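(* Let $\delta$ be an ordinal of uncountable cofinality, $A$ an abelian group, and $\mathcal{P}_A$ a presheaf of functions to $A$ on $\delta$. Then for every $n>0$ and every open cover $\mathcal{V}$ of $\delta$ refining $\mathcal{U}_\delta$, $\check{\mathrm{H}}^n(\delta,\mathcal{P}_A)\cong\mathrm{H}^n(\mathcal{V},\mathcal{P}_A)$. In particular, for all $n>0$, $\check{\mathrm{H}}^n(\delta,\mathcal{A}_d)\cong\check{\mathrm{H}}^n(\delta,\mathcal{D}_A)\cong\mathrm{H}^n(\mathcal{U}_\delta,\mathcal{D}_A)$, and each is naturally isomorphic to the group of $n$-coherent $A$-valued families indexed by $\delta$ modulo the subgroup of $n$-trivial ones.
   Context: Ordinals carry the order topology; each $\alpha<\delta$ is identified with its set of predecessors. $\mathcal{U}_\delta=\{\alpha\mid\alpha<\delta\}$. A presheaf of functions to $A$ assigns to each open $U$ a subgroup $\mathcal{P}_A(U)$ of the group (under pointwise addition) of all functions $U\to A$, with restriction of functions as restriction maps. $\mathcal{D}_A$: $U\mapsto\bigoplus_UA$ (finitely supported functions); $\mathcal{A}_d$: the sheaf of locally constant functions to $A$. A cover $\mathcal{V}$ refines $\mathcal{W}$ if each member of $\mathcal{V}$ is contained in some member of $\mathcal{W}$. For a cover $\mathcal{V}=\{V_\alpha\mid\alpha<\theta\}$, $\mathrm{H}^n(\mathcal{V},\mathcal{P})$ is the cohomology of the complex $L^j=\prod_{\vec\alpha\in[\theta]^{j+1}}\mathcal{P}(V_{\alpha_0}\cap\dots\cap V_{\alpha_j})$, $d^jf(\vec\alpha)=\sum_{i=0}^{j+1}(-1)^if(\vec\alpha^i)$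 (restricted), with $\vec\alpha^i$ the tuple with $i$-th coordinate deleted; $\check{\mathrm{H}}^n(X,\mathcal{P})=\varinjlim_{\mathcal{V}}\mathrm{H}^n(\mathcal{V},\mathcal{P})$ over open covers ordered by refinement. $f=^*g$ means $f,g$ differ at finitely many points (after restriction to the smaller domain). An $A$-valued family indexed by $\delta$ is $\Phi=\{\varphi_{\vec\alpha}:\alpha_0\to A\mid\vec\alpha\in[\delta]^n\}$; it is $n$-coherent if $\sum_{i=0}^n(-1)^i\varphi_{\vec\alpha^i}\restriction\alpha_0=^*0$ for all $\vec\alpha\in[\delta]^{n+1}$; it is $n$-trivial if ($n=1$) some $\varphi:\delta\to A$ has $\varphi\restriction\beta=^*\varphi_\beta$ for all $\beta$, or ($n>1$) some $\{\psi_{\vec\beta}:\beta_0\to A\mid\vec\beta\in[\delta]^{n-1}\}$ has $\sum_{i=0}^{n-1}(-1)^i\psi_{\vec\alpha^i}\restriction\alpha_0=^*\varphi_{\vec\alpha}$ for all $\vec\alpha\in[\delta]^n$.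
   Formalization: In the first assertion the presheaf is also assumed to satisfy the sheaf condition for two disjoint open sets; for arbitrary presheaves of functions it is false (e.g. all functions on {0}, zero on every other open set). The part on locally constant and finitely supported functions is unchanged. *)

theory Defs
  imports "HOL-Algebra.Product_Groups" "HOL-Algebra.FiniteProduct" "HOL-Library.Countable_Set" Complex_Main
begin

text \<open>
  Abelian groups are \<open>comm_group\<close>s and hence written multiplicatively: \<open>\<otimes>\<close>, \<open>\<one>\<close> and
  \<open>x [^] (-1)\<close> stand for \<open>+\<close>, \<open>0\<close> and \<open>-x\<close>.  A function from a set \<open>U\<close> to \<open>A\<close> is an element of
  \<open>U \<rightarrow>\<^sub>E carrier A\<close>, so restriction of functions is \<open>restrict\<close>, and \<open>product_group U (\<lambda>_. A)\<close> is the
  group of all functions from \<open>U\<close> to \<open>A\<close> under the pointwise operation.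

  An ordinal \<open>\<delta>\<close> is (the order type of) a type of sort \<open>{wellorder, linorder_topology}\<close>.  Its elements
  are the \<open>\<alpha> < \<delta>\<close>, the set of predecessors of \<open>\<alpha>\<close> is \<open>{..<\<alpha>}\<close>, and \<open>linorder_topology\<close> says that it
  carries the order topology.
\<close>

subsection \<open>Increasing tuples and alternating sums\<close>

text \<open>
  If \<open>r\<close> is a well-order of type \<open>\<theta>\<close>, this is \<open>[\<theta>]\<^sup>k\<close>.
\<close>
definition increasing_tuples :: "'i rel \<Rightarrow> nat \<Rightarrow> 'i list set" where
  "increasing_tuples r k =
     {xs. length xs = k \<and> set xs \<subseteq> Field r \<and> sorted_wrt (\<lambda>a b. (a, b) \<in> r \<and> a \<noteq> b) xs}"

definition delete_nth :: "nat \<Rightarrow> 'i list \<Rightarrow> 'i list" where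
  "delete_nth i xs = take i xs @ drop (Suc i) xs"

definition alternating_sum ::
    "'a monoid \<Rightarrow> ('i list \<Rightarrow> 'x \<Rightarrow> 'a) \<Rightarrow> 'i list \<Rightarrow> 'x \<Rightarrow> 'a" where
  "alternating_sum A f xs x =
     (\<Otimes>\<^bsub>A\<^esub> i\<in>{..<length xs}. f (delete_nth i xs) x [^]\<^bsub>A\<^esub> ((-1) ^ i :: int))"

subsection \<open>Presheaves of functions\<close>

definition presheaf_of_functions ::
    "'a monoid \<Rightarrow> ('x::topological_space set \<Rightarrow> ('x \<Rightarrow> 'a) set) \<Rightarrow> bool" where
  "presheaf_of_functions A P \<longleftrightarrow>
     (\<forall>U. open U \<longrightarrow> subgroup (P U) (product_group U (\<lambda>_. A))) \<and>
     (\<forall>U W. open U \<and> open W \<and> W \<subseteq> U \<longrightarrow> (\<forall>f\<in>P U. restrict f W \<in> P W))"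

text \<open>
  The sheaf condition for covers by two disjoint open sets.  It holds for every sheaf of functions, in
  particular for the locally constant functions, and for the presheaf of finitely supported functions.
  For arbitrary presheaves of functions, covers refining \<open>{{..<\<alpha>} | \<alpha>}\<close> can have different cohomology:
  if all functions on \<open>{0}\<close> but only the trivial section on every other open set are admitted, the
  cover by \<open>{0}\<close> and all \<open>{0<..\<gamma>}\<close> has no cohomology in degree 1, whereas the cover by \<open>{0, 1}\<close> and all
  \<open>{0} \<union> {1<..\<gamma>}\<close> with \<open>\<gamma> > 1\<close> has.
\<close>
definition disjointly_additive :: "('x::topological_space set \<Rightarrow> ('x \<Rightarrow> 'a) set) \<Rightarrow> bool" where
  "disjointly_additive P \<longleftrightarrow>
     (\<forall>U W f. open U \<and> open W \<and> U \<inter> W = {} \<and> f \<in> extensional (U \<union> W) \<and>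
        restrict f U \<in> P U \<and> restrict f W \<in> P W \<longrightarrow> f \<in> P (U \<union> W))"

definition finite_support_presheaf :: "'a monoid \<Rightarrow> 'x set \<Rightarrow> ('x \<Rightarrow> 'a) set" where
  "finite_support_presheaf A U = carrier (sum_group U (\<lambda>_. A))"

definition locally_constant_sheaf ::
    "'a monoid \<Rightarrow> 'x::topological_space set \<Rightarrow> ('x \<Rightarrow> 'a) set" where
  "locally_constant_sheaf A U =
     {f \<in> U \<rightarrow>\<^sub>E carrier A. \<forall>x\<in>U. \<exists>W. open W \<and> x \<in> W \<and> W \<subseteq> U \<and> (\<forall>y\<in>W. f y = f x)}"

subsection \<open>Cohomology of an enumerated cover\<close>

text \<open>
  A cover \<open>{V\<^sub>\<alpha> | \<alpha> < \<theta>}\<close> is given by a well-order \<open>r\<close> (of type \<open>\<theta>\<close>) on an index set \<open>Field r\<close>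
  together with the family \<open>V\<close>.
\<close>
definition enumerated_open_cover :: "'i rel \<Rightarrow> ('i \<Rightarrow> 'x::topological_space set) \<Rightarrow> bool" where
  "enumerated_open_cover r V \<longleftrightarrow>
     Well_order r \<and> (\<forall>i\<in>Field r. open (V i)) \<and> (\<Union>i\<in>Field r. V i) = UNIV"

definition refines :: "'x set set \<Rightarrow> 'x set set \<Rightarrow> bool" where
  "refines \<V> \<W> \<longleftrightarrow> (\<forall>V\<in>\<V>. \<exists>W\<in>\<W>. V \<subseteq> W)"

definition overlap :: "('i \<Rightarrow> 'x set) \<Rightarrow> 'i list \<Rightarrow> 'x set" where
  "overlap V xs = (\<Inter>i\<in>set xs. V i)"

definition sections :: "'a monoid \<Rightarrow> ('x set \<Rightarrow> ('x \<Rightarrow> 'a) set) \<Rightarrow> 'x set \<Rightarrow> ('x \<Rightarrow> 'a) monoid" where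
  "sections A P U = (product_group U (\<lambda>_. A))\<lparr>carrier := P U\<rparr>"

definition cochains ::
    "'a monoid \<Rightarrow> ('x set \<Rightarrow> ('x \<Rightarrow> 'a) set) \<Rightarrow> 'i rel \<Rightarrow> ('i \<Rightarrow> 'x set) \<Rightarrow> nat
      \<Rightarrow> ('i list \<Rightarrow> 'x \<Rightarrow> 'a) monoid" where
  "cochains A P r V j = product_group (increasing_tuples r (j + 1)) (\<lambda>xs. sections A P (overlap V xs))"

definition coboundary_map ::
    "'a monoid \<Rightarrow> 'i rel \<Rightarrow> ('i \<Rightarrow> 'x set) \<Rightarrow> nat \<Rightarrow> ('i list \<Rightarrow> 'x \<Rightarrow> 'a) \<Rightarrow> ('i list \<Rightarrow> 'x \<Rightarrow> 'a)" where
  "coboundary_map A r V j f =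
     (\<lambda>xs\<in>increasing_tuples r (j + 2). \<lambda>x\<in>overlap V xs. alternating_sum A f xs x)"

definition cocycles ::
    "'a monoid \<Rightarrow> ('x set \<Rightarrow> ('x \<Rightarrow> 'a) set) \<Rightarrow> 'i rel \<Rightarrow> ('i \<Rightarrow> 'x set) \<Rightarrow> nat
      \<Rightarrow> ('i list \<Rightarrow> 'x \<Rightarrow> 'a) set" where
  "cocycles A P r V n =
     kernel (cochains A P r V n) (cochains A P r V (n + 1)) (coboundary_map A r V n)"

definition coboundaries ::
    "'a monoid \<Rightarrow> ('x set \<Rightarrow> ('x \<Rightarrow> 'a) set) \<Rightarrow> 'i rel \<Rightarrow> ('i \<Rightarrow> 'x set) \<Rightarrow> nat
      \<Rightarrow> ('i list \<Rightarrow> 'x \<Rightarrow> 'a) set" where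
  "coboundaries A P r V n =
     (if n = 0 then {\<one>\<^bsub>cochains A P r V 0\<^esub>}
      else coboundary_map A r V (n - 1) ` carrier (cochains A P r V (n - 1)))"

definition cover_cohomology ::
    "nat \<Rightarrow> 'a monoid \<Rightarrow> ('x set \<Rightarrow> ('x \<Rightarrow> 'a) set) \<Rightarrow> 'i rel \<Rightarrow> ('i \<Rightarrow> 'x set)
      \<Rightarrow> ('i list \<Rightarrow> 'x \<Rightarrow> 'a) set monoid" where
  "cover_cohomology n A P r V =
     (cochains A P r V n)\<lparr>carrier := cocycles A P r V n\<rparr> Mod coboundaries A P r V n"

text \<open>
  The map of quotient groups induced by \<open>\<phi>\<close>, where \<open>G Mod B\<close> is the target: \<open>[f] \<mapsto> [\<phi> f]\<close>.
  The union is over the representatives \<open>f\<close> of the class \<open>c\<close>, which all yield the same coset.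
\<close>
definition induced_map :: "('b, 'm) monoid_scheme \<Rightarrow> 'b set \<Rightarrow> ('c \<Rightarrow> 'b) \<Rightarrow> 'c set \<Rightarrow> 'b set" where
  "induced_map G B \<phi> c = (\<Union>f\<in>c. B #>\<^bsub>G\<^esub> \<phi> f)"

subsection \<open>Cech cohomology\<close>

text \<open>
  A refinement function \<open>\<rho>\<close> need not preserve the order of the indices, so pulling back a cochain \<open>f\<close>
  (defined on increasing tuples only) along \<open>\<rho>\<close> uses the alternating extension of \<open>f\<close>: its value at a
  tuple without repetitions is the value of \<open>f\<close> at the sorted tuple times the sign of the sorting
  permutation (the parity of the number of inversions); at tuples with repetitions it is trivial.
\<close>
definition alternating_extension ::
    "'a monoid \<Rightarrow> 'i rel \<Rightarrow> ('i list \<Rightarrow> 'x \<Rightarrow> 'a) \<Rightarrow> 'i list \<Rightarrow> 'x \<Rightarrow> 'a" where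
  "alternating_extension A s f ys x =
     (if distinct ys
      then f (THE zs. zs \<in> increasing_tuples s (length ys) \<and> set zs = set ys) x [^]\<^bsub>A\<^esub>
             ((-1) ^ card {(i, j). i < j \<and> j < length ys \<and> (ys ! j, ys ! i) \<in> s} :: int)
      else \<one>\<^bsub>A\<^esub>)"

definition pullback ::
    "'a monoid \<Rightarrow> 'j rel \<Rightarrow> 'i rel \<Rightarrow> ('i \<Rightarrow> 'x set) \<Rightarrow> nat \<Rightarrow> ('i \<Rightarrow> 'j)
      \<Rightarrow> ('j list \<Rightarrow> 'x \<Rightarrow> 'a) \<Rightarrow> ('i list \<Rightarrow> 'x \<Rightarrow> 'a)" where
  "pullback A s r V n \<rho> f =
     (\<lambda>xs\<in>increasing_tuples r (n + 1). \<lambda>x\<in>overlap V xs. alternating_extension A s f (map \<rho> xs) x)"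

definition open_covers :: "'x::topological_space set set set" where
  "open_covers = {\<V>. (\<forall>V\<in>\<V>. open V) \<and> \<Union>\<V> = UNIV}"

text \<open>
  For the direct limit each cover, as a set of open sets, is enumerated without repetitions along an
  arbitrary well-order of it; different choices give canonically isomorphic groups.
\<close>
definition chosen_order :: "'x set set \<Rightarrow> 'x set rel" where
  "chosen_order \<V> = (SOME r. well_order_on \<V> r)"

text \<open>
  On cohomology the map induced by a refinement function does not depend on its choice.
\<close>
definition refinement_function :: "'x set set \<Rightarrow> 'x set set \<Rightarrow> 'x set \<Rightarrow> 'x set" where
  "refinement_function \<V> \<W> = (SOME \<rho>. \<forall>V\<in>\<V>. \<rho> V \<in> \<W> \<and> V \<subseteq> \<rho> V)"

definition set_cover_cohomology ::
    "nat \<Rightarrow> 'a monoid \<Rightarrow> ('x set \<Rightarrow> ('x \<Rightarrow> 'a) set) \<Rightarrow> 'x set set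
      \<Rightarrow> ('x set list \<Rightarrow> 'x \<Rightarrow> 'a) set monoid" where
  "set_cover_cohomology n A P \<V> = cover_cohomology n A P (chosen_order \<V>) id"

definition refinement_map ::
    "nat \<Rightarrow> 'a monoid \<Rightarrow> ('x set \<Rightarrow> ('x \<Rightarrow> 'a) set) \<Rightarrow> 'x set set \<Rightarrow> 'x set set
      \<Rightarrow> ('x set list \<Rightarrow> 'x \<Rightarrow> 'a) set \<Rightarrow> ('x set list \<Rightarrow> 'x \<Rightarrow> 'a) set" where
  "refinement_map n A P \<W> \<V> =
     induced_map (cochains A P (chosen_order \<V>) id n) (coboundaries A P (chosen_order \<V>) id n)
       (pullback A (chosen_order \<W>) (chosen_order \<V>) id n (refinement_function \<V> \<W>))"

text \<open>
  The direct limit of the groups \<open>G j\<close>, \<open>j \<in> J\<close>, over the directed preorder \<open>below\<close> with transition maps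
  \<open>\<phi> i j : G i \<rightarrow> G j\<close> for \<open>below i j\<close>: the disjoint union of the groups modulo the relation of being
  identified at some later stage.
\<close>
definition limit_rel ::
    "'j set \<Rightarrow> ('j \<Rightarrow> 'j \<Rightarrow> bool) \<Rightarrow> ('j \<Rightarrow> 'b monoid) \<Rightarrow> ('j \<Rightarrow> 'j \<Rightarrow> 'b \<Rightarrow> 'b) \<Rightarrow> ('j \<times> 'b) rel" where
  "limit_rel J below G \<phi> =
     {((i, x), (j, y)). i \<in> J \<and> x \<in> carrier (G i) \<and> j \<in> J \<and> y \<in> carrier (G j) \<and>
        (\<exists>k\<in>J. below i k \<and> below j k \<and> \<phi> i k x = \<phi> j k y)}"

definition direct_limit ::
    "'j set \<Rightarrow> ('j \<Rightarrow> 'j \<Rightarrow> bool) \<Rightarrow> ('j \<Rightarrow> 'b monoid) \<Rightarrow> ('j \<Rightarrow> 'j \<Rightarrow> 'b \<Rightarrow> 'b) \<Rightarrow> ('j \<times> 'b) set monoid" where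
  "direct_limit J below G \<phi> =
     \<lparr>carrier = (SIGMA j:J. carrier (G j)) // limit_rel J below G \<phi>,
      mult = (\<lambda>X Y. \<Union>(i, x)\<in>X. \<Union>(j, y)\<in>Y. \<Union>k\<in>{k\<in>J. below i k \<and> below j k}.
                limit_rel J below G \<phi> `` {(k, \<phi> i k x \<otimes>\<^bsub>G k\<^esub> \<phi> j k y)}),
      one = (\<Union>j\<in>J. limit_rel J below G \<phi> `` {(j, \<one>\<^bsub>G j\<^esub>)})\<rparr>"

definition cech_cohomology ::
    "nat \<Rightarrow> 'a monoid \<Rightarrow> ('x::topological_space set \<Rightarrow> ('x \<Rightarrow> 'a) set)
      \<Rightarrow> ('x set set \<times> ('x set list \<Rightarrow> 'x \<Rightarrow> 'a) set) set monoid" where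
  "cech_cohomology n A P =
     direct_limit open_covers (\<lambda>\<W> \<V>. refines \<V> \<W>) (set_cover_cohomology n A P) (refinement_map n A P)"

subsection \<open>Change of coefficients\<close>

definition cochain_change ::
    "'i rel \<Rightarrow> ('i \<Rightarrow> 'x set) \<Rightarrow> nat \<Rightarrow> ('a \<Rightarrow> 'a) \<Rightarrow> ('i list \<Rightarrow> 'x \<Rightarrow> 'a) \<Rightarrow> ('i list \<Rightarrow> 'x \<Rightarrow> 'a)" where
  "cochain_change r V n h f = (\<lambda>xs\<in>increasing_tuples r (n + 1). \<lambda>x\<in>overlap V xs. h (f xs x))"

text \<open>
  In the next two definitions \<open>\<P>\<close> assigns to each group a presheaf of functions to it; \<open>B\<close> is the
  target of \<open>h\<close>.
\<close>
definition cover_cohomology_change ::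
    "nat \<Rightarrow> ('a monoid \<Rightarrow> 'x set \<Rightarrow> ('x \<Rightarrow> 'a) set) \<Rightarrow> 'i rel \<Rightarrow> ('i \<Rightarrow> 'x set) \<Rightarrow> 'a monoid \<Rightarrow> ('a \<Rightarrow> 'a)
      \<Rightarrow> ('i list \<Rightarrow> 'x \<Rightarrow> 'a) set \<Rightarrow> ('i list \<Rightarrow> 'x \<Rightarrow> 'a) set" where
  "cover_cohomology_change n \<P> r V B h =
     induced_map (cochains B (\<P> B) r V n) (coboundaries B (\<P> B) r V n) (cochain_change r V n h)"

definition cech_cohomology_change ::
    "nat \<Rightarrow> ('a monoid \<Rightarrow> 'x::topological_space set \<Rightarrow> ('x \<Rightarrow> 'a) set) \<Rightarrow> 'a monoid \<Rightarrow> ('a \<Rightarrow> 'a)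
      \<Rightarrow> ('x set set \<times> ('x set list \<Rightarrow> 'x \<Rightarrow> 'a) set) set
      \<Rightarrow> ('x set set \<times> ('x set list \<Rightarrow> 'x \<Rightarrow> 'a) set) set" where
  "cech_cohomology_change n \<P> B h X =
     (\<Union>(\<V>, c)\<in>X.
        limit_rel open_covers (\<lambda>\<W> \<V>. refines \<V> \<W>)
            (set_cover_cohomology n B (\<P> B)) (refinement_map n B (\<P> B))
          `` {(\<V>, cover_cohomology_change n \<P> (chosen_order \<V>) id B h c)})"

text \<open>
  \<open>F\<close> and \<open>G\<close> are functors from the abelian groups with elements in \<open>'a\<close> to groups; \<open>Fmap B h\<close> and
  \<open>Gmap B h\<close> are their actions on a homomorphism \<open>h\<close> with target \<open>B\<close>.
\<close>
definition naturally_isomorphic ::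
    "('a monoid \<Rightarrow> 'b monoid) \<Rightarrow> ('a monoid \<Rightarrow> ('a \<Rightarrow> 'a) \<Rightarrow> 'b \<Rightarrow> 'b)
      \<Rightarrow> ('a monoid \<Rightarrow> 'c monoid) \<Rightarrow> ('a monoid \<Rightarrow> ('a \<Rightarrow> 'a) \<Rightarrow> 'c \<Rightarrow> 'c) \<Rightarrow> bool" where
  "naturally_isomorphic F Fmap G Gmap \<longleftrightarrow>
     (\<exists>\<theta>. (\<forall>A. comm_group A \<longrightarrow> \<theta> A \<in> iso (F A) (G A)) \<and>
          (\<forall>A B h. comm_group A \<and> comm_group B \<and> h \<in> hom A B \<longrightarrow>
             (\<forall>x\<in>carrier (F A). \<theta> B (Fmap B h x) = Gmap B h (\<theta> A x))))"

subsection \<open>Ordinals and coherent families\<close>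

definition uncountable_cofinality :: "'d::wellorder itself \<Rightarrow> bool" where
  "uncountable_cofinality _ \<longleftrightarrow> (\<forall>C::'d set. (\<forall>a. \<exists>c\<in>C. a \<le> c) \<longrightarrow> uncountable C)"

definition ordinal_rel :: "'d::wellorder rel" where
  "ordinal_rel = {(a, b). a \<le> b}"

definition families :: "'a monoid \<Rightarrow> nat \<Rightarrow> ('d::wellorder list \<Rightarrow> 'd \<Rightarrow> 'a) monoid" where
  "families A n = product_group (increasing_tuples ordinal_rel n) (\<lambda>xs. product_group {..<hd xs} (\<lambda>_. A))"

definition coherent_families :: "'a monoid \<Rightarrow> nat \<Rightarrow> ('d::wellorder list \<Rightarrow> 'd \<Rightarrow> 'a) set" where
  "coherent_families A n =
     {\<Phi> \<in> carrier (families A n). \<forall>xs\<in>increasing_tuples ordinal_rel (n + 1).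
        finite {x \<in> {..<hd xs}. alternating_sum A \<Phi> xs x \<noteq> \<one>\<^bsub>A\<^esub>}}"

definition trivial_families :: "'a monoid \<Rightarrow> nat \<Rightarrow> ('d::wellorder list \<Rightarrow> 'd \<Rightarrow> 'a) set" where
  "trivial_families A n =
     {\<Phi> \<in> carrier (families A n).
        if n = 1
        then \<exists>\<phi>\<in>UNIV \<rightarrow> carrier A. \<forall>b. finite {x \<in> {..<b}. \<phi> x \<noteq> \<Phi> [b] x}
        else \<exists>\<Psi>\<in>carrier (families A (n - 1)). \<forall>xs\<in>increasing_tuples ordinal_rel n.
               finite {x \<in> {..<hd xs}. alternating_sum A \<Psi> xs x \<noteq> \<Phi> xs x}}"

definition coherent_mod_trivial ::
    "nat \<Rightarrow> 'a monoid \<Rightarrow> ('d::wellorder list \<Rightarrow> 'd \<Rightarrow> 'a) set monoid" where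
  "coherent_mod_trivial n A =
     (families A n)\<lparr>carrier := coherent_families A n\<rparr> Mod trivial_families A n"

definition coherent_mod_trivial_change ::
    "nat \<Rightarrow> 'a monoid \<Rightarrow> ('a \<Rightarrow> 'a)
      \<Rightarrow> ('d::wellorder list \<Rightarrow> 'd \<Rightarrow> 'a) set \<Rightarrow> ('d list \<Rightarrow> 'd \<Rightarrow> 'a) set" where
  "coherent_mod_trivial_change n B h =
     induced_map (families B n) (trivial_families B n)
       (\<lambda>\<Phi>. \<lambda>xs\<in>increasing_tuples ordinal_rel n. \<lambda>x\<in>{..<hd xs}. h (\<Phi> xs x))"

end

theory Submission
  imports Defs
begin

text \<open>
  At a fixed point \<open>x\<close>, a cochain of a cover extends to an alternating function of tuples of members
  containing \<open>x\<close>, so it can be pulled back along a refinement that is chosen separately at each \<open>x\<close>.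
  If the chosen refinement function takes finitely many values as \<open>x\<close> varies, each on a clopen set, then
  a presheaf with the sheaf condition for two disjoint open sets admits these pullbacks, and the prism
  operator shows that any two of them agree on cohomology.  Hence covers that refine each other in this
  piecewise sense have the same cohomology.

  In an ordinal of uncountable cofinality, for each open cover there is \<open>\<gamma>\<close> such that all bounded subsets
  of \<open>{\<gamma><..}\<close> are contained in a member; and the compact set \<open>{..\<gamma>}\<close> is partitioned into finitely
  many clopen sets each contained in a member.  So every cover by bounded sets piecewise refines every
  open cover, and the direct limit is attained at each such cover.

  The complex of all functions on the cover by the \<open>{..<\<alpha>}\<close> is exact.  A family of functions is coherent if
  its coboundary is finitely supported, and taking the coboundary identifies coherent modulo trivial
  families with the cohomology of the finitely supported functions one degree higher.
\<close>

section \<open>Alternating functions of tuples\<close>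

text \<open>A cover by bounded sets need not refine a given open cover \<W>: a member that straddles
  the threshold \<gamma> may lie in no member of \<W>. An ordinary refinement function is then
  missing, which is why the index in \<W> may depend on the point and why additivity over disjoint
  open sets is asked of the presheaf. The pulled back index tuples are unsorted in a way that varies
  with the point; the alternating extension absorbs the signs, and it is determined by its values at
  increasing tuples.

  On \<open>{..a}\<close> a locally constant function has finitely many jumps, and these form an
  arbitrary finitely supported function on \<open>{..<a}\<close>. On \<open>{..<a}\<close> itself,
  for a limit a, there can be infinitely many. So the two presheaves are compared on different
  covers, \<open>atMost\<close> and \<open>lessThan\<close>, both of which compute Cech cohomology.
  What the jumps forget is a constant, and constants have no cohomology in positive degrees, since
  all members share the least element.

  Naturality follows from the form of the isomorphisms: each is, up to inversion, induced by a
  formula on cochains that commutes with homomorphisms of the coefficients.\<close>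

primrec asum :: "('a, 'm) monoid_scheme \<Rightarrow> 'i list \<Rightarrow> ('i list \<Rightarrow> 'a) \<Rightarrow> 'a" where
  "asum G [] f = \<one>\<^bsub>G\<^esub>"
| "asum G (y # ys) f = f ys \<otimes>\<^bsub>G\<^esub> inv\<^bsub>G\<^esub> asum G ys (\<lambda>zs. f (y # zs))"

text \<open>Unfolded, this is the classical prism operator: the sum over i, with sign
  \<open>(-1) ^ i\<close>, of \<open>f\<close> at the tuple that follows \<open>\<rho>\<close> up to
  position i and \<open>\<sigma>\<close> from position i on, so that position i occurs
  twice.\<close>

primrec prism ::
    "('a, 'm) monoid_scheme \<Rightarrow> ('i \<Rightarrow> 'j) \<Rightarrow> ('i \<Rightarrow> 'j) \<Rightarrow> 'i list \<Rightarrow> ('j list \<Rightarrow> 'a) \<Rightarrow> 'a" where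
  "prism G \<rho> \<sigma> [] f = \<one>\<^bsub>G\<^esub>"
| "prism G \<rho> \<sigma> (y # ys) f =
     f (\<rho> y # \<sigma> y # map \<sigma> ys) \<otimes>\<^bsub>G\<^esub> inv\<^bsub>G\<^esub> prism G \<rho> \<sigma> ys (\<lambda>zs. f (\<rho> y # zs))"

text \<open>Adjacent entries suffice, because every tuple can be sorted by adjacent swaps.
  Triviality at repetitions is a separate clause: the sign rule alone only makes the value there
  equal to its own inverse.\<close>

definition alternating :: "('a, 'm) monoid_scheme \<Rightarrow> ('i list \<Rightarrow> 'a) \<Rightarrow> bool" where
  "alternating G f \<longleftrightarrow> range f \<subseteq> carrier G \<and>
     (\<forall>us a b vs. f (us @ a # b # vs) = inv\<^bsub>G\<^esub> f (us @ b # a # vs)) \<and>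
     (\<forall>us a vs. f (us @ a # a # vs) = \<one>\<^bsub>G\<^esub>)"

lemma delete_nth_0 [simp]: "delete_nth 0 (y # ys) = ys"
  and delete_nth_Suc [simp]: "delete_nth (Suc i) (y # ys) = y # delete_nth i ys"
  by (auto simp: delete_nth_def)

lemma length_delete_nth: "i < length ys \<Longrightarrow> length (delete_nth i ys) = length ys - 1"
  by (auto simp: delete_nth_def)

lemma set_delete_nth: "set (delete_nth i ys) \<subseteq> set ys"
  by (auto simp: delete_nth_def dest: in_set_takeD in_set_dropD)

lemma delete_nth_increasing_tuples:
  assumes "xs \<in> increasing_tuples r (Suc k)" "i < Suc k"
  shows "delete_nth i xs \<in> increasing_tuples r k"
proof -
  have len: "length xs = Suc k" and srt: "sorted_wrt (\<lambda>a b. (a, b) \<in> r \<and> a \<noteq> b) xs"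
    and sub: "set xs \<subseteq> Field r"
    using assms by (auto simp: increasing_tuples_def)
  have "sorted_wrt (\<lambda>a b. (a, b) \<in> r \<and> a \<noteq> b) (take i xs @ xs ! i # drop (Suc i) xs)"
    using srt assms(2) len by (simp add: id_take_nth_drop[symmetric])
  then have "sorted_wrt (\<lambda>a b. (a, b) \<in> r \<and> a \<noteq> b) (delete_nth i xs)"
    by (auto simp: delete_nth_def sorted_wrt_append)
  moreover have "length (delete_nth i xs) = k" "set (delete_nth i xs) \<subseteq> Field r"
    using len assms(2) sub set_delete_nth[of i xs] by (auto simp: length_delete_nth)
  ultimately show ?thesis by (simp add: increasing_tuples_def)
qed

context comm_group
begin

lemma cancel_middle:
  assumes "x \<in> carrier G" "y \<in> carrier G"
  shows "x \<otimes> (inv x \<otimes> y) = y" "inv x \<otimes> (x \<otimes> y) = y"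
  using assms by (simp_all add: m_assoc[symmetric])

lemma asum_closed [simp, intro]:
  assumes "range f \<subseteq> carrier G" shows "asum G ys f \<in> carrier G"
  using assms
proof (induction ys arbitrary: f)
  case (Cons y ys)
  have "asum G ys (\<lambda>zs. f (y # zs)) \<in> carrier G" using Cons.prems by (intro Cons.IH) auto
  then show ?case using Cons.prems by auto
qed auto

lemma asum_one [simp]: "asum G ys (\<lambda>_. \<one>) = \<one>"
  by (induction ys) auto

lemma asum_mult:
  assumes "range f \<subseteq> carrier G" "range g \<subseteq> carrier G"
  shows "asum G ys (\<lambda>zs. f zs \<otimes> g zs) = asum G ys f \<otimes> asum G ys g"
  using assms
proof (induction ys arbitrary: f g)
  case (Cons y ys)
  have [simp]: "asum G ys (\<lambda>zs. f (y # zs)) \<in> carrier G" "asum G ys (\<lambda>zs. g (y # zs)) \<in> carrier G"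
    "f ys \<in> carrier G" "g ys \<in> carrier G"
    using Cons.prems by (auto intro!: asum_closed)
  have "asum G ys (\<lambda>zs. f (y # zs) \<otimes> g (y # zs)) =
      asum G ys (\<lambda>zs. f (y # zs)) \<otimes> asum G ys (\<lambda>zs. g (y # zs))"
    using Cons.prems by (intro Cons.IH) auto
  then show ?case by (simp add: inv_mult m_ac)
qed auto

lemma asum_inv:
  assumes "range f \<subseteq> carrier G"
  shows "asum G ys (\<lambda>zs. inv f zs) = inv asum G ys f"
proof (rule inv_equality[symmetric])
  have "asum G ys (\<lambda>zs. inv f zs) \<otimes> asum G ys f = asum G ys (\<lambda>zs. inv f zs \<otimes> f zs)"
    using assms by (subst asum_mult) auto
  also have "\<dots> = asum G ys (\<lambda>_. \<one>)"
    using assms by (simp add: image_subset_iff)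
  finally show "asum G ys (\<lambda>zs. inv f zs) \<otimes> asum G ys f = \<one>" by simp
qed (use assms in auto)

lemma asum_map: "asum G (map \<rho> ys) f = asum G ys (\<lambda>zs. f (map \<rho> zs))"
  by (induction ys arbitrary: f) auto

lemma asum_hom:
  assumes "comm_group H" "h \<in> hom G H" "range f \<subseteq> carrier G"
  shows "h (asum G ys f) = asum H ys (\<lambda>zs. h (f zs))"
  using assms(3)
proof (induction ys arbitrary: f)
  interpret H: comm_group H by fact
  interpret h: group_hom G H h using assms(2) by unfold_locales
  case (Cons y ys)
  have "h (asum G ys (\<lambda>zs. f (y # zs))) = asum H ys (\<lambda>zs. h (f (y # zs)))"
    using Cons.prems by (intro Cons.IH) auto
  moreover have "asum G ys (\<lambda>zs. f (y # zs)) \<in> carrier G" "f ys \<in> carrier G"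
    using Cons.prems by auto
  ultimately show ?case by simp
qed (use assms in \<open>simp add: hom_one comm_group.axioms group.is_monoid\<close>)

text \<open>Splitting off the first entry leaves \<open>asum G ys f\<close> twice, with opposite
  signs, and a double sum over the shorter tuple that is trivial by induction. This is the square of
  the coboundary at a single point.\<close>

lemma asum_asum:
  assumes "range f \<subseteq> carrier G"
  shows "asum G ys (\<lambda>zs. asum G zs f) = \<one>"
  using assms
proof (induction ys arbitrary: f)
  case (Cons y ys)
  have r: "range (\<lambda>zs. f (y # zs)) \<subseteq> carrier G" using Cons.prems by auto
  then have "asum G ys (\<lambda>zs. asum G (y # zs) f) =
      asum G ys f \<otimes> inv asum G ys (\<lambda>zs. asum G zs (\<lambda>zs. f (y # zs)))"
    using Cons.prems by (simp add: asum_mult asum_inv image_subset_iff)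
  then show ?case using Cons.prems Cons.IH[OF r] r by (simp)
qed auto

lemma alternating_range: "alternating G f \<Longrightarrow> range f \<subseteq> carrier G"
  unfolding alternating_def by blast

lemma alternating_closed: "alternating G f \<Longrightarrow> f zs \<in> carrier G"
  using alternating_range by blast

lemma alternating_swap: "alternating G f \<Longrightarrow> f (us @ a # b # vs) = inv f (us @ b # a # vs)"
  unfolding alternating_def by blast

lemma alternating_repeat: "alternating G f \<Longrightarrow> f (us @ a # a # vs) = \<one>"
  unfolding alternating_def by blast

lemma alternatingI:
  assumes "\<And>zs. f zs \<in> carrier G"
    and "\<And>us a b vs. f (us @ a # b # vs) = inv f (us @ b # a # vs)"
    and "\<And>us a vs. f (us @ a # a # vs) = \<one>"
  shows "alternating G f"
  unfolding alternating_def using assms by blast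

lemma alternating_Cons: 
  assumes "alternating G f" shows "alternating G (\<lambda>zs. f (y # zs))"
proof (rule alternatingI)
  fix us vs and a b
  show "f (y # us @ a # b # vs) = inv f (y # us @ b # a # vs)"
    using alternating_swap[OF assms, of "y # us" a b vs] by (simp only: append_Cons)
  show "f (y # us @ a # a # vs) = \<one>"
    using alternating_repeat[OF assms, of "y # us" a vs] by (simp only: append_Cons)
qed (rule alternating_closed[OF assms])

lemma alternating_map:
  assumes "alternating G f" shows "alternating G (\<lambda>zs. f (map \<rho> zs))"
proof (rule alternatingI)
  fix us vs and a b
  show "f (map \<rho> (us @ a # b # vs)) = inv f (map \<rho> (us @ b # a # vs))"
    unfolding map_append list.map by (rule alternating_swap[OF assms])
  show "f (map \<rho> (us @ a # a # vs)) = \<one>"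
    unfolding map_append list.map by (rule alternating_repeat[OF assms])
qed (rule alternating_closed[OF assms])

text \<open>Needed to compare coboundaries of alternating extensions at increasing tuples only.
  Behind a common prefix the claim passes to \<open>f\<close> with its first entry fixed; at the
  front, the terms that delete \<open>a\<close> and \<open>b\<close> trade places with opposite
  signs.\<close>

lemma asum_alternating:
  assumes "alternating G f" shows "alternating G (\<lambda>ys. asum G ys f)"
proof -
  have "asum G (us @ a # b # vs) f = inv asum G (us @ b # a # vs) f
        \<and> asum G (us @ a # a # vs) f = \<one>" for us a b vs
    using assms
  proof (induction us arbitrary: f)
    case Nil
    note alt = Nil
    have "asum G vs (\<lambda>zs. f (a # b # zs)) = asum G vs (\<lambda>zs. inv f (b # a # zs))"
      using alternating_swap[OF alt, of "[]" a b] by (simp only: append_Nil)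
    also have "\<dots> = inv asum G vs (\<lambda>zs. f (b # a # zs))"
      using alternating_closed[OF alt] by (intro asum_inv) auto
    finally have 1: "asum G vs (\<lambda>zs. f (a # b # zs)) = inv asum G vs (\<lambda>zs. f (b # a # zs))" .
    have 2: "asum G vs (\<lambda>zs. f (a # a # zs)) = \<one>"
      using alternating_repeat[OF alt, of "[]" a] by (simp only: append_Nil asum_one)
    have [simp]: "asum G vs (\<lambda>zs. f (b # a # zs)) \<in> carrier G"
      using alternating_closed[OF alt] by (intro asum_closed) auto
    show ?case using alternating_closed[OF alt] by (simp add: 1 2 inv_mult m_ac)
  next
    case (Cons u us)
    have alt: "alternating G (\<lambda>zs. f (u # zs))" using Cons.prems by (rule alternating_Cons)
    have c: "asum G zs (\<lambda>zs. f (u # zs)) \<in> carrier G" for zs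
      using alt by (intro asum_closed alternating_range)
    have s: "f (us @ a # b # vs) = inv f (us @ b # a # vs)" "f (us @ a # a # vs) = \<one>"
      using Cons.prems by (rule alternating_swap, rule alternating_repeat)
    note IH = Cons.IH[OF alt, THEN conjunct1] Cons.IH[OF alt, THEN conjunct2]
    show ?case
      unfolding append_Cons asum.simps s IH
      using c alternating_closed[OF Cons.prems] by (simp add: inv_mult)
  qed
  then show ?thesis using asum_closed[OF alternating_range[OF assms]] by (intro alternatingI) blast+
qed

section \<open>The prism operator of two index maps\<close>

lemma prism_closed [simp, intro]:
  assumes "range f \<subseteq> carrier G" shows "prism G \<rho> \<sigma> ys f \<in> carrier G"
  using assms
proof (induction ys arbitrary: f)
  case (Cons y ys)
  have "prism G \<rho> \<sigma> ys (\<lambda>zs. f (\<rho> y # zs)) \<in> carrier G" using Cons.prems by (intro Cons.IH) auto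
  then show ?case using Cons.prems by auto
qed auto

lemma prism_one [simp]: "prism G \<rho> \<sigma> ys (\<lambda>_. \<one>) = \<one>"
  by (induction ys) auto

lemma prism_mult:
  assumes "range f \<subseteq> carrier G" "range g \<subseteq> carrier G"
  shows "prism G \<rho> \<sigma> ys (\<lambda>zs. f zs \<otimes> g zs) = prism G \<rho> \<sigma> ys f \<otimes> prism G \<rho> \<sigma> ys g"
  using assms
proof (induction ys arbitrary: f g)
  case (Cons y ys)
  have [simp]: "prism G \<rho> \<sigma> ys (\<lambda>zs. f (\<rho> y # zs)) \<in> carrier G"
    "prism G \<rho> \<sigma> ys (\<lambda>zs. g (\<rho> y # zs)) \<in> carrier G" "f zs \<in> carrier G" "g zs \<in> carrier G" for zs
    using Cons.prems by (auto intro!: prism_closed)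
  have "prism G \<rho> \<sigma> ys (\<lambda>zs. f (\<rho> y # zs) \<otimes> g (\<rho> y # zs)) =
      prism G \<rho> \<sigma> ys (\<lambda>zs. f (\<rho> y # zs)) \<otimes> prism G \<rho> \<sigma> ys (\<lambda>zs. g (\<rho> y # zs))"
    using Cons.prems by (intro Cons.IH) auto
  then show ?case by (simp add: inv_mult m_ac)
qed auto

lemma prism_inv:
  assumes "range f \<subseteq> carrier G"
  shows "prism G \<rho> \<sigma> ys (\<lambda>zs. inv f zs) = inv prism G \<rho> \<sigma> ys f"
proof (rule inv_equality[symmetric])
  have "prism G \<rho> \<sigma> ys (\<lambda>zs. inv f zs) \<otimes> prism G \<rho> \<sigma> ys f = prism G \<rho> \<sigma> ys (\<lambda>zs. inv f zs \<otimes> f zs)"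
    using assms by (subst prism_mult) auto
  also have "\<dots> = prism G \<rho> \<sigma> ys (\<lambda>_. \<one>)"
    using assms by (simp add: image_subset_iff)
  finally show "prism G \<rho> \<sigma> ys (\<lambda>zs. inv f zs) \<otimes> prism G \<rho> \<sigma> ys f = \<one>" by simp
qed (use assms in auto)

text \<open>The homotopy formula dP + Pd = \<sigma> - \<rho>. It holds for every function,
  alternating or not, so induction applies to \<open>f\<close> with its first entry fixed at
  \<open>\<rho> y\<close>.\<close>

lemma prism_homotopy:
  assumes "range f \<subseteq> carrier G"
  shows "asum G ys (\<lambda>zs. prism G \<rho> \<sigma> zs f) \<otimes> prism G \<rho> \<sigma> ys (\<lambda>zs. asum G zs f) =
    f (map \<sigma> ys) \<otimes> inv f (map \<rho> ys)"
  using assms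
proof (induction ys arbitrary: f)
  case (Cons y ys)
  define f1 where "f1 = (\<lambda>zs. f (\<rho> y # zs))"
  define f2 where "f2 = (\<lambda>zs. f (\<rho> y # \<sigma> y # zs))"
  have r: "range f1 \<subseteq> carrier G" "range f2 \<subseteq> carrier G" "range f \<subseteq> carrier G"
    using Cons.prems by (auto simp: f1_def f2_def)
  then have r': "f1 zs \<in> carrier G" "f2 zs \<in> carrier G" "f zs \<in> carrier G" for zs by auto
  \<comment> \<open>\<open>D\<close> and \<open>K\<close> occur in both summands with opposite signs
    and cancel; \<open>E\<close> and \<open>L\<close> are the two terms of the induction hypothesis
    for \<open>f1\<close>.\<close>
  define D where "D = asum G ys (\<lambda>zs. f2 (map \<sigma> zs))"
  define E where "E = asum G ys (\<lambda>zs. prism G \<rho> \<sigma> zs f1)"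
  define K where "K = prism G \<rho> \<sigma> ys f"
  define L where "L = prism G \<rho> \<sigma> ys (\<lambda>zs. asum G zs f1)"
  have c [simp]: "D \<in> carrier G" "E \<in> carrier G" "K \<in> carrier G" "L \<in> carrier G"
    using r unfolding D_def E_def K_def L_def by (auto intro!: asum_closed prism_closed)
  have IH: "E \<otimes> L = f1 (map \<sigma> ys) \<otimes> inv f1 (map \<rho> ys)"
    unfolding E_def L_def by (rule Cons.IH) fact
  have "asum G (y # ys) (\<lambda>zs. prism G \<rho> \<sigma> zs f) =
      K \<otimes> inv asum G ys (\<lambda>zs. f2 (map \<sigma> zs) \<otimes> inv prism G \<rho> \<sigma> zs f1)"
    by (simp add: K_def f1_def f2_def)
  also have "\<dots> = K \<otimes> inv (D \<otimes> inv E)"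
    using r r' unfolding D_def E_def by (simp add: asum_mult asum_inv image_subset_iff prism_closed)
  finally have 1: "asum G (y # ys) (\<lambda>zs. prism G \<rho> \<sigma> zs f) = K \<otimes> inv (D \<otimes> inv E)" .
  have "prism G \<rho> \<sigma> (y # ys) (\<lambda>zs. asum G zs f) =
     (f (\<sigma> y # map \<sigma> ys) \<otimes> inv (f1 (map \<sigma> ys) \<otimes> inv D))
        \<otimes> inv prism G \<rho> \<sigma> ys (\<lambda>zs. f zs \<otimes> inv asum G zs f1)"
    by (simp add: D_def f1_def f2_def asum_map)
  also have "\<dots> = (f (\<sigma> y # map \<sigma> ys) \<otimes> inv (f1 (map \<sigma> ys) \<otimes> inv D)) \<otimes> inv (K \<otimes> inv L)"
    using r r' unfolding K_def L_def by (simp add: prism_mult prism_inv image_subset_iff asum_closed)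
  finally have 2: "prism G \<rho> \<sigma> (y # ys) (\<lambda>zs. asum G zs f) =
    (f (\<sigma> y # map \<sigma> ys) \<otimes> inv (f1 (map \<sigma> ys) \<otimes> inv D)) \<otimes> inv (K \<otimes> inv L)" .
  have "K \<otimes> inv (D \<otimes> inv E) \<otimes>
      ((f (\<sigma> y # map \<sigma> ys) \<otimes> inv (f1 (map \<sigma> ys) \<otimes> inv D)) \<otimes> inv (K \<otimes> inv L)) =
     f (\<sigma> y # map \<sigma> ys) \<otimes> inv f1 (map \<sigma> ys) \<otimes> (E \<otimes> L) \<otimes> (K \<otimes> inv K) \<otimes> (D \<otimes> inv D)"
    using r' by (simp add: inv_mult m_ac del: r_inv l_inv Units_r_inv Units_l_inv)
  also have "\<dots> = f (\<sigma> y # map \<sigma> ys) \<otimes> inv f1 (map \<rho> ys)"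
    using r' by (simp add: IH m_assoc cancel_middle)
  finally show ?case unfolding 1 2 by (simp add: f1_def)
qed (simp add: image_subset_iff)

lemma finprod_inv_pointwise:
  assumes "finite I" "\<And>i. i \<in> I \<Longrightarrow> g i \<in> carrier G"
  shows "(\<Otimes>i\<in>I. inv g i) = inv (\<Otimes>i\<in>I. g i)"
  using assms
proof (induction I rule: finite_induct)
  case (insert a I)
  then have "finprod G g I \<in> carrier G" by (auto intro: finprod_closed)
  moreover have "(\<Otimes>i\<in>insert a I. inv g i) = inv g a \<otimes> (\<Otimes>i\<in>I. inv g i)"
    using insert by (subst finprod_insert) auto
  moreover have "(\<Otimes>i\<in>insert a I. g i) = g a \<otimes> (\<Otimes>i\<in>I. g i)"
    using insert by (subst finprod_insert) auto
  ultimately show ?case using insert by (simp add: inv_mult)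
qed auto

text \<open>Links the recursion, which suits induction on the tuple, with the indexed product of
  \<open>alternating_sum\<close>: deleting position \<open>Suc i\<close> keeps the first entry and
  flips the sign of deleting position \<open>i\<close> in the tail.\<close>

lemma asum_eq_finprod:
  assumes "range f \<subseteq> carrier G"
  shows "asum G ys f = (\<Otimes>i\<in>{..<length ys}. f (delete_nth i ys) [^] ((-1) ^ i :: int))"
  using assms
proof (induction ys arbitrary: f)
  case (Cons y ys)
  define g where "g = (\<lambda>i. f (delete_nth i (y # ys)) [^] ((-1) ^ i :: int))"
  have c: "f zs \<in> carrier G" for zs using Cons.prems by auto
  then have gc: "g i \<in> carrier G" for i by (simp add: g_def)
  have "finprod G g {..<length (y # ys)} = finprod G g (insert 0 (Suc ` {..<length ys}))"
    by (simp add: lessThan_Suc_eq_insert_0)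
  also have "\<dots> = f ys \<otimes> finprod G g (Suc ` {..<length ys})"
    using gc c by (subst finprod_insert) (auto simp: g_def)
  also have "finprod G g (Suc ` {..<length ys}) = finprod G (\<lambda>i. g (Suc i)) {..<length ys}"
    using gc by (subst finprod_reindex) (auto simp: inj_on_def)
  also have "\<dots> = finprod G (\<lambda>i. inv (f (y # delete_nth i ys) [^] ((-1) ^ i :: int))) {..<length ys}"
    using c by (intro finprod_cong) (auto simp: g_def int_pow_neg)
  also have "\<dots> = inv finprod G (\<lambda>i. f (y # delete_nth i ys) [^] ((-1) ^ i :: int)) {..<length ys}"
    using c by (intro finprod_inv_pointwise) auto
  also have "finprod G (\<lambda>i. f (y # delete_nth i ys) [^] ((-1) ^ i :: int)) {..<length ys}
      = asum G ys (\<lambda>zs. f (y # zs))"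
    using Cons.prems by (subst Cons.IH) auto
  finally show ?case by (simp add: g_def)
qed auto

end

text \<open>Cochains are meaningful only at increasing tuples and on overlaps, whereas the rules for
  \<open>asum\<close> want a function with all values in the group. Any such \<open>F\<close> that
  agrees with the cochain on the faces will do.\<close>

lemma alternating_sum_eq_asum:
  fixes G :: "'a monoid"
  assumes "comm_group G" "range F \<subseteq> carrier G"
    and "\<And>i. i < length xs \<Longrightarrow> f (delete_nth i xs) x = F (delete_nth i xs)"
  shows "alternating_sum G f xs x = asum G xs F"
proof -
  interpret comm_group G by fact
  have c: "F zs \<in> carrier G" for zs using assms(2) by auto
  then show ?thesis
    unfolding alternating_sum_def asum_eq_finprod[OF assms(2)]
    using assms(3) by (intro finprod_cong) auto
qed

section \<open>Sorting tuples of indices\<close>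

abbreviation strictly_sorted :: "'i rel \<Rightarrow> 'i list \<Rightarrow> bool" where
  "strictly_sorted s \<equiv> sorted_wrt (\<lambda>a b. (a, b) \<in> s \<and> a \<noteq> b)"

primrec inversions :: "'i rel \<Rightarrow> 'i list \<Rightarrow> nat" where
  "inversions s [] = 0"
| "inversions s (y # ys) = length (filter (\<lambda>z. (z, y) \<in> s) ys) + inversions s ys"

text \<open>The pairs that start at position 0 are counted by the filter, all others are the shifted
  pairs of the tail.\<close>

lemma inversions_eq_card:
  "inversions s ys = card {(i, j). i < j \<and> j < length ys \<and> (ys ! j, ys ! i) \<in> s}"
proof (induction ys)
  case (Cons y ys)
  let ?S = "{(i, j). i < j \<and> j < length ys \<and> (ys ! j, ys ! i) \<in> s}"
  let ?J = "{j. j < length ys \<and> (ys ! j, y) \<in> s}"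
  have "{(i, j). i < j \<and> j < length (y # ys) \<and> ((y # ys) ! j, (y # ys) ! i) \<in> s} =
      (\<lambda>j. (0, Suc j)) ` ?J \<union> map_prod Suc Suc ` ?S" (is "?L = ?A \<union> ?B")
  proof (intro equalityI subsetI)
    fix p assume "p \<in> ?L"
    then obtain i j where p: "p = (i, Suc j)" "i < Suc j" "j < length ys" "(ys ! j, (y # ys) ! i) \<in> s"
      by (cases p; cases "snd p") auto
    show "p \<in> ?A \<union> ?B"
    proof (cases i)
      case (Suc k)
      then have "(k, j) \<in> ?S" using p by auto
      then show ?thesis using p(1) Suc by (auto intro!: image_eqI[of _ "map_prod Suc Suc" "(k, j)"])
    qed (use p in auto)
  qed auto
  moreover have "finite ?S"
    by (rule finite_subset[of _ "{..<length ys} \<times> {..<length ys}"]) auto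
  moreover have "?A \<inter> ?B = {}" by auto
  moreover have "card ?A = card ?J" by (intro card_image) (auto simp: inj_on_def)
  moreover have "card ?B = card ?S" by (intro card_image) (auto simp: inj_on_def)
  ultimately have "card {(i, j). i < j \<and> j < length (y # ys) \<and> ((y # ys) ! j, (y # ys) ! i) \<in> s} =
      card ?J + card ?S"
    by (simp add: card_Un_disjoint)
  then show ?case using Cons.IH by (simp add: length_filter_conv_card)
qed auto

lemma Well_orderD:
  assumes "Well_order s"
  shows "(a, b) \<in> s \<Longrightarrow> (b, c) \<in> s \<Longrightarrow> (a, c) \<in> s"
    and "(a, b) \<in> s \<Longrightarrow> (b, a) \<in> s \<Longrightarrow> a = b"
    and "a \<in> Field s \<Longrightarrow> b \<in> Field s \<Longrightarrow> (a, b) \<in> s \<or> (b, a) \<in> s"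
    and "a \<in> Field s \<Longrightarrow> (a, a) \<in> s"
proof -
  have "trans s" "antisym s" "total_on (Field s) s" "refl_on (Field s) s"
    using assms
    by (auto simp: well_order_on_def linear_order_on_def partial_order_on_def preorder_on_def)
  then show "(a, b) \<in> s \<Longrightarrow> (b, c) \<in> s \<Longrightarrow> (a, c) \<in> s"
    "(a, b) \<in> s \<Longrightarrow> (b, a) \<in> s \<Longrightarrow> a = b"
    "a \<in> Field s \<Longrightarrow> b \<in> Field s \<Longrightarrow> (a, b) \<in> s \<or> (b, a) \<in> s"
    "a \<in> Field s \<Longrightarrow> (a, a) \<in> s"
    by (blast dest: transD, blast dest: antisymD, metis total_on_def refl_on_def, blast dest: refl_onD)
qed

text \<open>An adjacent swap affects only the comparison of the two entries themselves. The count
  thus serves both as a measure for sorting and as the exponent of the sign.\<close>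

lemma inversions_swap:
  assumes "Well_order s" "(a, b) \<in> s" "a \<noteq> b"
  shows "inversions s (us @ b # a # vs) = Suc (inversions s (us @ a # b # vs))"
proof (induction us)
  case Nil
  have "(b, a) \<notin> s" using Well_orderD(2)[OF assms(1)] assms(2,3) by blast
  then show ?case using assms(2) by simp
qed auto

text \<open>By transitivity, being increasing is a condition on neighbours; a violating pair is
  either a repetition or can be swapped.\<close>

lemma not_strictly_sorted:
  assumes "Well_order s" "\<not> strictly_sorted s ys"
  obtains us a b vs where "ys = us @ a # b # vs" "\<not> ((a, b) \<in> s \<and> a \<noteq> b)"
proof -
  have "transp (\<lambda>a b. (a, b) \<in> s \<and> a \<noteq> b)"
    by (rule transpI) (metis Well_orderD(1,2)[OF assms(1)])
  then have "\<not> successively (\<lambda>a b. (a, b) \<in> s \<and> a \<noteq> b) ys"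
    using assms(2) by (simp add: successively_conv_sorted_wrt)
  then have "\<exists>us a b vs. ys = us @ a # b # vs \<and> \<not> ((a, b) \<in> s \<and> a \<noteq> b)"
  proof (induction ys rule: induct_list012)
    case (3 x y zs)
    show ?case
    proof (cases "(x, y) \<in> s \<and> x \<noteq> y")
      case True
      with 3 obtain us a b vs where "y # zs = us @ a # b # vs" "\<not> ((a, b) \<in> s \<and> a \<noteq> b)" by auto
      then show ?thesis by (metis append_Cons)
    qed (metis append_Nil)
  qed auto
  then show ?thesis using that by blast
qed

text \<open>Bubble sort: swapping an inverted adjacent pair lowers the number of inversions and
  inverts both values, and at a repetition both are trivial. Agreement is asked only at the
  rearrangement of \<open>ys\<close>, since at a point \<open>x\<close> the functions are comparable
  only at tuples of members containing \<open>x\<close>.\<close>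

lemma alternating_unique:
  assumes "comm_group G" "alternating G f" "alternating G g" "Well_order s"
    and eq: "\<And>zs. zs \<in> increasing_tuples s (length ys) \<Longrightarrow> set zs = set ys \<Longrightarrow> f zs = g zs"
    and "set ys \<subseteq> Field s"
  shows "f ys = g ys"
  using eq assms(6)
proof (induction "inversions s ys" arbitrary: ys rule: less_induct)
  case (less ys)
  interpret comm_group G by fact
  show ?case
  proof (cases "strictly_sorted s ys")
    case True
    then show ?thesis using less.prems by (auto simp: increasing_tuples_def)
  next
    case False
    then obtain us a b vs where ys: "ys = us @ a # b # vs" and ab: "\<not> ((a, b) \<in> s \<and> a \<noteq> b)"
      using not_strictly_sorted[OF assms(4)] by blast
    show ?thesis
    proof (cases "a = b")
      case True
      then show ?thesis
        using alternating_repeat[OF assms(2)] alternating_repeat[OF assms(3)] ys by simp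
    next
      case False
      with ab have "(b, a) \<in> s" using Well_orderD(3)[OF assms(4), of a b] less.prems(2) ys by auto
      then have "inversions s (us @ b # a # vs) < inversions s ys"
        using inversions_swap[OF assms(4), of b a us vs] False ys by auto
      moreover have "set (us @ b # a # vs) = set ys" "length (us @ b # a # vs) = length ys"
        using ys by auto
      ultimately have "f (us @ b # a # vs) = g (us @ b # a # vs)"
        using less.hyps[of "us @ b # a # vs"] less.prems by simp
      then show ?thesis
        using alternating_swap[OF assms(2), of us a b vs] alternating_swap[OF assms(3), of us a b vs] ys
        by simp
    qed
  qed
qed

lemma strictly_sorted_insert:
  assumes "Well_order s" "strictly_sorted s zs" "set zs \<subseteq> Field s" "x \<in> Field s" "x \<notin> set zs"
  shows "\<exists>ws. strictly_sorted s ws \<and> set ws = insert x (set zs)"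
  using assms(2-)
proof (induction zs)
  case Nil
  then show ?case by (intro exI[of _ "[x]"]) simp
next
  case (Cons z zs)
  show ?case
  proof (cases "(x, z) \<in> s")
    case True
    then have "strictly_sorted s (x # z # zs)"
      using Cons.prems Well_orderD(1)[OF assms(1)] by auto
    then show ?thesis by (intro exI[of _ "x # z # zs"]) auto
  next
    case False
    then have zx: "(z, x) \<in> s" using Well_orderD(3)[OF assms(1)] Cons.prems by auto
    obtain ws where ws: "strictly_sorted s ws" "set ws = insert x (set zs)"
      using Cons by auto
    then have "strictly_sorted s (z # ws)" using zx Cons.prems by auto
    then show ?thesis using ws by (intro exI[of _ "z # ws"]) auto
  qed
qed

lemma strictly_sorted_exists:
  assumes "Well_order s" "finite S" "S \<subseteq> Field s"
  shows "\<exists>zs. strictly_sorted s zs \<and> set zs = S"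
  using assms(2,3)
proof (induction S rule: finite_induct)
  case empty
  then show ?case by (intro exI[of _ "[]"]) simp
next
  case (insert x S)
  then show ?case using strictly_sorted_insert[OF assms(1)] by force
qed

text \<open>The head of an increasing tuple is its minimum, so two increasing enumerations of one
  set have the same head.\<close>

lemma strictly_sorted_unique:
  assumes "Well_order s" "strictly_sorted s zs" "strictly_sorted s ws" "set zs = set ws"
  shows "zs = ws"
  using assms(2-)
proof (induction zs arbitrary: ws)
  case (Cons z zs)
  then obtain w ws' where ws: "ws = w # ws'" by (cases ws) auto
  have "z = w"
  proof (rule ccontr)
    assume "z \<noteq> w"
    then have "z \<in> set ws'" "w \<in> set zs" using Cons.prems(3) ws by auto
    then have "(w, z) \<in> s" "(z, w) \<in> s" using Cons.prems(1,2) ws by auto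
    then show False using Well_orderD(2)[OF assms(1)] \<open>z \<noteq> w\<close> by blast
  qed
  moreover have "set zs = set ws'" using Cons.prems ws \<open>z = w\<close> by auto
  ultimately show ?case using Cons ws by simp
qed auto

lemma strictly_sorted_distinct: "strictly_sorted s zs \<Longrightarrow> distinct zs"
  by (induction zs) auto

text \<open>Justifies the definite description in \<open>alternating_extension\<close>.\<close>

lemma ex1_increasing_tuple:
  assumes "Well_order s" "distinct ys" "set ys \<subseteq> Field s"
  shows "\<exists>!zs. zs \<in> increasing_tuples s (length ys) \<and> set zs = set ys"
proof -
  obtain zs where zs: "strictly_sorted s zs" "set zs = set ys"
    using strictly_sorted_exists[OF assms(1) finite_set assms(3)] by blast
  then have "length zs = length ys"
    using distinct_card[OF strictly_sorted_distinct[OF zs(1)]] distinct_card[OF assms(2)] by simp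
  then have "zs \<in> increasing_tuples s (length ys)"
    using zs assms(3) by (auto simp: increasing_tuples_def)
  moreover have "ws = zs" if "ws \<in> increasing_tuples s (length ys) \<and> set ws = set ys" for ws
    using that zs by (intro strictly_sorted_unique[OF assms(1)]) (auto simp: increasing_tuples_def)
  ultimately show ?thesis using zs(2) by blast
qed

section \<open>The complex of all cochains\<close>

text \<open>The complex of all functions shares its operations with \<open>cochains\<close>.
  Identities are proved here point by point, for all presheaves at once, and membership in the
  presheaf is checked separately.\<close>

definition all_cochains ::
    "'a monoid \<Rightarrow> 'i rel \<Rightarrow> ('i \<Rightarrow> 'x set) \<Rightarrow> nat \<Rightarrow> ('i list \<Rightarrow> 'x \<Rightarrow> 'a) monoid" where
  "all_cochains A r V n =
     product_group (increasing_tuples r (n + 1)) (\<lambda>xs. product_group (overlap V xs) (\<lambda>_. A))"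

text \<open>The alternating extension at one point \<open>x\<close>, made trivial at tuples of the
  wrong length and at tuples with an entry outside the index set or a member missing
  \<open>x\<close>. This cut-off makes it a total alternating function of tuples.\<close>

definition alt_ext ::
    "'a monoid \<Rightarrow> 'i rel \<Rightarrow> ('i \<Rightarrow> 'x set) \<Rightarrow> nat \<Rightarrow> ('i list \<Rightarrow> 'x \<Rightarrow> 'a) \<Rightarrow> 'x \<Rightarrow> 'i list \<Rightarrow> 'a" where
  "alt_ext A s W n f x ys =
     (if length ys = n + 1 \<and> set ys \<subseteq> Field s \<and> x \<in> overlap W ys
      then alternating_extension A s f ys x else \<one>\<^bsub>A\<^esub>)"

lemma comm_group_product_group:
  assumes "\<And>i. i \<in> I \<Longrightarrow> comm_group (G i)" shows "comm_group (product_group I G)"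
proof -
  have "group (product_group I G)"
    using assms by (intro product_group) (auto simp: comm_group_def)
  moreover have "x \<otimes>\<^bsub>product_group I G\<^esub> y = y \<otimes>\<^bsub>product_group I G\<^esub> x"
    if "x \<in> carrier (product_group I G)" "y \<in> carrier (product_group I G)" for x y
    using that assms by (auto intro!: restrict_ext comm_monoid.m_comm simp: comm_group_def PiE_iff)
  ultimately show ?thesis by (rule group.group_comm_groupI)
qed

lemma comm_group_all_cochains: "comm_group A \<Longrightarrow> comm_group (all_cochains A r V n)"
  unfolding all_cochains_def by (intro comm_group_product_group)

lemma all_cochains_carrierI:
  assumes "f \<in> extensional (increasing_tuples r (n + 1))"
    and "\<And>xs. xs \<in> increasing_tuples r (n + 1) \<Longrightarrow> f xs \<in> extensional (overlap V xs)"
    and "\<And>xs x. xs \<in> increasing_tuples r (n + 1) \<Longrightarrow> x \<in> overlap V xs \<Longrightarrow> f xs x \<in> carrier A"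
  shows "f \<in> carrier (all_cochains A r V n)"
  using assms by (auto simp: all_cochains_def PiE_iff)

lemma all_cochains_value:
  assumes "f \<in> carrier (all_cochains A r V n)" "xs \<in> increasing_tuples r (n + 1)" "x \<in> overlap V xs"
  shows "f xs x \<in> carrier A"
  using assms by (auto simp: all_cochains_def PiE_iff)

lemma all_cochains_eqI:
  assumes "f \<in> carrier (all_cochains A r V n)" "g \<in> carrier (all_cochains A r V n)"
    and "\<And>xs x. xs \<in> increasing_tuples r (n + 1) \<Longrightarrow> x \<in> overlap V xs \<Longrightarrow> f xs x = g xs x"
  shows "f = g"
proof (rule PiE_ext)
  show "f \<in> (\<Pi>\<^sub>E xs\<in>increasing_tuples r (n + 1). overlap V xs \<rightarrow>\<^sub>E carrier A)"
    "g \<in> (\<Pi>\<^sub>E xs\<in>increasing_tuples r (n + 1). overlap V xs \<rightarrow>\<^sub>E carrier A)"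
    using assms(1,2) by (auto simp: all_cochains_def)
  fix xs assume "xs \<in> increasing_tuples r (n + 1)"
  then show "f xs = g xs"
    using assms by (intro PiE_ext[of _ "overlap V xs" "\<lambda>_. carrier A"]) (auto simp: all_cochains_def PiE_iff)
qed

lemma all_cochains_one [simp]:
  "xs \<in> increasing_tuples r (n + 1) \<Longrightarrow> x \<in> overlap V xs \<Longrightarrow> \<one>\<^bsub>all_cochains A r V n\<^esub> xs x = \<one>\<^bsub>A\<^esub>"
  by (simp add: all_cochains_def)

lemma all_cochains_mult [simp]:
  "xs \<in> increasing_tuples r (n + 1) \<Longrightarrow> x \<in> overlap V xs \<Longrightarrow>
     (f \<otimes>\<^bsub>all_cochains A r V n\<^esub> g) xs x = f xs x \<otimes>\<^bsub>A\<^esub> g xs x"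
  by (simp add: all_cochains_def)

lemma all_cochains_inv:
  assumes "comm_group A" "f \<in> carrier (all_cochains A r V n)"
    "xs \<in> increasing_tuples r (n + 1)" "x \<in> overlap V xs"
  shows "(inv\<^bsub>all_cochains A r V n\<^esub> f) xs x = inv\<^bsub>A\<^esub> f xs x"
proof -
  have "Group.group A" using assms(1) by (simp add: comm_group_def)
  then show ?thesis using assms(2-) by (simp add: all_cochains_def PiE_iff)
qed

lemma int_pow_parity:
  assumes "comm_group A" "a \<in> carrier A"
  shows "a [^]\<^bsub>A\<^esub> ((-1) ^ n :: int) = (if even n then a else inv\<^bsub>A\<^esub> a)"
proof -
  interpret comm_group A by fact
  show ?thesis using assms(2) int_pow_neg[of a 1] by simp
qed

lemma overlap_iff_subset: "x \<in> overlap V xs \<longleftrightarrow> set xs \<subseteq> {i. x \<in> V i}"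
  by (auto simp: overlap_def)

lemma alt_ext_closed:
  assumes "comm_group A" "Well_order s" "f \<in> carrier (all_cochains A s W n)"
  shows "alt_ext A s W n f x ys \<in> carrier A"
proof -
  interpret comm_group A by fact
  have "f (THE zs. zs \<in> increasing_tuples s (length ys) \<and> set zs = set ys) x \<in> carrier A"
    if "length ys = n + 1" "set ys \<subseteq> Field s" "x \<in> overlap W ys" "distinct ys"
  proof -
    have "(THE zs. zs \<in> increasing_tuples s (length ys) \<and> set zs = set ys) \<in> increasing_tuples s (n + 1)"
      "set (THE zs. zs \<in> increasing_tuples s (length ys) \<and> set zs = set ys) = set ys"
      using theI'[OF ex1_increasing_tuple[OF assms(2), of ys]] that by auto
    then show ?thesis using all_cochains_value[OF assms(3)] that(3) by (auto simp: overlap_def)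
  qed
  then show ?thesis by (simp add: alt_ext_def alternating_extension_def)
qed

text \<open>The cut-off and the sorted tuple depend on the entries but not on their order, so an
  adjacent swap changes only the parity of the inversion count.\<close>

lemma alternating_alt_ext:
  assumes "comm_group A" "Well_order s" "f \<in> carrier (all_cochains A s W n)"
  shows "alternating A (alt_ext A s W n f x)"
proof -
  interpret comm_group A by fact
  have swap: "alt_ext A s W n f x (us @ a # b # vs) = inv\<^bsub>A\<^esub> alt_ext A s W n f x (us @ b # a # vs)"
    if ab: "(a, b) \<in> s" "a \<noteq> b" for us a b vs
  proof -
    let ?u = "us @ a # b # vs" and ?v = "us @ b # a # vs"
    have set: "set ?v = set ?u" "length ?v = length ?u" "distinct ?v = distinct ?u" by auto
    show ?thesis
    proof (cases "length ?u = n + 1 \<and> set ?u \<subseteq> Field s \<and> x \<in> overlap W ?u \<and> distinct ?u")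
      case True
      define c where "c = f (THE zs. zs \<in> increasing_tuples s (length ?u) \<and> set zs = set ?u) x"
      have "(THE zs. zs \<in> increasing_tuples s (length ?u) \<and> set zs = set ?u) \<in> increasing_tuples s (n + 1)"
        "set (THE zs. zs \<in> increasing_tuples s (length ?u) \<and> set zs = set ?u) = set ?u"
        using theI'[OF ex1_increasing_tuple[OF assms(2), of ?u]] True by auto
      then have c: "c \<in> carrier A"
        unfolding c_def using True by (intro all_cochains_value[OF assms(3)]) (auto simp: overlap_def)
      have "alt_ext A s W n f x ?u = c [^]\<^bsub>A\<^esub> ((-1) ^ inversions s ?u :: int)"
        using True by (simp add: alt_ext_def alternating_extension_def c_def inversions_eq_card)
      moreover have "alt_ext A s W n f x ?v = c [^]\<^bsub>A\<^esub> ((-1) ^ inversions s ?v :: int)"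
        using True set
        unfolding alt_ext_def alternating_extension_def c_def inversions_eq_card overlap_def set by simp
      ultimately show ?thesis
        using c inversions_swap[OF assms(2) ab] by (simp add: int_pow_parity[OF assms(1)] del: power_Suc)
    next
      case False
      then have "alt_ext A s W n f x ?u = \<one>\<^bsub>A\<^esub>" "alt_ext A s W n f x ?v = \<one>\<^bsub>A\<^esub>"
        unfolding alt_ext_def alternating_extension_def set overlap_def by auto
      then show ?thesis by simp
    qed
  qed
  show ?thesis
  proof (rule alternatingI)
    fix us vs :: "'b list" and a b
    show "alt_ext A s W n f x (us @ a # a # vs) = \<one>\<^bsub>A\<^esub>"
      by (simp add: alt_ext_def alternating_extension_def)
    then show "alt_ext A s W n f x (us @ a # b # vs) = inv\<^bsub>A\<^esub> alt_ext A s W n f x (us @ b # a # vs)"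
    \<comment> \<open>The order compares only elements of its field; if an entry lies outside, the
      cut-off makes both sides trivial.\<close>
    proof (cases "{a, b} \<subseteq> Field s")
      case True
      then consider "a = b" | "(a, b) \<in> s" "a \<noteq> b" | "(b, a) \<in> s" "b \<noteq> a"
        using Well_orderD(3)[OF assms(2)] by auto
      then show ?thesis
      proof cases
        case 1
        then show ?thesis by (simp add: alt_ext_def alternating_extension_def)
      next
        case 2
        then show ?thesis by (rule swap)
      next
        case 3
        then show ?thesis using swap[of b a us vs] alt_ext_closed[OF assms] by simp
      qed
    qed (auto simp: alt_ext_def)
  qed (rule alt_ext_closed[OF assms])
qed

lemma alt_ext_increasing:
  assumes "comm_group A" "Well_order s" "f \<in> carrier (all_cochains A s W n)"
    and "zs \<in> increasing_tuples s (n + 1)" "x \<in> overlap W zs"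
  shows "alt_ext A s W n f x zs = f zs x"
proof -
  interpret comm_group A by fact
  have zs: "length zs = n + 1" "set zs \<subseteq> Field s" "strictly_sorted s zs" "distinct zs"
    using assms(4) strictly_sorted_distinct by (auto simp: increasing_tuples_def)
  have "(THE ws. ws \<in> increasing_tuples s (length zs) \<and> set ws = set zs) = zs"
    using ex1_increasing_tuple[OF assms(2) zs(4,2)] assms(4) zs(1) by (intro the1_equality) auto
  moreover have no_inv: "{(i, j). i < j \<and> j < length zs \<and> (zs ! j, zs ! i) \<in> s} = {}"
    using Well_orderD(2)[OF assms(2)] sorted_wrt_nth_less[OF zs(3)] by fastforce
  ultimately show ?thesis
    using zs(1,2,4) assms(5) all_cochains_value[OF assms(3-5)]
    unfolding alt_ext_def alternating_extension_def no_inv by simp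
qed

lemma alt_ext_length: "length ys \<noteq> n + 1 \<Longrightarrow> alt_ext A s W n f x ys = \<one>\<^bsub>A\<^esub>"
  by (simp add: alt_ext_def)

text \<open>The form in which uniqueness is applied: an extension is identified by exhibiting an
  alternating candidate \<open>F\<close> with the right values at increasing tuples through
  \<open>x\<close>.\<close>

lemma alt_ext_unique:
  assumes A: "comm_group A" "Well_order s" "f \<in> carrier (all_cochains A s W n)"
    and F: "alternating A F"
    and eq: "\<And>zs. zs \<in> increasing_tuples s (n + 1) \<Longrightarrow> x \<in> overlap W zs \<Longrightarrow> f zs x = F zs"
    and ys: "length ys = n + 1" "set ys \<subseteq> Field s" "x \<in> overlap W ys"
  shows "alt_ext A s W n f x ys = F ys"
proof (rule alternating_unique[OF A(1) alternating_alt_ext[OF A] F A(2) _ ys(2)])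
  fix zs assume "zs \<in> increasing_tuples s (length ys)" "set zs = set ys"
  then show "alt_ext A s W n f x zs = F zs"
    using ys eq[of zs] alt_ext_increasing[OF A, of zs x] by (simp add: overlap_iff_subset)
qed

lemma alt_ext_mult:
  assumes A: "comm_group A" "Well_order s"
    and f: "f \<in> carrier (all_cochains A s W n)" and g: "g \<in> carrier (all_cochains A s W n)"
  shows "alt_ext A s W n (f \<otimes>\<^bsub>all_cochains A s W n\<^esub> g) x ys =
    alt_ext A s W n f x ys \<otimes>\<^bsub>A\<^esub> alt_ext A s W n g x ys"
proof -
  interpret comm_group A by fact
  have "f (THE zs. zs \<in> increasing_tuples s (length ys) \<and> set zs = set ys) x \<in> carrier A"
    "g (THE zs. zs \<in> increasing_tuples s (length ys) \<and> set zs = set ys) x \<in> carrier A"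
    "(f \<otimes>\<^bsub>all_cochains A s W n\<^esub> g) (THE zs. zs \<in> increasing_tuples s (length ys) \<and> set zs = set ys) x =
     f (THE zs. zs \<in> increasing_tuples s (length ys) \<and> set zs = set ys) x \<otimes>\<^bsub>A\<^esub>
     g (THE zs. zs \<in> increasing_tuples s (length ys) \<and> set zs = set ys) x"
    if "length ys = n + 1" "set ys \<subseteq> Field s" "x \<in> overlap W ys" "distinct ys"
  proof -
    have "(THE zs. zs \<in> increasing_tuples s (length ys) \<and> set zs = set ys) \<in> increasing_tuples s (n + 1)"
      "set (THE zs. zs \<in> increasing_tuples s (length ys) \<and> set zs = set ys) = set ys"
      using theI'[OF ex1_increasing_tuple[OF A(2), of ys]] that by auto
    then show "f (THE zs. zs \<in> increasing_tuples s (length ys) \<and> set zs = set ys) x \<in> carrier A"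
    "g (THE zs. zs \<in> increasing_tuples s (length ys) \<and> set zs = set ys) x \<in> carrier A"
    "(f \<otimes>\<^bsub>all_cochains A s W n\<^esub> g) (THE zs. zs \<in> increasing_tuples s (length ys) \<and> set zs = set ys) x =
     f (THE zs. zs \<in> increasing_tuples s (length ys) \<and> set zs = set ys) x \<otimes>\<^bsub>A\<^esub>
     g (THE zs. zs \<in> increasing_tuples s (length ys) \<and> set zs = set ys) x"
      using all_cochains_value[OF f] all_cochains_value[OF g] that(3) by (auto simp: overlap_def)
  qed
  then show ?thesis by (simp add: alt_ext_def alternating_extension_def int_pow_distrib)
qed

text \<open>Extension is multiplicative, so the value at the trivial cochain is its own
  square.\<close>

lemma alt_ext_one:
  assumes "comm_group A" "Well_order s"
  shows "alt_ext A s W n \<one>\<^bsub>all_cochains A s W n\<^esub> x ys = \<one>\<^bsub>A\<^esub>"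
proof -
  interpret comm_group A by fact
  interpret M: comm_group "all_cochains A s W n" by (rule comm_group_all_cochains) fact
  have "alt_ext A s W n \<one>\<^bsub>all_cochains A s W n\<^esub> x ys \<in> carrier A"
    by (intro alt_ext_closed assms) auto
  moreover have "alt_ext A s W n (\<one>\<^bsub>all_cochains A s W n\<^esub> \<otimes>\<^bsub>all_cochains A s W n\<^esub> \<one>\<^bsub>all_cochains A s W n\<^esub>) x ys =
    alt_ext A s W n \<one>\<^bsub>all_cochains A s W n\<^esub> x ys \<otimes>\<^bsub>A\<^esub> alt_ext A s W n \<one>\<^bsub>all_cochains A s W n\<^esub> x ys"
    by (intro alt_ext_mult assms) auto
  ultimately show ?thesis by simp
qed

section \<open>Subquotients of abelian groups\<close>

text \<open>Cosets are formed in the ambient group \<open>G\<close>. Cocycles modulo coboundaries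
  and coherent modulo trivial families both have this shape.\<close>

locale subquotient = comm_group G for G (structure) +
  fixes Z B
  assumes Z: "subgroup Z G" and B: "subgroup B G" and BZ: "B \<subseteq> Z"
begin

abbreviation subquot where "subquot \<equiv> G\<lparr>carrier := Z\<rparr> Mod B"

lemma Z_carrier: "z \<in> Z \<Longrightarrow> z \<in> carrier G"
  using subgroup.mem_carrier[OF Z] .

lemma carrier_subquot: "carrier subquot = (\<lambda>z. B #> z) ` Z"
  by (simp add: carrier_FactGroup r_coset_def)

lemma coset_eq_iff:
  assumes "x \<in> Z" "y \<in> Z"
  shows "B #> x = B #> y \<longleftrightarrow> x \<otimes> inv y \<in> B"
proof -
  interpret B: subgroup B G by (rule B)
  have c: "x \<in> carrier G" "y \<in> carrier G" using assms Z_carrier by auto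
  show ?thesis
  proof
    assume "B #> x = B #> y"
    then have "x \<in> B #> y" using rcos_self[OF c(1) B] by simp
    then show "x \<otimes> inv y \<in> B" using B.rcos_module_imp[OF is_group c(2)] by blast
  next
    assume "x \<otimes> inv y \<in> B"
    then have "x \<in> B #> y" using B.rcos_module_rev[OF is_group c(2) c(1)] by simp
    then show "B #> x = B #> y" using repr_independence[OF _ c(2) B] by simp
  qed
qed

lemma coset_mem: "x \<in> Z \<Longrightarrow> B #> x \<in> carrier subquot"
  by (auto simp: carrier_subquot)

lemma coset_subset: "x \<in> Z \<Longrightarrow> B #> x \<subseteq> Z"
  using BZ subgroup.m_closed[OF Z] by (auto simp: r_coset_def)

lemma coset_self: "x \<in> Z \<Longrightarrow> x \<in> B #> x"
  using rcos_self[OF Z_carrier B] .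

lemma mult_subquot: "mult subquot = (<#>)"
  by (simp add: set_mult_def fun_eq_iff)

lemma mult_coset:
  assumes "x \<in> Z" "y \<in> Z"
  shows "(B #> x) \<otimes>\<^bsub>subquot\<^esub> (B #> y) = B #> (x \<otimes> y)"
  using normal.rcos_sum[OF subgroup_imp_normal[OF B]] assms Z_carrier
  by (simp add: mult_subquot)

lemma comm_group_subquot: "comm_group subquot"
proof -
  interpret Z: comm_group "G\<lparr>carrier := Z\<rparr>"
    using Z by (intro group.group_comm_groupI subgroup_imp_group) (auto intro: m_comm Z_carrier)
  show ?thesis
    by (intro Z.abelian_FactGroup subgroup_incl B Z BZ)
qed

end

text \<open>Pullbacks, change of coefficients, the coboundary of a family and the jump map are all
  treated as instances of this.\<close>

locale subquotient_map = G: subquotient G Z B + H: subquotient H Y C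
  for G (structure) and Z B and H (structure) and Y C +
  fixes \<phi>
  assumes closed: "z \<in> Z \<Longrightarrow> \<phi> z \<in> Y"
    and mult: "x \<in> Z \<Longrightarrow> y \<in> Z \<Longrightarrow> \<phi> (x \<otimes>\<^bsub>G\<^esub> y) = \<phi> x \<otimes>\<^bsub>H\<^esub> \<phi> y"
    and null: "b \<in> B \<Longrightarrow> \<phi> b \<in> C"
begin

lemma map_inv:
  assumes "x \<in> Z" shows "\<phi> (inv\<^bsub>G\<^esub> x) = inv\<^bsub>H\<^esub> \<phi> x"
proof -
  have i: "inv\<^bsub>G\<^esub> x \<in> Z" using assms by (rule subgroup.m_inv_closed[OF G.Z])
  have "\<phi> \<one>\<^bsub>G\<^esub> \<otimes>\<^bsub>H\<^esub> \<phi> \<one>\<^bsub>G\<^esub> = \<phi> \<one>\<^bsub>G\<^esub>" "\<phi> \<one>\<^bsub>G\<^esub> \<in> carrier H"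
    using mult[of "\<one>\<^bsub>G\<^esub>" "\<one>\<^bsub>G\<^esub>"] subgroup.one_closed[OF G.Z] closed H.Z_carrier by auto
  then have "\<phi> \<one>\<^bsub>G\<^esub> = \<one>\<^bsub>H\<^esub>" by simp
  then have "\<phi> (inv\<^bsub>G\<^esub> x) \<otimes>\<^bsub>H\<^esub> \<phi> x = \<one>\<^bsub>H\<^esub>"
    using mult[OF i assms] assms G.Z_carrier by simp
  then show ?thesis
    using H.inv_equality[of "\<phi> (inv\<^bsub>G\<^esub> x)" "\<phi> x"] i assms closed H.Z_carrier by simp
qed

text \<open>Representatives of one class differ by an element of \<open>B\<close>, which
  \<open>\<phi>\<close> sends into \<open>C\<close>; so the union in \<open>induced_map\<close> is a
  single coset.\<close>

lemma induced_coset: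
  assumes "x \<in> Z"
  shows "induced_map H C \<phi> (B #>\<^bsub>G\<^esub> x) = C #>\<^bsub>H\<^esub> \<phi> x"
proof -
  have "C #>\<^bsub>H\<^esub> \<phi> f = C #>\<^bsub>H\<^esub> \<phi> x" if f: "f \<in> B #>\<^bsub>G\<^esub> x" for f
  proof -
    obtain b where b: "b \<in> B" "f = b \<otimes>\<^bsub>G\<^esub> x" using f by (auto simp: r_coset_def)
    then have "\<phi> f = \<phi> b \<otimes>\<^bsub>H\<^esub> \<phi> x" using mult[of b x] G.BZ assms by auto
    moreover have "\<phi> b \<in> C" "\<phi> b \<in> carrier H" "\<phi> x \<in> carrier H"
      using null[OF b(1)] H.BZ H.Z_carrier closed assms by auto
    ultimately have "\<phi> f \<otimes>\<^bsub>H\<^esub> inv\<^bsub>H\<^esub> \<phi> x \<in> C" by (simp add: H.m_assoc)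
    moreover have "f \<in> Z" using f assms G.coset_subset by blast
    ultimately show ?thesis using H.coset_eq_iff closed assms by blast
  qed
  then show ?thesis using G.coset_self[OF assms] unfolding induced_map_def by blast
qed

lemma induced_hom: "induced_map H C \<phi> \<in> hom G.subquot H.subquot"
proof (rule homI)
  fix X assume "X \<in> carrier G.subquot"
  then obtain x where x: "x \<in> Z" "X = B #>\<^bsub>G\<^esub> x" by (auto simp: G.carrier_subquot)
  then show "induced_map H C \<phi> X \<in> carrier H.subquot"
    using closed by (simp add: induced_coset H.coset_mem)
  fix Y assume "Y \<in> carrier G.subquot"
  then obtain y where y: "y \<in> Z" "Y = B #>\<^bsub>G\<^esub> y" by (auto simp: G.carrier_subquot)
  then show "induced_map H C \<phi> (X \<otimes>\<^bsub>G.subquot\<^esub> Y) =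
      induced_map H C \<phi> X \<otimes>\<^bsub>H.subquot\<^esub> induced_map H C \<phi> Y"
    using x closed subgroup.m_closed[OF G.Z]
    unfolding x y by (simp only: G.mult_coset induced_coset H.mult_coset mult)
qed

lemma induced_iso:
  assumes inj: "\<And>x. x \<in> Z \<Longrightarrow> \<phi> x \<in> C \<Longrightarrow> x \<in> B"
    and surj: "\<And>y. y \<in> Y \<Longrightarrow> \<exists>x\<in>Z. y \<otimes>\<^bsub>H\<^esub> inv\<^bsub>H\<^esub> \<phi> x \<in> C"
  shows "induced_map H C \<phi> \<in> iso G.subquot H.subquot"
proof (rule isoI[OF induced_hom])
  show "bij_betw (induced_map H C \<phi>) (carrier G.subquot) (carrier H.subquot)"
    unfolding bij_betw_def
  proof
    show "inj_on (induced_map H C \<phi>) (carrier G.subquot)"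
    proof (rule inj_onI)
      fix X X' assume "X \<in> carrier G.subquot" "X' \<in> carrier G.subquot"
        and eq: "induced_map H C \<phi> X = induced_map H C \<phi> X'"
      then obtain x x' where x: "x \<in> Z" "X = B #>\<^bsub>G\<^esub> x" "x' \<in> Z" "X' = B #>\<^bsub>G\<^esub> x'"
        by (auto simp: G.carrier_subquot)
      have xi: "inv\<^bsub>G\<^esub> x' \<in> Z" using x(3) by (rule subgroup.m_inv_closed[OF G.Z])
      have "\<phi> x \<otimes>\<^bsub>H\<^esub> inv\<^bsub>H\<^esub> \<phi> x' \<in> C"
        using eq x closed by (simp add: induced_coset H.coset_eq_iff)
      then have "\<phi> (x \<otimes>\<^bsub>G\<^esub> inv\<^bsub>G\<^esub> x') \<in> C"
        using x xi by (simp add: mult map_inv)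
      then show "X = X'"
        using inj[of "x \<otimes>\<^bsub>G\<^esub> inv\<^bsub>G\<^esub> x'"] x xi subgroup.m_closed[OF G.Z]
        by (simp add: G.coset_eq_iff)
    qed
    show "induced_map H C \<phi> ` carrier G.subquot = carrier H.subquot"
    proof (intro equalityI subsetI)
      fix X assume "X \<in> carrier H.subquot"
      then obtain y where y: "y \<in> Y" "X = C #>\<^bsub>H\<^esub> y" by (auto simp: H.carrier_subquot)
      then obtain x where x: "x \<in> Z" "y \<otimes>\<^bsub>H\<^esub> inv\<^bsub>H\<^esub> \<phi> x \<in> C" using surj by blast
      then have "X = induced_map H C \<phi> (B #>\<^bsub>G\<^esub> x)"
        using y closed by (simp add: induced_coset H.coset_eq_iff)
      then show "X \<in> induced_map H C \<phi> ` carrier G.subquot"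
        using G.coset_mem[OF x(1)] by blast
    qed (use induced_hom in \<open>auto simp: hom_def\<close>)
  qed
qed

end

section \<open>Direct limits\<close>

text \<open>The laws \<open>id\<close> and \<open>comp\<close> are equations on carriers. Refinement
  functions are chosen independently for each pair of covers and need not compose; only the maps
  they induce on cohomology do.\<close>

locale direct_system =
  fixes J :: "'j set" and below and G :: "'j \<Rightarrow> 'b monoid" and \<phi>
  assumes refl: "i \<in> J \<Longrightarrow> below i i"
    and trans: "below i j \<Longrightarrow> below j k \<Longrightarrow> below i k"
    and directed: "i \<in> J \<Longrightarrow> j \<in> J \<Longrightarrow> \<exists>k\<in>J. below i k \<and> below j k"
    and hom: "i \<in> J \<Longrightarrow> j \<in> J \<Longrightarrow> below i j \<Longrightarrow> \<phi> i j \<in> hom (G i) (G j)"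
    and id: "i \<in> J \<Longrightarrow> x \<in> carrier (G i) \<Longrightarrow> \<phi> i i x = x"
    and comp: "i \<in> J \<Longrightarrow> j \<in> J \<Longrightarrow> k \<in> J \<Longrightarrow> below i j \<Longrightarrow> below j k \<Longrightarrow> x \<in> carrier (G i) \<Longrightarrow>
      \<phi> j k (\<phi> i j x) = \<phi> i k x"
    and monoid: "i \<in> J \<Longrightarrow> monoid (G i)"
begin

abbreviation rel where "rel \<equiv> limit_rel J below G \<phi>"

lemma closed: "i \<in> J \<Longrightarrow> j \<in> J \<Longrightarrow> below i j \<Longrightarrow> x \<in> carrier (G i) \<Longrightarrow> \<phi> i j x \<in> carrier (G j)"
  using hom by (auto simp: hom_def)

lemma relI:
  assumes "i \<in> J" "x \<in> carrier (G i)" "j \<in> J" "y \<in> carrier (G j)" "k \<in> J" "below i k" "below j k"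
    "\<phi> i k x = \<phi> j k y"
  shows "((i, x), (j, y)) \<in> rel"
  using assms unfolding limit_rel_def by blast

lemma relE:
  assumes "((i, x), (j, y)) \<in> rel"
  obtains k where "i \<in> J" "x \<in> carrier (G i)" "j \<in> J" "y \<in> carrier (G j)" "k \<in> J" "below i k" "below j k"
    "\<phi> i k x = \<phi> j k y"
  using assms unfolding limit_rel_def by blast

lemma later_eq:
  assumes "i \<in> J" "x \<in> carrier (G i)" "j \<in> J" "y \<in> carrier (G j)" "k \<in> J" "below i k" "below j k"
    "\<phi> i k x = \<phi> j k y" "l \<in> J" "below k l"
  shows "\<phi> i l x = \<phi> j l y"
proof -
  have "\<phi> i l x = \<phi> k l (\<phi> i k x)" using assms by (intro comp[symmetric])
  also have "\<dots> = \<phi> k l (\<phi> j k y)" using assms by simp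
  also have "\<dots> = \<phi> j l y" using assms by (intro comp)
  finally show ?thesis .
qed

lemma equiv: "equiv (SIGMA j:J. carrier (G j)) rel"
proof (rule equivI)
  show "rel \<subseteq> (SIGMA j:J. carrier (G j)) \<times> (SIGMA j:J. carrier (G j))"
    by (auto simp: limit_rel_def)
  show "refl_on (SIGMA j:J. carrier (G j)) rel"
    by (auto simp: refl_on_def intro!: relI intro: refl)
  show "sym rel" unfolding sym_def limit_rel_def by fastforce
  show "trans rel"
  proof (rule transI)
    fix a b c assume ab: "(a, b) \<in> rel" and bc: "(b, c) \<in> rel"
    obtain i x j y k z where abc: "a = (i, x)" "b = (j, y)" "c = (k, z)" by (metis surj_pair)
    obtain u where u: "i \<in> J" "x \<in> carrier (G i)" "j \<in> J" "y \<in> carrier (G j)" "u \<in> J" "below i u" "below j u"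
      "\<phi> i u x = \<phi> j u y" using ab abc by (auto elim: relE)
    obtain v where v: "k \<in> J" "z \<in> carrier (G k)" "v \<in> J" "below j v" "below k v"
      "\<phi> j v y = \<phi> k v z" using bc abc by (auto elim: relE)
    obtain w where w: "w \<in> J" "below u w" "below v w" using directed[OF u(5) v(3)] by blast
    have "\<phi> i w x = \<phi> j w y" by (rule later_eq[of i x j y u]) (use u w in auto)
    also have "\<dots> = \<phi> k w z" by (rule later_eq[of j y k z v]) (use u v w in auto)
    finally show "(a, c) \<in> rel"
      using u v w abc trans by (auto intro!: relI[of _ _ _ _ w] intro: trans)
  qed
qed

lemma class_eq_iff:
  assumes "i \<in> J" "x \<in> carrier (G i)" "j \<in> J" "y \<in> carrier (G j)"
  shows "rel `` {(i, x)} = rel `` {(j, y)} \<longleftrightarrow> ((i, x), (j, y)) \<in> rel"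
  using assms equiv by (intro eq_equiv_class_iff) auto

lemma class_push:
  assumes "i \<in> J" "x \<in> carrier (G i)" "k \<in> J" "below i k"
  shows "rel `` {(k, \<phi> i k x)} = rel `` {(i, x)}"
  using assms closed[of i k x] refl[of k]
  by (subst class_eq_iff) (auto intro!: relI[of _ _ _ _ k] simp: id)

text \<open>The product in \<open>direct_limit\<close> is a union over all representatives and all
  common later stages; the point is that each of them contributes the same class.\<close>

lemma mult_class:
  assumes i: "i \<in> J" "x \<in> carrier (G i)" and j: "j \<in> J" "y \<in> carrier (G j)"
    and k: "k \<in> J" "below i k" "below j k"
  shows "rel `` {(i, x)} \<otimes>\<^bsub>direct_limit J below G \<phi>\<^esub> rel `` {(j, y)} =
    rel `` {(k, \<phi> i k x \<otimes>\<^bsub>G k\<^esub> \<phi> j k y)}"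
proof -
  let ?T = "rel `` {(k, \<phi> i k x \<otimes>\<^bsub>G k\<^esub> \<phi> j k y)}"
  have *: "rel `` {(k', \<phi> i' k' x' \<otimes>\<^bsub>G k'\<^esub> \<phi> j' k' y')} = ?T"
    if rx: "((i, x), (i', x')) \<in> rel" and ry: "((j, y), (j', y')) \<in> rel"
      and k': "k' \<in> J" "below i' k'" "below j' k'"
    for i' x' j' y' k'
  proof -
    obtain u where u: "i' \<in> J" "x' \<in> carrier (G i')" "u \<in> J" "below i u" "below i' u"
      "\<phi> i u x = \<phi> i' u x'" by (rule relE[OF rx])
    obtain v where v: "j' \<in> J" "y' \<in> carrier (G j')" "v \<in> J" "below j v" "below j' v"
      "\<phi> j v y = \<phi> j' v y'" by (rule relE[OF ry])
    \<comment> \<open>The stage \<open>w\<close> found here lies above all stages in use, so both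
      products can be pushed there and compared.\<close>
    obtain w1 where w1: "w1 \<in> J" "below u w1" "below v w1" using directed[OF u(3) v(3)] by blast
    obtain w2 where w2: "w2 \<in> J" "below k w2" "below k' w2" using directed[OF k(1) k'(1)] by blast
    obtain w where w: "w \<in> J" "below w1 w" "below w2 w" using directed[OF w1(1) w2(1)] by blast
    have b: "below u w" "below v w" "below k w" "below k' w" using w w1 w2 by (meson trans)+
    have e: "\<phi> i w x = \<phi> i' w x'" "\<phi> j w y = \<phi> j' w y'"
      by (rule later_eq[of i x i' x' u]; use i u b w in auto)
        (rule later_eq[of j y j' y' v]; use j v b w in auto)
    have c: "\<phi> i k x \<in> carrier (G k)" "\<phi> j k y \<in> carrier (G k)"
      "\<phi> i' k' x' \<in> carrier (G k')" "\<phi> j' k' y' \<in> carrier (G k')"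
      using i j k u v that closed by auto
    have m: "\<phi> i k x \<otimes>\<^bsub>G k\<^esub> \<phi> j k y \<in> carrier (G k)"
      "\<phi> i' k' x' \<otimes>\<^bsub>G k'\<^esub> \<phi> j' k' y' \<in> carrier (G k')"
      using c k k' monoid by (auto intro: monoid.m_closed)
    have "\<phi> k w (\<phi> i k x \<otimes>\<^bsub>G k\<^esub> \<phi> j k y) = \<phi> k w (\<phi> i k x) \<otimes>\<^bsub>G w\<^esub> \<phi> k w (\<phi> j k y)"
      using hom[of k w] k w b c by (auto simp: hom_def)
    also have "\<dots> = \<phi> i w x \<otimes>\<^bsub>G w\<^esub> \<phi> j w y" using i j k w b by (simp add: comp)
    also have "\<dots> = \<phi> i' w x' \<otimes>\<^bsub>G w\<^esub> \<phi> j' w y'" by (simp add: e)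
    also have "\<dots> = \<phi> k' w (\<phi> i' k' x') \<otimes>\<^bsub>G w\<^esub> \<phi> k' w (\<phi> j' k' y')"
      using u v k' w b by (simp add: comp)
    also have "\<dots> = \<phi> k' w (\<phi> i' k' x' \<otimes>\<^bsub>G k'\<^esub> \<phi> j' k' y')"
      using hom[of k' w] k' w b c by (auto simp: hom_def)
    finally show ?thesis
      using k k' m w b by (subst class_eq_iff) (auto intro: relI)
  qed
  have self: "((i, x), (i, x)) \<in> rel" "((j, y), (j, y)) \<in> rel"
    using i j refl relI[of i x i x i] relI[of j y j y j] by auto
  let ?K = "\<lambda>p q. {k \<in> J. below (fst p) k \<and> below (fst q) k}"
  have "rel `` {(i, x)} \<otimes>\<^bsub>direct_limit J below G \<phi>\<^esub> rel `` {(j, y)} =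
      (\<Union>p\<in>rel `` {(i, x)}. \<Union>q\<in>rel `` {(j, y)}. \<Union>k'\<in>?K p q.
        rel `` {(k', \<phi> (fst p) k' (snd p) \<otimes>\<^bsub>G k'\<^esub> \<phi> (fst q) k' (snd q))})"
    by (simp add: direct_limit_def case_prod_beta)
  also have "\<dots> = (\<Union>p\<in>rel `` {(i, x)}. \<Union>q\<in>rel `` {(j, y)}. \<Union>k'\<in>?K p q. ?T)"
  proof (intro SUP_cong[OF HOL.refl])
    fix p q k' assume "p \<in> rel `` {(i, x)}" "q \<in> rel `` {(j, y)}" "k' \<in> ?K p q"
    then show "rel `` {(k', \<phi> (fst p) k' (snd p) \<otimes>\<^bsub>G k'\<^esub> \<phi> (fst q) k' (snd q))} = ?T"
      using *[of "fst p" "snd p" "fst q" "snd q" k'] by simp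
  qed
  also have "\<dots> = ?T"
  proof (intro equalityI subsetI)
    fix z assume "z \<in> ?T"
    moreover have "(i, x) \<in> rel `` {(i, x)}" "(j, y) \<in> rel `` {(j, y)}" "k \<in> ?K (i, x) (j, y)"
      using self k by simp_all
    ultimately show "z \<in> (\<Union>p\<in>rel `` {(i, x)}. \<Union>q\<in>rel `` {(j, y)}. \<Union>k'\<in>?K p q. ?T)"
      by (intro UN_I)
  qed (elim UN_E)
  finally show ?thesis .
qed

text \<open>A class represented at stage \<open>i\<close> is moved up to a stage \<open>k\<close>
  above \<open>i\<close> and \<open>j\<close>, and from there back to \<open>j\<close> along the
  bijection \<open>\<phi> j k\<close>.\<close>

lemma stage_iso:
  assumes j: "j \<in> J"
    and bij: "\<And>k. k \<in> J \<Longrightarrow> below j k \<Longrightarrow> bij_betw (\<phi> j k) (carrier (G j)) (carrier (G k))"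
  shows "(\<lambda>x. rel `` {(j, x)}) \<in> iso (G j) (direct_limit J below G \<phi>)"
proof (rule isoI)
  have carrier: "carrier (direct_limit J below G \<phi>) = (SIGMA j:J. carrier (G j)) // rel"
    by (simp add: direct_limit_def)
  show "(\<lambda>x. rel `` {(j, x)}) \<in> hom (G j) (direct_limit J below G \<phi>)"
  proof (rule homI)
    fix x y assume x: "x \<in> carrier (G j)" 
    then show "rel `` {(j, x)} \<in> carrier (direct_limit J below G \<phi>)"
      using j by (auto simp: carrier intro: quotientI)
    assume y: "y \<in> carrier (G j)"
    show "rel `` {(j, x \<otimes>\<^bsub>G j\<^esub> y)} =
        rel `` {(j, x)} \<otimes>\<^bsub>direct_limit J below G \<phi>\<^esub> rel `` {(j, y)}"
      using mult_class[OF j x j y j refl[OF j] refl[OF j]] x y j by (simp add: id)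
  qed
  show "bij_betw (\<lambda>x. rel `` {(j, x)}) (carrier (G j)) (carrier (direct_limit J below G \<phi>))"
    unfolding bij_betw_def
  proof
    show "inj_on (\<lambda>x. rel `` {(j, x)}) (carrier (G j))"
    proof (rule inj_onI)
      fix x y assume xy: "x \<in> carrier (G j)" "y \<in> carrier (G j)" "rel `` {(j, x)} = rel `` {(j, y)}"
      then have "((j, x), (j, y)) \<in> rel" using j by (simp add: class_eq_iff)
      then obtain k where "k \<in> J" "below j k" "\<phi> j k x = \<phi> j k y" by (auto elim: relE)
      then show "x = y" using bij[of k] xy by (auto simp: bij_betw_def inj_on_def)
    qed
    show "(\<lambda>x. rel `` {(j, x)}) ` carrier (G j) = carrier (direct_limit J below G \<phi>)"
    proof (intro equalityI subsetI)
      fix X assume "X \<in> carrier (direct_limit J below G \<phi>)"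
      then obtain i x where x: "i \<in> J" "x \<in> carrier (G i)" "X = rel `` {(i, x)}"
        by (auto simp: carrier elim!: quotientE)
      obtain k where k: "k \<in> J" "below i k" "below j k" using directed x j by blast
      then obtain y where y: "y \<in> carrier (G j)" "\<phi> j k y = \<phi> i k x"
        using bij[of k] closed[of i k x] x by (metis bij_betw_def imageE)
      have "X = rel `` {(k, \<phi> i k x)}" using class_push x k by simp
      also have "\<dots> = rel `` {(j, y)}" using class_push[of j y k] y k j by simp
      finally show "X \<in> (\<lambda>x. rel `` {(j, x)}) ` carrier (G j)" using y by blast
    qed (use j in \<open>auto simp: carrier intro: quotientI\<close>)
  qed
qed

end

section \<open>Natural isomorphisms\<close>

lemma naturally_isomorphicI:
  assumes "\<And>A. comm_group A \<Longrightarrow> \<theta> A \<in> iso (F A) (G A)"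
    and "\<And>A B h x. comm_group A \<Longrightarrow> comm_group B \<Longrightarrow> h \<in> hom A B \<Longrightarrow> x \<in> carrier (F A) \<Longrightarrow>
      \<theta> B (Fmap B h x) = Gmap B h (\<theta> A x)"
  shows "naturally_isomorphic F Fmap G Gmap"
  unfolding naturally_isomorphic_def using assms by blast

lemma naturally_isomorphic_iso:
  assumes "naturally_isomorphic F Fmap G Gmap" "comm_group A"
  shows "F A \<cong> G A"
  using assms unfolding naturally_isomorphic_def is_iso_def by blast

lemma naturally_isomorphic_trans:
  assumes "naturally_isomorphic F Fmap G Gmap" "naturally_isomorphic G Gmap H Hmap"
  shows "naturally_isomorphic F Fmap H Hmap"
proof -
  obtain \<theta> where t: "\<And>A. comm_group A \<Longrightarrow> \<theta> A \<in> iso (F A) (G A)"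
    "\<And>A B h x. comm_group A \<Longrightarrow> comm_group B \<Longrightarrow> h \<in> hom A B \<Longrightarrow> x \<in> carrier (F A) \<Longrightarrow>
      \<theta> B (Fmap B h x) = Gmap B h (\<theta> A x)"
    using assms(1) unfolding naturally_isomorphic_def by blast
  obtain \<eta> where e: "\<And>A. comm_group A \<Longrightarrow> \<eta> A \<in> iso (G A) (H A)"
    "\<And>A B h x. comm_group A \<Longrightarrow> comm_group B \<Longrightarrow> h \<in> hom A B \<Longrightarrow> x \<in> carrier (G A) \<Longrightarrow>
      \<eta> B (Gmap B h x) = Hmap B h (\<eta> A x)"
    using assms(2) unfolding naturally_isomorphic_def by blast
  show ?thesis
  proof (rule naturally_isomorphicI[of "\<lambda>A. \<eta> A \<circ> \<theta> A"])
    show "\<eta> A \<circ> \<theta> A \<in> iso (F A) (H A)" if "comm_group A" for A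
      using t(1) e(1) that iso_set_trans by blast
    show "(\<eta> B \<circ> \<theta> B) (Fmap B h x) = Hmap B h ((\<eta> A \<circ> \<theta> A) x)"
      if "comm_group A" "comm_group B" "h \<in> hom A B" "x \<in> carrier (F A)" for A B h x
      using t(2)[OF that] e(2)[OF that(1-3), of "\<theta> A x"] t(1)[OF that(1)] that(4)
      by (auto simp: iso_def hom_def)
  qed
qed

text \<open>An inverse is controlled only on the carrier, so turning the naturality square around
  requires that \<open>Fmap\<close> stays inside the carriers, which is assumed as
  \<open>closed\<close>.\<close>

lemma naturally_isomorphic_sym:
  assumes "naturally_isomorphic F Fmap G Gmap" "\<And>A. comm_group A \<Longrightarrow> Group.group (F A)"
    and closed: "\<And>A B h x. comm_group A \<Longrightarrow> comm_group B \<Longrightarrow> h \<in> hom A B \<Longrightarrow> x \<in> carrier (F A) \<Longrightarrow>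
      Fmap B h x \<in> carrier (F B)"
  shows "naturally_isomorphic G Gmap F Fmap"
proof -
  obtain \<theta> where t: "\<And>A. comm_group A \<Longrightarrow> \<theta> A \<in> iso (F A) (G A)"
    "\<And>A B h x. comm_group A \<Longrightarrow> comm_group B \<Longrightarrow> h \<in> hom A B \<Longrightarrow> x \<in> carrier (F A) \<Longrightarrow>
      \<theta> B (Fmap B h x) = Gmap B h (\<theta> A x)"
    using assms(1) unfolding naturally_isomorphic_def by blast
  show ?thesis
  proof (rule naturally_isomorphicI[of "\<lambda>A. inv_into (carrier (F A)) (\<theta> A)"])
    show "inv_into (carrier (F A)) (\<theta> A) \<in> iso (G A) (F A)" if "comm_group A" for A
      using group.iso_set_sym[OF assms(2)[OF that] t(1)[OF that]] .
    fix A B :: "'a monoid" and h y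
    assume AB: "comm_group A" "comm_group B" "h \<in> hom A B" and y: "y \<in> carrier (G A)"
    define x where "x = inv_into (carrier (F A)) (\<theta> A) y"
    have bij: "bij_betw (\<theta> A) (carrier (F A)) (carrier (G A))"
      "bij_betw (\<theta> B) (carrier (F B)) (carrier (G B))"
      using t(1) AB by (auto simp: iso_def)
    then have x: "x \<in> carrier (F A)" "\<theta> A x = y"
      using y by (auto simp: x_def bij_betw_def inv_into_into f_inv_into_f)
    have "Gmap B h y = \<theta> B (Fmap B h x)" using t(2)[OF AB x(1)] x(2) by simp
    then show "inv_into (carrier (F B)) (\<theta> B) (Gmap B h y) =
        Fmap B h (inv_into (carrier (F A)) (\<theta> A) y)"
      using closed[OF AB x(1)] bij(2) by (simp add: bij_betw_def flip: x_def)
  qed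
qed

section \<open>Coboundaries and pullbacks of cochains\<close>

lemma overlap_delete_nth: "x \<in> overlap V xs \<Longrightarrow> x \<in> overlap V (delete_nth i xs)"
  using set_delete_nth[of i xs] by (auto simp: overlap_def)

text \<open>The tool for evaluating a coboundary at a point: \<open>F\<close> may be any total
  function that has the values of the cochain at increasing tuples through \<open>x\<close>.\<close>

lemma coboundary_eq_asum:
  assumes "comm_group A" "range F \<subseteq> carrier A"
    and "\<And>zs. zs \<in> increasing_tuples r (n + 1) \<Longrightarrow> x \<in> overlap V zs \<Longrightarrow> f zs x = F zs"
    and "xs \<in> increasing_tuples r (n + 2)" "x \<in> overlap V xs"
  shows "coboundary_map A r V n f xs x = asum A xs F"
proof -
  have "length xs = Suc (n + 1)" "xs \<in> increasing_tuples r (Suc (n + 1))"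
    using assms(4) by (auto simp: increasing_tuples_def)
  then have "f (delete_nth i xs) x = F (delete_nth i xs)" if "i < length xs" for i
    using that by (intro assms(3) delete_nth_increasing_tuples overlap_delete_nth assms(5)) auto
  then show ?thesis
    using assms by (simp add: coboundary_map_def alternating_sum_eq_asum[of A F])
qed

lemma alt_ext_range:
  assumes "comm_group A" "Well_order s" "f \<in> carrier (all_cochains A s W n)"
  shows "range (alt_ext A s W n f x) \<subseteq> carrier A"
  using alt_ext_closed[OF assms] by auto

lemma coboundary_alt_ext:
  assumes "comm_group A" "Well_order r" "f \<in> carrier (all_cochains A r V n)"
    and "xs \<in> increasing_tuples r (n + 2)" "x \<in> overlap V xs"
  shows "coboundary_map A r V n f xs x = asum A xs (alt_ext A r V n f x)"
  using assms by (intro coboundary_eq_asum alt_ext_range alt_ext_increasing[symmetric])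

lemma coboundary_closed:
  assumes "comm_group A" "Well_order r" "f \<in> carrier (all_cochains A r V n)"
  shows "coboundary_map A r V n f \<in> carrier (all_cochains A r V (n + 1))"
proof (rule all_cochains_carrierI)
  interpret comm_group A by fact
  fix xs x assume "xs \<in> increasing_tuples r (n + 1 + 1)" "x \<in> overlap V xs"
  then show "coboundary_map A r V n f xs x \<in> carrier A"
    using coboundary_alt_ext[OF assms] alt_ext_range[OF assms] by simp
qed (auto simp: coboundary_map_def)

lemma asum_length:
  assumes "comm_group A" "range f \<subseteq> carrier A" "\<And>zs. length zs = k \<Longrightarrow> f zs = \<one>\<^bsub>A\<^esub>"
    and "length ys = Suc k"
  shows "asum A ys f = \<one>\<^bsub>A\<^esub>"
proof -
  interpret comm_group A by fact
  show ?thesis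
    unfolding asum_eq_finprod[OF assms(2)]
    using assms(3,4) by (intro finprod_one_eqI) (simp add: length_delete_nth)
qed

text \<open>At tuples of the right length both sides are alternating in \<open>ys\<close> and agree
  at increasing tuples. At other lengths every face has the wrong length for the cut-off, so both
  sides are trivial.\<close>

lemma alt_ext_coboundary:
  assumes A: "comm_group A" "Well_order r" and f: "f \<in> carrier (all_cochains A r V n)"
    and ys: "set ys \<subseteq> Field r" "x \<in> overlap V ys"
  shows "alt_ext A r V (n + 1) (coboundary_map A r V n f) x ys = asum A ys (alt_ext A r V n f x)"
proof (cases "length ys = n + 2")
  case True
  interpret comm_group A by fact
  show ?thesis
    using A coboundary_closed[OF A f] asum_alternating[OF alternating_alt_ext[OF A f]] True ys
    by (intro alt_ext_unique[where F="\<lambda>ys. asum A ys (alt_ext A r V n f x)"])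
      (auto simp: coboundary_alt_ext[OF A f])
next
  case False
  interpret comm_group A by fact
  show ?thesis
  proof (cases ys)
    case (Cons z zs)
    then have "asum A ys (alt_ext A r V n f x) = \<one>\<^bsub>A\<^esub>"
      using False by (intro asum_length[of A _ "length zs"] A alt_ext_range f alt_ext_length) auto
    then show ?thesis using False by (simp add: alt_ext_length)
  qed (simp add: alt_ext_length)
qed

lemma coboundary_coboundary:
  assumes A: "comm_group A" "Well_order r" and f: "f \<in> carrier (all_cochains A r V n)"
  shows "coboundary_map A r V (n + 1) (coboundary_map A r V n f) = \<one>\<^bsub>all_cochains A r V (n + 2)\<^esub>"
proof (rule all_cochains_eqI)
  interpret comm_group A by fact
  interpret M: comm_group "all_cochains A r V (n + 2)" by (rule comm_group_all_cochains) fact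
  show "\<one>\<^bsub>all_cochains A r V (n + 2)\<^esub> \<in> carrier (all_cochains A r V (n + 2))"
    by (rule M.one_closed)
  note df = coboundary_closed[OF A f]
  show "coboundary_map A r V (n + 1) (coboundary_map A r V n f) \<in> carrier (all_cochains A r V (n + 2))"
    using coboundary_closed[OF A df] by simp
  fix xs x assume xs: "xs \<in> increasing_tuples r (n + 2 + 1)" "x \<in> overlap V xs"
  have "coboundary_map A r V (n + 1) (coboundary_map A r V n f) xs x =
      asum A xs (\<lambda>zs. asum A zs (alt_ext A r V n f x))"
  proof (rule coboundary_eq_asum[OF A(1)])
    show "range (\<lambda>zs. asum A zs (alt_ext A r V n f x)) \<subseteq> carrier A"
      using alt_ext_range[OF A f] by auto
    show "coboundary_map A r V n f zs x = asum A zs (alt_ext A r V n f x)"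
      if "zs \<in> increasing_tuples r (n + 1 + 1)" "x \<in> overlap V zs" for zs
      using that by (intro coboundary_alt_ext A f) auto
  qed (use xs in auto)
  then show "coboundary_map A r V (n + 1) (coboundary_map A r V n f) xs x =
      \<one>\<^bsub>all_cochains A r V (n + 2)\<^esub> xs x"
    unfolding asum_asum[OF alt_ext_range[OF A f]] all_cochains_one[OF xs] .
qed

lemma coboundary_mult:
  assumes A: "comm_group A" "Well_order r"
    and f: "f \<in> carrier (all_cochains A r V n)" and g: "g \<in> carrier (all_cochains A r V n)"
  shows "coboundary_map A r V n (f \<otimes>\<^bsub>all_cochains A r V n\<^esub> g) =
    coboundary_map A r V n f \<otimes>\<^bsub>all_cochains A r V (n + 1)\<^esub> coboundary_map A r V n g"
proof (rule all_cochains_eqI)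
  interpret comm_group A by fact
  interpret M: comm_group "all_cochains A r V n" by (rule comm_group_all_cochains) fact
  interpret N: comm_group "all_cochains A r V (n + 1)" by (rule comm_group_all_cochains) fact
  note fg = M.m_closed[OF f g]
  show "coboundary_map A r V n (f \<otimes>\<^bsub>all_cochains A r V n\<^esub> g) \<in> carrier (all_cochains A r V (n + 1))"
    using A fg by (rule coboundary_closed)
  show "coboundary_map A r V n f \<otimes>\<^bsub>all_cochains A r V (n + 1)\<^esub> coboundary_map A r V n g
      \<in> carrier (all_cochains A r V (n + 1))"
    using A f g by (intro N.m_closed coboundary_closed)
  fix xs x assume xs: "xs \<in> increasing_tuples r (n + 1 + 1)" "x \<in> overlap V xs"
  then have xs': "xs \<in> increasing_tuples r (n + 2)" by simp
  show "coboundary_map A r V n (f \<otimes>\<^bsub>all_cochains A r V n\<^esub> g) xs x =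
    (coboundary_map A r V n f \<otimes>\<^bsub>all_cochains A r V (n + 1)\<^esub> coboundary_map A r V n g) xs x"
    unfolding all_cochains_mult[OF xs] coboundary_alt_ext[OF A fg xs' xs(2)]
      coboundary_alt_ext[OF A f xs' xs(2)] coboundary_alt_ext[OF A g xs' xs(2)] alt_ext_mult[OF A f g]
    using alt_ext_range[OF A f] alt_ext_range[OF A g] by (rule asum_mult)
qed

lemma coboundary_hom:
  assumes "comm_group A" "Well_order r"
  shows "coboundary_map A r V n \<in> hom (all_cochains A r V n) (all_cochains A r V (n + 1))"
  using coboundary_closed[OF assms] coboundary_mult[OF assms] by (intro homI)

text \<open>The index chosen for \<open>i\<close> depends on the point: \<open>V i\<close> is
  covered by the members chosen at its points, but need not lie in any one of them.\<close>

definition pointwise_refines ::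
    "'i rel \<Rightarrow> ('i \<Rightarrow> 'x set) \<Rightarrow> 'j rel \<Rightarrow> ('j \<Rightarrow> 'x set) \<Rightarrow> ('x \<Rightarrow> 'i \<Rightarrow> 'j) \<Rightarrow> bool" where
  "pointwise_refines r V s W \<rho> \<longleftrightarrow> (\<forall>i\<in>Field r. \<forall>x\<in>V i. \<rho> x i \<in> Field s \<and> x \<in> W (\<rho> x i))"

definition pointwise_pullback ::
    "'a monoid \<Rightarrow> 'j rel \<Rightarrow> ('j \<Rightarrow> 'x set) \<Rightarrow> 'i rel \<Rightarrow> ('i \<Rightarrow> 'x set) \<Rightarrow> nat \<Rightarrow> ('x \<Rightarrow> 'i \<Rightarrow> 'j)
      \<Rightarrow> ('j list \<Rightarrow> 'x \<Rightarrow> 'a) \<Rightarrow> ('i list \<Rightarrow> 'x \<Rightarrow> 'a)" where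
  "pointwise_pullback A s W r V n \<rho> f =
     (\<lambda>xs\<in>increasing_tuples r (n + 1). \<lambda>x\<in>overlap V xs. alt_ext A s W n f x (map (\<rho> x) xs))"

lemma pointwise_pullback_apply:
  "xs \<in> increasing_tuples r (n + 1) \<Longrightarrow> x \<in> overlap V xs \<Longrightarrow>
     pointwise_pullback A s W r V n \<rho> f xs x = alt_ext A s W n f x (map (\<rho> x) xs)"
  by (simp add: pointwise_pullback_def)

lemma pointwise_refines_map:
  assumes "pointwise_refines r V s W \<rho>" "set xs \<subseteq> Field r" "x \<in> overlap V xs"
  shows "set (map (\<rho> x) xs) \<subseteq> Field s" "x \<in> overlap W (map (\<rho> x) xs)"
  using assms by (auto simp: pointwise_refines_def overlap_def)

text \<open>An ordinary refinement function is the constant choice. Its image tuples have the right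
  length and consist of members containing \<open>x\<close>, so the cut-off in
  \<open>alt_ext\<close> does not interfere.\<close>

lemma pullback_eq_pointwise_pullback:
  assumes "pointwise_refines r V s W (\<lambda>_. \<rho>)"
  shows "pullback A s r V n \<rho> f = pointwise_pullback A s W r V n (\<lambda>_. \<rho>) f"
proof -
  have "alternating_extension A s f (map \<rho> xs) x = alt_ext A s W n f x (map \<rho> xs)"
    if "xs \<in> increasing_tuples r (n + 1)" "x \<in> overlap V xs" for xs x
    using that pointwise_refines_map[OF assms, of xs x] by (auto simp: alt_ext_def increasing_tuples_def)
  then show ?thesis
    unfolding pullback_def pointwise_pullback_def by (intro restrict_ext) auto
qed

lemma pointwise_pullback_closed:
  assumes "comm_group A" "Well_order s" "f \<in> carrier (all_cochains A s W n)"
  shows "pointwise_pullback A s W r V n \<rho> f \<in> carrier (all_cochains A r V n)"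
  by (rule all_cochains_carrierI) (auto simp: pointwise_pullback_def alt_ext_closed[OF assms])

lemma pointwise_pullback_mult:
  assumes A: "comm_group A" "Well_order s"
    and f: "f \<in> carrier (all_cochains A s W n)" and g: "g \<in> carrier (all_cochains A s W n)"
  shows "pointwise_pullback A s W r V n \<rho> (f \<otimes>\<^bsub>all_cochains A s W n\<^esub> g) =
    pointwise_pullback A s W r V n \<rho> f \<otimes>\<^bsub>all_cochains A r V n\<^esub> pointwise_pullback A s W r V n \<rho> g"
proof (rule all_cochains_eqI)
  interpret M: comm_group "all_cochains A s W n" by (rule comm_group_all_cochains) fact
  interpret N: comm_group "all_cochains A r V n" by (rule comm_group_all_cochains) fact
  show "pointwise_pullback A s W r V n \<rho> (f \<otimes>\<^bsub>all_cochains A s W n\<^esub> g) \<in> carrier (all_cochains A r V n)"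
    using A f g by (intro pointwise_pullback_closed M.m_closed)
  show "pointwise_pullback A s W r V n \<rho> f \<otimes>\<^bsub>all_cochains A r V n\<^esub> pointwise_pullback A s W r V n \<rho> g
      \<in> carrier (all_cochains A r V n)"
    using A f g by (intro pointwise_pullback_closed N.m_closed)
  fix xs x assume xs: "xs \<in> increasing_tuples r (n + 1)" "x \<in> overlap V xs"
  show "pointwise_pullback A s W r V n \<rho> (f \<otimes>\<^bsub>all_cochains A s W n\<^esub> g) xs x =
    (pointwise_pullback A s W r V n \<rho> f \<otimes>\<^bsub>all_cochains A r V n\<^esub> pointwise_pullback A s W r V n \<rho> g) xs x"
    unfolding all_cochains_mult[OF xs] pointwise_pullback_apply[OF xs] by (rule alt_ext_mult[OF A f g])
qed

text \<open>Both sides are alternating in \<open>ys\<close>, so agreement at increasing tuples is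
  enough.\<close>

lemma alt_ext_pointwise_pullback:
  assumes A: "comm_group A" "Well_order s" "Well_order r" and f: "f \<in> carrier (all_cochains A s W n)"
    and \<rho>: "pointwise_refines r V s W \<rho>" and ys: "set ys \<subseteq> Field r" "x \<in> overlap V ys"
  shows "alt_ext A r V n (pointwise_pullback A s W r V n \<rho> f) x ys = alt_ext A s W n f x (map (\<rho> x) ys)"
proof (cases "length ys = n + 1")
  case True
  interpret comm_group A by fact
  show ?thesis
    using A pointwise_pullback_closed[OF A(1,2) f] True ys
      alternating_map[OF alternating_alt_ext[OF A(1,2) f]]
    by (intro alt_ext_unique[where F="\<lambda>ys. alt_ext A s W n f x (map (\<rho> x) ys)"])
      (auto simp: pointwise_pullback_apply)
qed (simp add: alt_ext_length)

text \<open>The coboundary is computed at one point at a time, with \<open>\<rho> x\<close> as a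
  fixed map of indices, so the dependence of \<open>\<rho>\<close> on the point does no
  harm.\<close>

lemma pointwise_pullback_coboundary:
  assumes A: "comm_group A" "Well_order s" "Well_order r" and f: "f \<in> carrier (all_cochains A s W n)"
    and \<rho>: "pointwise_refines r V s W \<rho>"
  shows "pointwise_pullback A s W r V (n + 1) \<rho> (coboundary_map A s W n f) =
    coboundary_map A r V n (pointwise_pullback A s W r V n \<rho> f)"
proof (rule all_cochains_eqI)
  interpret comm_group A by fact
  note pf = pointwise_pullback_closed[OF A(1,2) f]
  show "pointwise_pullback A s W r V (n + 1) \<rho> (coboundary_map A s W n f) \<in> carrier (all_cochains A r V (n + 1))"
    using A f by (intro pointwise_pullback_closed coboundary_closed)
  show "coboundary_map A r V n (pointwise_pullback A s W r V n \<rho> f) \<in> carrier (all_cochains A r V (n + 1))"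
    using A pf by (intro coboundary_closed)
  fix xs x assume xs: "xs \<in> increasing_tuples r (n + 1 + 1)" "x \<in> overlap V xs"
  then have sub: "set xs \<subseteq> Field r" by (auto simp: increasing_tuples_def)
  have "coboundary_map A r V n (pointwise_pullback A s W r V n \<rho> f) xs x =
      asum A xs (\<lambda>zs. alt_ext A s W n f x (map (\<rho> x) zs))"
  proof (rule coboundary_eq_asum[OF A(1)])
    show "range (\<lambda>zs. alt_ext A s W n f x (map (\<rho> x) zs)) \<subseteq> carrier A"
      using alt_ext_closed[OF A(1,2) f] by auto
  qed (use xs in \<open>auto simp: pointwise_pullback_apply\<close>)
  then show "pointwise_pullback A s W r V (n + 1) \<rho> (coboundary_map A s W n f) xs x =
      coboundary_map A r V n (pointwise_pullback A s W r V n \<rho> f) xs x"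
    unfolding pointwise_pullback_apply[OF xs]
      alt_ext_coboundary[OF A(1,2) f pointwise_refines_map[OF \<rho> sub xs(2)]] asum_map by simp
qed

lemma pointwise_pullback_pointwise_pullback:
  assumes A: "comm_group A" "Well_order t" "Well_order s" and f: "f \<in> carrier (all_cochains A t X n)"
    and \<sigma>: "pointwise_refines s W t X \<sigma>" and \<rho>: "pointwise_refines r V s W \<rho>"
  shows "pointwise_pullback A s W r V n \<rho> (pointwise_pullback A t X s W n \<sigma> f) =
    pointwise_pullback A t X r V n (\<lambda>x i. \<sigma> x (\<rho> x i)) f"
proof (rule all_cochains_eqI)
  fix xs x assume xs: "xs \<in> increasing_tuples r (n + 1)" "x \<in> overlap V xs"
  then have sub: "set xs \<subseteq> Field r" by (auto simp: increasing_tuples_def)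
  show "pointwise_pullback A s W r V n \<rho> (pointwise_pullback A t X s W n \<sigma> f) xs x =
    pointwise_pullback A t X r V n (\<lambda>x i. \<sigma> x (\<rho> x i)) f xs x"
    unfolding pointwise_pullback_apply[OF xs]
      alt_ext_pointwise_pullback[OF A f \<sigma> pointwise_refines_map[OF \<rho> sub xs(2)]]
    by (simp add: comp_def)
qed (use A f in \<open>auto intro: pointwise_pullback_closed\<close>)

lemma pointwise_refines_comp:
  assumes "pointwise_refines s W t X \<sigma>" "pointwise_refines r V s W \<rho>"
  shows "pointwise_refines r V t X (\<lambda>x i. \<sigma> x (\<rho> x i))"
  using assms by (simp add: pointwise_refines_def)

lemma pointwise_pullback_id:
  assumes A: "comm_group A" "Well_order r" and f: "f \<in> carrier (all_cochains A r V n)"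
  shows "pointwise_pullback A r V r V n (\<lambda>_ i. i) f = f"
proof (rule all_cochains_eqI)
  fix xs x assume xs: "xs \<in> increasing_tuples r (n + 1)" "x \<in> overlap V xs"
  show "pointwise_pullback A r V r V n (\<lambda>_ i. i) f xs x = f xs x"
    unfolding pointwise_pullback_apply[OF xs] using alt_ext_increasing[OF A f xs] by simp
qed (use A f in \<open>auto intro: pointwise_pullback_closed\<close>)

text \<open>Lowers the degree by one: the prism over \<open>n\<close> indices repeats one of them
  and so evaluates \<open>f\<close>, of degree \<open>n\<close>, at tuples of length
  \<open>n + 1\<close>.\<close>

definition prism_cochain ::
    "'a monoid \<Rightarrow> 'j rel \<Rightarrow> ('j \<Rightarrow> 'x set) \<Rightarrow> 'i rel \<Rightarrow> ('i \<Rightarrow> 'x set) \<Rightarrow> nat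
      \<Rightarrow> ('x \<Rightarrow> 'i \<Rightarrow> 'j) \<Rightarrow> ('x \<Rightarrow> 'i \<Rightarrow> 'j) \<Rightarrow> ('j list \<Rightarrow> 'x \<Rightarrow> 'a) \<Rightarrow> ('i list \<Rightarrow> 'x \<Rightarrow> 'a)" where
  "prism_cochain A s W r V n \<rho> \<sigma> f =
     (\<lambda>xs\<in>increasing_tuples r n. \<lambda>x\<in>overlap V xs. prism A (\<rho> x) (\<sigma> x) xs (alt_ext A s W n f x))"

lemma prism_cochain_closed:
  assumes "comm_group A" "Well_order s" "f \<in> carrier (all_cochains A s W (n + 1))"
  shows "prism_cochain A s W r V (n + 1) \<rho> \<sigma> f \<in> carrier (all_cochains A r V n)"
proof -
  interpret comm_group A by fact
  show ?thesis
    using alt_ext_range[OF assms]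
    by (intro all_cochains_carrierI) (auto simp: prism_cochain_def intro!: prism_closed)
qed

text \<open>The coboundary of a cocycle is known to vanish only at tuples of members containing the
  point, and the prism evaluates its argument only at entries from the two images.\<close>

lemma prism_trivial:
  assumes "comm_group A" "\<And>ws. set ws \<subseteq> \<rho> ` set zs \<union> \<sigma> ` set zs \<Longrightarrow> f ws = \<one>\<^bsub>A\<^esub>"
  shows "prism A \<rho> \<sigma> zs f = \<one>\<^bsub>A\<^esub>"
  using assms(2)
proof (induction zs arbitrary: f)
  interpret comm_group A by fact
  case (Cons z zs)
  have "prism A \<rho> \<sigma> zs (\<lambda>zs. f (\<rho> z # zs)) = \<one>\<^bsub>A\<^esub>"
    by (intro Cons.IH Cons.prems) auto
  moreover have "f (\<rho> z # \<sigma> z # map \<sigma> zs) = \<one>\<^bsub>A\<^esub>" by (intro Cons.prems) auto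
  ultimately show ?case by simp
qed simp

text \<open>For a cocycle the term Pd of the homotopy formula is trivial, which leaves the quotient
  of the two pullbacks equal to a coboundary.\<close>

lemma coboundary_prism_cochain:
  assumes A: "comm_group A" "Well_order s" "Well_order r"
    and f: "f \<in> carrier (all_cochains A s W (n + 1))"
    and df: "coboundary_map A s W (n + 1) f = \<one>\<^bsub>all_cochains A s W (n + 2)\<^esub>"
    and \<rho>: "pointwise_refines r V s W \<rho>" and \<sigma>: "pointwise_refines r V s W \<sigma>"
  shows "pointwise_pullback A s W r V (n + 1) \<sigma> f
      \<otimes>\<^bsub>all_cochains A r V (n + 1)\<^esub> inv\<^bsub>all_cochains A r V (n + 1)\<^esub> pointwise_pullback A s W r V (n + 1) \<rho> f =
    coboundary_map A r V n (prism_cochain A s W r V (n + 1) \<rho> \<sigma> f)" (is "?l = ?r")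
proof (rule all_cochains_eqI)
  interpret comm_group A by fact
  interpret N: comm_group "all_cochains A r V (n + 1)" by (rule comm_group_all_cochains) fact
  note pf = pointwise_pullback_closed[OF A(1,2) f]
  show "?l \<in> carrier (all_cochains A r V (n + 1))"
    by (intro N.m_closed N.inv_closed pf)
  show "?r \<in> carrier (all_cochains A r V (n + 1))"
    using A f by (intro coboundary_closed prism_cochain_closed)
  fix xs x assume xs: "xs \<in> increasing_tuples r (n + 1 + 1)" "x \<in> overlap V xs"
  then have sub: "set xs \<subseteq> Field r" and len: "length xs = n + 2" by (auto simp: increasing_tuples_def)
  let ?F = "alt_ext A s W (n + 1) f x"
  note rg = alt_ext_range[OF A(1,2) f]
  have "?r xs x = asum A xs (\<lambda>zs. prism A (\<rho> x) (\<sigma> x) zs ?F)"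
  proof (rule coboundary_eq_asum[OF A(1)])
    show "range (\<lambda>zs. prism A (\<rho> x) (\<sigma> x) zs ?F) \<subseteq> carrier A"
      using rg by auto
  qed (use xs in \<open>auto simp: prism_cochain_def\<close>)
  moreover have "prism A (\<rho> x) (\<sigma> x) xs (\<lambda>zs. asum A zs ?F) = \<one>\<^bsub>A\<^esub>"
  proof -
    \<comment> \<open>All tuples occurring in the prism over \<open>xs\<close> consist of indices of members containing \<open>x\<close>.\<close>
    have "asum A zs ?F = \<one>\<^bsub>A\<^esub>" if "set zs \<subseteq> \<rho> x ` set xs \<union> \<sigma> x ` set xs" for zs
    proof -
      have "set zs \<subseteq> Field s" "x \<in> overlap W zs"
        using that pointwise_refines_map[OF \<rho> sub xs(2)] pointwise_refines_map[OF \<sigma> sub xs(2)]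
        unfolding overlap_def by (auto, blast)
      then have "asum A zs ?F = alt_ext A s W (n + 2) \<one>\<^bsub>all_cochains A s W (n + 2)\<^esub> x zs"
        using alt_ext_coboundary[OF A(1,2) f, of zs x] df by simp
      then show ?thesis using alt_ext_one[OF A(1,2)] by metis
    qed
    then show ?thesis by (intro prism_trivial A)
  qed
  moreover have "asum A xs (\<lambda>zs. prism A (\<rho> x) (\<sigma> x) zs ?F)
      \<otimes>\<^bsub>A\<^esub> prism A (\<rho> x) (\<sigma> x) xs (\<lambda>zs. asum A zs ?F) =
      ?F (map (\<sigma> x) xs) \<otimes>\<^bsub>A\<^esub> inv\<^bsub>A\<^esub> ?F (map (\<rho> x) xs)"
    using rg by (rule prism_homotopy)
  moreover have "asum A xs (\<lambda>zs. prism A (\<rho> x) (\<sigma> x) zs ?F) \<in> carrier A"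
    using rg by (intro asum_closed) auto
  ultimately have "?r xs x = ?F (map (\<sigma> x) xs) \<otimes>\<^bsub>A\<^esub> inv\<^bsub>A\<^esub> ?F (map (\<rho> x) xs)"
    by simp
  then show "?l xs x = ?r xs x"
    by (simp only: all_cochains_mult[OF xs] all_cochains_inv[OF A(1) pf xs] pointwise_pullback_apply[OF xs])
qed

section \<open>Piecewise refinements\<close>

text \<open>Finitely many open fibres partition the space, so each is clopen. For a choice of
  indices the values are whole functions of the index, so one partition serves all members of the
  cover.\<close>

definition piecewise_constant :: "('x::topological_space \<Rightarrow> 'b) \<Rightarrow> bool" where
  "piecewise_constant \<rho> \<longleftrightarrow> finite (range \<rho>) \<and> (\<forall>b. open (\<rho> -` {b}))"

lemma piecewise_constant_const: "piecewise_constant (\<lambda>_. c)"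
  by (auto simp: piecewise_constant_def vimage_def)

lemma piecewise_constant_if:
  assumes "piecewise_constant \<rho>" "piecewise_constant \<sigma>" "open C" "open (- C)"
  shows "piecewise_constant (\<lambda>x. if x \<in> C then \<rho> x else \<sigma> x)"
proof -
  have "(\<lambda>x. if x \<in> C then \<rho> x else \<sigma> x) -` {b} = (C \<inter> \<rho> -` {b}) \<union> (- C \<inter> \<sigma> -` {b})" for b
    by auto
  moreover have "range (\<lambda>x. if x \<in> C then \<rho> x else \<sigma> x) \<subseteq> range \<rho> \<union> range \<sigma>" by auto
  ultimately show ?thesis
    using assms by (auto simp: piecewise_constant_def intro: finite_subset intro!: open_Un open_Int)
qed

lemma piecewise_constant_Pair:
  assumes "piecewise_constant \<rho>" "piecewise_constant \<sigma>"
  shows "piecewise_constant (\<lambda>x. (\<rho> x, \<sigma> x))"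
  unfolding piecewise_constant_def
proof (intro conjI allI)
  have "range (\<lambda>x. (\<rho> x, \<sigma> x)) \<subseteq> range \<rho> \<times> range \<sigma>" by auto
  then show "finite (range (\<lambda>x. (\<rho> x, \<sigma> x)))"
    using assms by (rule_tac finite_subset[of _ "range \<rho> \<times> range \<sigma>"]) (auto simp: piecewise_constant_def)
  fix b
  have "(\<lambda>x. (\<rho> x, \<sigma> x)) -` {b} = \<rho> -` {fst b} \<inter> \<sigma> -` {snd b}"
    by (cases b) auto
  then show "open ((\<lambda>x. (\<rho> x, \<sigma> x)) -` {b})"
    using assms by (metis open_Int piecewise_constant_def)
qed

lemma piecewise_constant_compose:
  assumes "piecewise_constant \<rho>" shows "piecewise_constant (\<lambda>x. h (\<rho> x))"
proof -
  have "(\<lambda>x. h (\<rho> x)) -` {b} = (\<Union>c\<in>h -` {b}. \<rho> -` {c})" for b by auto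
  moreover have "range (\<lambda>x. h (\<rho> x)) = h ` range \<rho>" by auto
  ultimately show ?thesis using assms by (auto simp: piecewise_constant_def)
qed

definition piecewise_refines ::
    "'i rel \<Rightarrow> ('i \<Rightarrow> 'x::topological_space set) \<Rightarrow> 'j rel \<Rightarrow> ('j \<Rightarrow> 'x set) \<Rightarrow> ('x \<Rightarrow> 'i \<Rightarrow> 'j) \<Rightarrow> bool" where
  "piecewise_refines r V s W \<rho> \<longleftrightarrow> piecewise_constant \<rho> \<and> pointwise_refines r V s W \<rho>"

text \<open>The composite depends on \<open>x\<close> only through the pair of
  \<open>\<sigma> x\<close> and \<open>\<rho> x\<close>, which is constant on the pieces of the
  common partition.\<close>

lemma piecewise_refines_comp:
  assumes "piecewise_refines s W t X \<sigma>" "piecewise_refines r V s W \<rho>"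
  shows "piecewise_refines r V t X (\<lambda>x i. \<sigma> x (\<rho> x i))"
  using assms pointwise_refines_comp[of s W t X \<sigma> r V \<rho>]
    piecewise_constant_compose[OF piecewise_constant_Pair[of \<sigma> \<rho>], of "\<lambda>(a, b) i. a (b i)"]
  by (simp add: piecewise_refines_def)

lemma piecewise_refines_id: "piecewise_refines r V r V (\<lambda>_ i. i)"
  by (simp add: piecewise_refines_def pointwise_refines_def piecewise_constant_const)

definition open_family :: "'i rel \<Rightarrow> ('i \<Rightarrow> 'x::topological_space set) \<Rightarrow> bool" where
  "open_family r V \<longleftrightarrow> Well_order r \<and> (\<forall>i\<in>Field r. open (V i))"

lemma open_family_Well_order: "open_family r V \<Longrightarrow> Well_order r"
  by (simp add: open_family_def)

lemma open_overlap: "open_family r V \<Longrightarrow> set xs \<subseteq> Field r \<Longrightarrow> open (overlap V xs)"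
  unfolding overlap_def open_family_def by (intro open_INT) auto

section \<open>Cochains with values in a presheaf\<close>

locale function_presheaf =
  fixes A :: "'a monoid" and P :: "'x::topological_space set \<Rightarrow> ('x \<Rightarrow> 'a) set"
  assumes A: "comm_group A" and presheaf: "presheaf_of_functions A P"
    and additive: "disjointly_additive P"
begin

sublocale A: comm_group A by (rule A)

lemma sections_subgroup: "open U \<Longrightarrow> subgroup (P U) (product_group U (\<lambda>_. A))"
  using presheaf by (simp add: presheaf_of_functions_def)

lemma sections_restrict: "open U \<Longrightarrow> open W \<Longrightarrow> W \<subseteq> U \<Longrightarrow> f \<in> P U \<Longrightarrow> restrict f W \<in> P W"
  using presheaf by (auto simp: presheaf_of_functions_def)

lemma sections_carrier:
  assumes "open U" "f \<in> P U" shows "f \<in> U \<rightarrow>\<^sub>E carrier A"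
  using subgroup.mem_carrier[OF sections_subgroup[OF assms(1)] assms(2)] by simp

lemma sections_one: "open U \<Longrightarrow> (\<lambda>x\<in>U. \<one>\<^bsub>A\<^esub>) \<in> P U"
  using subgroup.one_closed[OF sections_subgroup] by simp

lemma sections_mult:
  assumes "open U" "restrict f U \<in> P U" "restrict g U \<in> P U"
  shows "(\<lambda>x\<in>U. f x \<otimes>\<^bsub>A\<^esub> g x) \<in> P U"
proof -
  have "restrict f U \<otimes>\<^bsub>product_group U (\<lambda>_. A)\<^esub> restrict g U \<in> P U"
    using assms by (intro subgroup.m_closed[OF sections_subgroup])
  moreover have "restrict f U \<otimes>\<^bsub>product_group U (\<lambda>_. A)\<^esub> restrict g U = (\<lambda>x\<in>U. f x \<otimes>\<^bsub>A\<^esub> g x)"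
    by (auto simp: fun_eq_iff)
  ultimately show ?thesis by simp
qed

lemma sections_inv:
  assumes "open U" "restrict f U \<in> P U"
  shows "(\<lambda>x\<in>U. inv\<^bsub>A\<^esub> f x) \<in> P U"
proof -
  have "inv\<^bsub>product_group U (\<lambda>_. A)\<^esub> restrict f U \<in> P U"
    using assms by (intro subgroup.m_inv_closed[OF sections_subgroup])
  moreover have "inv\<^bsub>product_group U (\<lambda>_. A)\<^esub> restrict f U = (\<lambda>x\<in>U. inv\<^bsub>A\<^esub> restrict f U x)"
    using sections_carrier[OF assms] by (intro inv_product_group) auto
  moreover have "(\<lambda>x\<in>U. inv\<^bsub>A\<^esub> restrict f U x) = (\<lambda>x\<in>U. inv\<^bsub>A\<^esub> f x)"
    by (auto simp: fun_eq_iff)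
  ultimately show ?thesis by simp
qed

lemma sections_cong: "(\<And>x. x \<in> U \<Longrightarrow> f x = g x) \<Longrightarrow> restrict g U \<in> P U \<Longrightarrow> restrict f U \<in> P U"
  by (metis restrict_ext)

text \<open>\<open>S\<close> records the indices from which tuples may be formed: over
  \<open>U\<close>, the values of \<open>F\<close> are known to be sections only for tuples from
  \<open>S\<close>.\<close>

lemma sections_asum:
  assumes "open U" "\<And>zs. set zs \<subseteq> S \<Longrightarrow> restrict (F zs) U \<in> P U" "set xs \<subseteq> S"
  shows "(\<lambda>x\<in>U. asum A xs (\<lambda>zs. F zs x)) \<in> P U"
  using assms(2,3)
proof (induction xs arbitrary: F)
  case (Cons y ys)
  have "(\<lambda>x\<in>U. asum A ys (\<lambda>zs. F (y # zs) x)) \<in> P U"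
    using Cons.prems by (intro Cons.IH) auto
  moreover have "restrict (F ys) U \<in> P U"
    by (rule Cons.prems(1)) (use Cons.prems in auto)
  ultimately have "(\<lambda>x\<in>U. F ys x \<otimes>\<^bsub>A\<^esub> inv\<^bsub>A\<^esub> asum A ys (\<lambda>zs. F (y # zs) x)) \<in> P U"
    by (intro sections_mult sections_inv assms(1))
  then show ?case by (simp only: asum.simps prism.simps)
qed (simp add: sections_one assms(1))

lemma sections_prism:
  assumes "open U" "\<And>zs. set zs \<subseteq> S \<Longrightarrow> restrict (F zs) U \<in> P U"
    and "\<rho> ` set xs \<subseteq> S" "\<sigma> ` set xs \<subseteq> S"
  shows "(\<lambda>x\<in>U. prism A \<rho> \<sigma> xs (\<lambda>zs. F zs x)) \<in> P U"
  using assms(2-)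
proof (induction xs arbitrary: F)
  case (Cons y ys)
  have "(\<lambda>x\<in>U. prism A \<rho> \<sigma> ys (\<lambda>zs. F (\<rho> y # zs) x)) \<in> P U"
    using Cons.prems by (intro Cons.IH) auto
  moreover have "restrict (F (\<rho> y # \<sigma> y # map \<sigma> ys)) U \<in> P U"
    by (rule Cons.prems(1)) (use Cons.prems in auto)
  ultimately have "(\<lambda>x\<in>U. F (\<rho> y # \<sigma> y # map \<sigma> ys) x
      \<otimes>\<^bsub>A\<^esub> inv\<^bsub>A\<^esub> prism A \<rho> \<sigma> ys (\<lambda>zs. F (\<rho> y # zs) x)) \<in> P U"
    by (intro sections_mult sections_inv assms(1))
  then show ?case by (simp only: asum.simps prism.simps)
qed (simp add: sections_one assms(1))

text \<open>The fibres over a finite set of values are added one at a time, and each step glues two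
  disjoint open sets. This is where \<open>additive\<close> enters.\<close>

lemma sections_glue:
  assumes U: "open U" and \<rho>: "piecewise_constant \<rho>"
    and pieces: "\<And>b. restrict f (U \<inter> \<rho> -` {b}) \<in> P (U \<inter> \<rho> -` {b})"
  shows "restrict f U \<in> P U"
proof -
  have vim: "open (\<rho> -` S)" for S
  proof -
    have "\<rho> -` S = (\<Union>b\<in>S. \<rho> -` {b})" by auto
    then show ?thesis using \<rho> by (auto simp: piecewise_constant_def)
  qed
  have "restrict f (U \<inter> \<rho> -` S) \<in> P (U \<inter> \<rho> -` S)" if "finite S" for S
    using that
  proof (induction S rule: finite_induct)
    case empty
    show ?case using sections_one[of "{}"] by (simp add: restrict_def)
  next
    case (insert b S)
    let ?U = "U \<inter> \<rho> -` {b}" and ?W = "U \<inter> \<rho> -` S"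
    have un: "U \<inter> \<rho> -` insert b S = ?U \<union> ?W" by auto
    have "restrict (restrict f (?U \<union> ?W)) ?U = restrict f ?U"
      "restrict (restrict f (?U \<union> ?W)) ?W = restrict f ?W"
      by (auto simp: fun_eq_iff)
    moreover have "?U \<inter> ?W = {}" using insert.hyps(2) by auto
    moreover have "open ?U" "open ?W" using U vim by auto
    ultimately have "restrict f (?U \<union> ?W) \<in> P (?U \<union> ?W)"
      using additive pieces[of b] insert.IH unfolding disjointly_additive_def
      by (metis restrict_extensional)
    then show ?case unfolding un .
  qed
  moreover have "\<rho> -` range \<rho> = UNIV" by auto
  ultimately show ?thesis
    using \<rho> by (metis Int_UNIV_right piecewise_constant_def)
qed

abbreviation C where "C r V n \<equiv> carrier (cochains A P r V n)"

lemma C_eq: "C r V n = (\<Pi>\<^sub>E xs\<in>increasing_tuples r (n + 1). P (overlap V xs))"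
  by (simp add: cochains_def sections_def)

lemma increasing_tuples_subset: "xs \<in> increasing_tuples r k \<Longrightarrow> set xs \<subseteq> Field r"
  by (simp add: increasing_tuples_def)

lemma C_subgroup:
  assumes "open_family r V" shows "subgroup (C r V n) (all_cochains A r V n)"
  unfolding C_eq all_cochains_def
  using assms
  by (subst PiE_subgroup_product_group)
    (auto intro!: sections_subgroup open_overlap dest: increasing_tuples_subset)

lemma C_all_cochains: "open_family r V \<Longrightarrow> f \<in> C r V n \<Longrightarrow> f \<in> carrier (all_cochains A r V n)"
  using subgroup.mem_carrier[OF C_subgroup] .

lemma C_sections: "f \<in> C r V n \<Longrightarrow> xs \<in> increasing_tuples r (n + 1) \<Longrightarrow> f xs \<in> P (overlap V xs)"
  unfolding C_eq by auto

lemma C_I: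
  assumes "f \<in> extensional (increasing_tuples r (n + 1))"
    "\<And>xs. xs \<in> increasing_tuples r (n + 1) \<Longrightarrow> f xs \<in> P (overlap V xs)"
  shows "f \<in> C r V n"
  unfolding C_eq using assms by (auto simp: PiE_iff)

text \<open>For a fixed tuple the sorting is the same at all points of \<open>U\<close>, so the
  function is the restriction of one section, its inverse, or trivial.\<close>

lemma sections_alt_ext:
  assumes s: "open_family s W" and f: "f \<in> C s W n"
    and U: "open U" "U \<subseteq> overlap W ys" "set ys \<subseteq> Field s"
  shows "(\<lambda>x\<in>U. alt_ext A s W n f x ys) \<in> P U"
proof (cases "length ys = n + 1 \<and> distinct ys")
  case True
  define zs where "zs = (THE zs. zs \<in> increasing_tuples s (length ys) \<and> set zs = set ys)"
  have zs: "zs \<in> increasing_tuples s (n + 1)" "set zs = set ys"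
    using theI'[OF ex1_increasing_tuple[OF open_family_Well_order[OF s], of ys]] True U
    by (auto simp: zs_def)
  have "restrict (f zs) U \<in> P U"
  proof (rule sections_restrict)
    show "open (overlap W zs)" using open_overlap[OF s] U zs by simp
    show "U \<subseteq> overlap W zs" using U zs by (simp add: overlap_def)
    show "f zs \<in> P (overlap W zs)" using f zs by (rule_tac C_sections)
  qed fact
  then have "(\<lambda>x\<in>U. if even (inversions s ys) then f zs x else inv\<^bsub>A\<^esub> f zs x) \<in> P U"
    using sections_inv[OF U(1), of "f zs"] by (cases "even (inversions s ys)") simp_all
  moreover have "alt_ext A s W n f x ys = (if even (inversions s ys) then f zs x else inv\<^bsub>A\<^esub> f zs x)"
    if "x \<in> U" for x
  proof -
    have "f zs x \<in> carrier A"
      using all_cochains_value[OF C_all_cochains[OF s f] zs(1), of x] U zs(2) that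
      by (auto simp: overlap_def)
    moreover have "alt_ext A s W n f x ys = f zs x [^]\<^bsub>A\<^esub> ((-1) ^ inversions s ys :: int)"
      using True U that by (auto simp: alt_ext_def alternating_extension_def zs_def inversions_eq_card)
    ultimately show ?thesis by (simp add: int_pow_parity[OF A])
  qed
  ultimately show ?thesis by (rule_tac sections_cong)
next
  case False
  then have "alt_ext A s W n f x ys = \<one>\<^bsub>A\<^esub>" for x
    by (auto simp: alt_ext_def alternating_extension_def)
  then show ?thesis using sections_one U by simp
qed

lemma coboundary_in_C:
  assumes r: "open_family r V" and f: "f \<in> C r V n"
  shows "coboundary_map A r V n f \<in> C r V (n + 1)"
proof (rule C_I)
  fix xs assume xs: "xs \<in> increasing_tuples r (n + 1 + 1)"
  let ?U = "overlap V xs"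
  have U: "open ?U" "set xs \<subseteq> Field r"
    using open_overlap[OF r] increasing_tuples_subset[OF xs] by auto
  have "(\<lambda>x\<in>?U. asum A xs (\<lambda>zs. alt_ext A r V n f x zs)) \<in> P ?U"
  proof (rule sections_asum[OF U(1)])
    show "restrict (\<lambda>x. alt_ext A r V n f x zs) ?U \<in> P ?U" if "set zs \<subseteq> set xs" for zs
      using that U by (intro sections_alt_ext[OF r f]) (auto simp: overlap_def)
  qed simp
  then have "restrict (coboundary_map A r V n f xs) ?U \<in> P ?U"
    using xs by (rule_tac sections_cong)
      (auto simp: coboundary_alt_ext[OF A open_family_Well_order[OF r] C_all_cochains[OF r f]])
  moreover have "restrict (coboundary_map A r V n f xs) ?U = coboundary_map A r V n f xs"
    using xs by (auto simp: coboundary_map_def)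
  ultimately show "coboundary_map A r V n f xs \<in> P ?U" by simp
qed (auto simp: coboundary_map_def)

text \<open>On the fibre of \<open>\<rho>\<close> over \<open>b\<close> the pullback is along the
  fixed map \<open>b\<close>, where sorting is uniform; the finitely many fibres are then
  glued.\<close>

lemma pointwise_pullback_in_C:
  assumes s: "open_family s W" and r: "open_family r V" and f: "f \<in> C s W n"
    and \<rho>: "piecewise_refines r V s W \<rho>"
  shows "pointwise_pullback A s W r V n \<rho> f \<in> C r V n"
proof (rule C_I)
  fix xs assume xs: "xs \<in> increasing_tuples r (n + 1)"
  let ?U = "overlap V xs"
  have U: "open ?U" "set xs \<subseteq> Field r"
    using open_overlap[OF r] increasing_tuples_subset[OF xs] by auto
  have pr: "pointwise_refines r V s W \<rho>" "piecewise_constant \<rho>"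
    using \<rho> by (auto simp: piecewise_refines_def)
  have "(\<lambda>x\<in>?U. alt_ext A s W n f x (map (\<rho> x) xs)) \<in> P ?U"
  proof (rule sections_glue[OF U(1) pr(2)])
    fix b
    let ?W = "?U \<inter> \<rho> -` {b}"
    have W: "open ?W" using U pr(2) by (auto simp: piecewise_constant_def)
    show "(\<lambda>x\<in>?W. alt_ext A s W n f x (map (\<rho> x) xs)) \<in> P ?W"
    \<comment> \<open>Over an empty piece nothing forces \<open>b\<close> to take values in the
      index set of \<open>W\<close>.\<close>
    proof (cases "?W = {}")
      case True
      then show ?thesis using sections_one[of "{}"] by (simp add: restrict_def)
    next
      case False
      have "set (map b xs) \<subseteq> Field s" "?W \<subseteq> overlap W (map b xs)"
        using False pointwise_refines_map[OF pr(1) U(2)] by auto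
      then have "(\<lambda>x\<in>?W. alt_ext A s W n f x (map b xs)) \<in> P ?W"
        using W by (intro sections_alt_ext[OF s f])
      then show ?thesis by (rule_tac sections_cong) auto
    qed
  qed
  then show "pointwise_pullback A s W r V n \<rho> f xs \<in> P ?U"
    using xs by (simp add: pointwise_pullback_def)
qed (auto simp: pointwise_pullback_def)

text \<open>The prism involves both choices of indices, so the pieces are the fibres of the
  pair.\<close>

lemma prism_cochain_in_C:
  fixes s :: "'j rel" and r :: "'i rel"
  assumes s: "open_family s W" and r: "open_family r V" and f: "f \<in> C s W (n + 1)"
    and \<rho>: "piecewise_refines r V s W \<rho>" and \<sigma>: "piecewise_refines r V s W \<sigma>"
  shows "prism_cochain A s W r V (n + 1) \<rho> \<sigma> f \<in> C r V n"
proof (rule C_I)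
  fix xs assume xs: "xs \<in> increasing_tuples r (n + 1)"
  let ?U = "overlap V xs" and ?\<pi> = "\<lambda>x. (\<rho> x, \<sigma> x)"
  have U: "open ?U" "set xs \<subseteq> Field r"
    using open_overlap[OF r] increasing_tuples_subset[OF xs] by auto
  have pr: "pointwise_refines r V s W \<rho>" "pointwise_refines r V s W \<sigma>" "piecewise_constant ?\<pi>"
    using \<rho> \<sigma> by (auto simp: piecewise_refines_def intro: piecewise_constant_Pair)
  have "(\<lambda>x\<in>?U. prism A (\<rho> x) (\<sigma> x) xs (alt_ext A s W (n + 1) f x)) \<in> P ?U"
  proof (rule sections_glue[OF U(1) pr(3)])
    fix bc :: "('i \<Rightarrow> 'j) \<times> ('i \<Rightarrow> 'j)"
    obtain b c where bc: "bc = (b, c)" by (cases bc)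
    let ?W = "?U \<inter> ?\<pi> -` {bc}"
    have W: "open ?W" using U pr(3) by (auto simp: piecewise_constant_def bc)
    show "(\<lambda>x\<in>?W. prism A (\<rho> x) (\<sigma> x) xs (alt_ext A s W (n + 1) f x)) \<in> P ?W"
    proof (cases "?W = {}")
      case True
      then show ?thesis using sections_one[of "{}"] by (simp add: restrict_def)
    next
      case False
      let ?S = "b ` set xs \<union> c ` set xs"
      have *: "?S \<subseteq> Field s \<and> (\<forall>i\<in>?S. x \<in> W i)" if "x \<in> ?W" for x
        using that pointwise_refines_map[OF pr(1) U(2), of x] pointwise_refines_map[OF pr(2) U(2), of x]
        by (auto simp: overlap_def bc)
      \<comment> \<open>That \<open>?S\<close> consists of indices of \<open>W\<close> does not
        mention a point, yet it is known only through one.\<close>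
      obtain z where z: "z \<in> ?W" using False by (meson ex_in_conv)
      have S: "?S \<subseteq> Field s" "\<And>x i. x \<in> ?W \<Longrightarrow> i \<in> ?S \<Longrightarrow> x \<in> W i"
        using *[OF z] by (rule conjunct1) (use * in simp)
      have "(\<lambda>x\<in>?W. prism A b c xs (\<lambda>zs. alt_ext A s W (n + 1) f x zs)) \<in> P ?W"
      proof (rule sections_prism[OF W])
        show "(\<lambda>x\<in>?W. alt_ext A s W (n + 1) f x zs) \<in> P ?W" if "set zs \<subseteq> ?S" for zs
        proof (rule sections_alt_ext[OF s f W])
          show "?W \<subseteq> overlap W zs"
          proof
            fix x assume x: "x \<in> ?W"
            have "x \<in> W i" if "i \<in> set zs" for i
              using x subsetD[OF \<open>set zs \<subseteq> ?S\<close> that] by (rule S(2))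
            then show "x \<in> overlap W zs" by (simp add: overlap_def)
          qed
          show "set zs \<subseteq> Field s" using that S(1) by (rule subset_trans)
        qed
      qed auto
      then show ?thesis by (rule_tac sections_cong) (auto simp: bc)
    qed
  qed
  then show "prism_cochain A s W r V (n + 1) \<rho> \<sigma> f xs \<in> P ?U"
    using xs by (simp add: prism_cochain_def)
qed (auto simp: prism_cochain_def)

end

section \<open>Cohomology and refinements\<close>

text \<open>The quotient depends on the ambient group only through its operation, so cosets may be
  formed among all functions.\<close>

lemma cover_cohomology_subquot:
  "cover_cohomology n A P r V =
     (all_cochains A r V n)\<lparr>carrier := cocycles A P r V n\<rparr> Mod coboundaries A P r V n"
proof -
  have "cochains A P r V n\<lparr>carrier := cocycles A P r V n\<rparr> =
      all_cochains A r V n\<lparr>carrier := cocycles A P r V n\<rparr>"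
    by (simp add: cochains_def all_cochains_def product_group_def sections_def)
  then show ?thesis by (simp add: cover_cohomology_def)
qed

lemma group_all_cochains: "comm_group A \<Longrightarrow> Group.group (all_cochains A r V n)"
  by (rule comm_group.axioms(2)[OF comm_group_all_cochains])

lemma induced_map_cochains:
  "induced_map (cochains A P r V n) B \<phi> = induced_map (all_cochains A r V n) B \<phi>"
  by (simp add: fun_eq_iff induced_map_def r_coset_def cochains_def all_cochains_def product_group_def sections_def)

definition cohomology_pullback ::
    "'a monoid \<Rightarrow> ('x set \<Rightarrow> ('x \<Rightarrow> 'a) set) \<Rightarrow> nat \<Rightarrow> 'j rel \<Rightarrow> ('j \<Rightarrow> 'x set) \<Rightarrow> 'i rel \<Rightarrow> ('i \<Rightarrow> 'x set)
      \<Rightarrow> ('x \<Rightarrow> 'i \<Rightarrow> 'j) \<Rightarrow> ('j list \<Rightarrow> 'x \<Rightarrow> 'a) set \<Rightarrow> ('i list \<Rightarrow> 'x \<Rightarrow> 'a) set" where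
  "cohomology_pullback A P n s W r V \<rho> =
     induced_map (all_cochains A r V n) (coboundaries A P r V n) (pointwise_pullback A s W r V n \<rho>)"

abbreviation cohomology_class ::
    "'a monoid \<Rightarrow> ('x set \<Rightarrow> ('x \<Rightarrow> 'a) set) \<Rightarrow> nat \<Rightarrow> 'i rel \<Rightarrow> ('i \<Rightarrow> 'x set)
      \<Rightarrow> ('i list \<Rightarrow> 'x \<Rightarrow> 'a) \<Rightarrow> ('i list \<Rightarrow> 'x \<Rightarrow> 'a) set" where
  "cohomology_class A P n r V f \<equiv> coboundaries A P r V n #>\<^bsub>all_cochains A r V n\<^esub> f"

text \<open>A piecewise substitute for being finer than every open cover; it makes the transition
  maps from \<open>V\<close> to all finer covers bijective.\<close>

definition absorbing :: "'i rel \<Rightarrow> ('i \<Rightarrow> 'x::topological_space set) \<Rightarrow> bool" where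
  "absorbing r V \<longleftrightarrow>
     (\<forall>\<W>\<in>open_covers. \<exists>\<rho>. piecewise_refines r V (chosen_order \<W>) id \<rho>)"

lemma chosen_order: "well_order_on \<V> (chosen_order \<V>)"
  unfolding chosen_order_def using well_order_on[of \<V>] by (rule someI_ex)

lemma Field_chosen_order [simp]: "Field (chosen_order \<V>) = \<V>"
  using chosen_order[of \<V>] well_order_on_Field by blast

lemma open_family_chosen: "\<V> \<in> open_covers \<Longrightarrow> open_family (chosen_order \<V>) id"
  using chosen_order[of \<V>] by (simp add: open_family_def open_covers_def)

lemma refinement_function:
  assumes "refines \<V> \<W>" "U \<in> \<V>"
  shows "refinement_function \<V> \<W> U \<in> \<W>" "U \<subseteq> refinement_function \<V> \<W> U"
proof -
  have "\<exists>\<rho>. \<forall>V\<in>\<V>. \<rho> V \<in> \<W> \<and> V \<subseteq> \<rho> V"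
    using assms(1) unfolding refines_def by (rule_tac bchoice) blast
  from someI_ex[OF this] show "refinement_function \<V> \<W> U \<in> \<W>" "U \<subseteq> refinement_function \<V> \<W> U"
    using assms(2) unfolding refinement_function_def by blast+
qed

lemma refinement_function_piecewise:
  "refines \<V> \<W> \<Longrightarrow>
     piecewise_refines (chosen_order \<V>) id (chosen_order \<W>) id (\<lambda>_. refinement_function \<V> \<W>)"
  using refinement_function[of \<V> \<W>]
  by (auto simp: piecewise_refines_def pointwise_refines_def piecewise_constant_const)

text \<open>An enumeration may repeat a set, whereas the direct limit runs over sets of open sets.
  Choosing an index for each member compares the two.\<close>

lemma inv_into_refines:
  "piecewise_refines (chosen_order (V ` Field r)) id r V (\<lambda>_. inv_into (Field r) V)"
  by (auto simp: piecewise_refines_def pointwise_refines_def piecewise_constant_const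
      inv_into_into f_inv_into_f)

lemma open_family_image:
  "open_family r V \<Longrightarrow> (\<Union>i\<in>Field r. V i) = UNIV \<Longrightarrow> V ` Field r \<in> open_covers"
  by (auto simp: open_family_def open_covers_def)

context function_presheaf
begin

lemma refinement_map_eq:
  "refines \<V> \<W> \<Longrightarrow> refinement_map n A P \<W> \<V> =
     cohomology_pullback A P n (chosen_order \<W>) id (chosen_order \<V>) id (\<lambda>_. refinement_function \<V> \<W>)"
  using refinement_function_piecewise[of \<V> \<W>] pullback_eq_pointwise_pullback
  unfolding refinement_map_def cohomology_pullback_def piecewise_refines_def induced_map_cochains
  by (metis (no_types, lifting) ext)

lemma cocycles_eq:
  "cocycles A P r V n =
     {f \<in> C r V n. coboundary_map A r V n f = \<one>\<^bsub>all_cochains A r V (n + 1)\<^esub>}"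
  by (simp add: cocycles_def kernel_def cochains_def all_cochains_def product_group_def sections_def)

lemma coboundaries_Suc: "coboundaries A P r V (Suc m) = coboundary_map A r V m ` C r V m"
  by (simp add: coboundaries_def)

lemma coboundary_group_hom:
  assumes "open_family r V"
  shows "group_hom (all_cochains A r V n) (all_cochains A r V (n + 1)) (coboundary_map A r V n)"
  using coboundary_hom[OF A open_family_Well_order[OF assms]]
  by (simp add: group_hom_def group_hom_axioms_def group_all_cochains A)

lemma cocycles_subgroup:
  assumes "open_family r V" shows "subgroup (cocycles A P r V n) (all_cochains A r V n)"
proof -
  interpret h: group_hom "all_cochains A r V n" "all_cochains A r V (n + 1)" "coboundary_map A r V n"
    using assms by (rule coboundary_group_hom)
  have "cocycles A P r V n =
      C r V n \<inter> kernel (all_cochains A r V n) (all_cochains A r V (n + 1)) (coboundary_map A r V n)"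
    using C_all_cochains[OF assms] by (auto simp: cocycles_eq kernel_def)
  then show ?thesis
    using C_subgroup[OF assms] h.subgroup_kernel h.G.subgroups_Inter_pair by simp
qed

lemma coboundaries_subgroup:
  assumes "open_family r V" shows "subgroup (coboundaries A P r V (Suc m)) (all_cochains A r V (Suc m))"
proof -
  interpret h: group_hom "all_cochains A r V m" "all_cochains A r V (m + 1)" "coboundary_map A r V m"
    using assms by (rule coboundary_group_hom)
  show ?thesis
    unfolding coboundaries_Suc using h.subgroup_img_is_subgroup[OF C_subgroup[OF assms]] by simp
qed

lemma coboundaries_subset:
  assumes "open_family r V" shows "coboundaries A P r V (Suc m) \<subseteq> cocycles A P r V (Suc m)"
proof
  fix f assume "f \<in> coboundaries A P r V (Suc m)"
  then obtain g where g: "g \<in> C r V m" "f = coboundary_map A r V m g"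
    by (auto simp: coboundaries_Suc)
  then show "f \<in> cocycles A P r V (Suc m)"
    using coboundary_in_C[OF assms g(1)]
      coboundary_coboundary[OF A open_family_Well_order[OF assms] C_all_cochains[OF assms g(1)]]
    by (simp add: cocycles_eq)
qed

lemma subquotient_cohomology:
  assumes "open_family r V" "0 < n"
  shows "subquotient (all_cochains A r V n) (cocycles A P r V n) (coboundaries A P r V n)"
proof -
  obtain m where "n = Suc m" using assms(2) gr0_implies_Suc by blast
  then show ?thesis
    using cocycles_subgroup[OF assms(1)] coboundaries_subgroup[OF assms(1)]
      coboundaries_subset[OF assms(1)] comm_group_all_cochains[OF A]
    unfolding subquotient_def subquotient_axioms_def by blast
qed

lemma cohomology_comm_group:
  assumes "open_family r V" "0 < n" shows "comm_group (cover_cohomology n A P r V)"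
  using subquotient.comm_group_subquot[OF subquotient_cohomology[OF assms]]
  by (simp add: cover_cohomology_subquot)

lemma carrier_cohomology:
  assumes "open_family r V" "0 < n"
  shows "carrier (cover_cohomology n A P r V) = cohomology_class A P n r V ` cocycles A P r V n"
  using subquotient.carrier_subquot[OF subquotient_cohomology[OF assms]]
  by (simp add: cover_cohomology_subquot)

lemma subquotient_map_pullback:
  assumes s: "open_family s W" and r: "open_family r V" and n: "0 < n"
    and \<rho>: "piecewise_refines r V s W \<rho>"
  shows "subquotient_map (all_cochains A s W n) (cocycles A P s W n) (coboundaries A P s W n)
    (all_cochains A r V n) (cocycles A P r V n) (coboundaries A P r V n)
    (pointwise_pullback A s W r V n \<rho>)"
proof -
  interpret G: subquotient "all_cochains A s W n" "cocycles A P s W n" "coboundaries A P s W n"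
    using s n by (rule subquotient_cohomology)
  interpret H: subquotient "all_cochains A r V n" "cocycles A P r V n" "coboundaries A P r V n"
    using r n by (rule subquotient_cohomology)
  have wo: "Well_order s" "Well_order r" using s r by (auto intro: open_family_Well_order)
  have pr: "pointwise_refines r V s W \<rho>" using \<rho> by (simp add: piecewise_refines_def)
  obtain m where m: "n = Suc m" using n gr0_implies_Suc by blast
  show ?thesis
  proof
    fix f assume f: "f \<in> cocycles A P s W n"
    then have fC: "f \<in> C s W n" and df: "coboundary_map A s W n f = \<one>\<^bsub>all_cochains A s W (n + 1)\<^esub>"
      by (auto simp: cocycles_eq)
    have "coboundary_map A r V n (pointwise_pullback A s W r V n \<rho> f) =
        pointwise_pullback A s W r V (n + 1) \<rho> \<one>\<^bsub>all_cochains A s W (n + 1)\<^esub>"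
      using pointwise_pullback_coboundary[OF A wo C_all_cochains[OF s fC] pr] df by simp
    also have "\<dots> = \<one>\<^bsub>all_cochains A r V (n + 1)\<^esub>"
    proof -
      interpret h: group_hom "all_cochains A s W (n + 1)" "all_cochains A r V (n + 1)"
        "pointwise_pullback A s W r V (n + 1) \<rho>"
        using pointwise_pullback_closed[OF A wo(1)] pointwise_pullback_mult[OF A wo(1)]
        by (auto simp: group_hom_def group_hom_axioms_def group_all_cochains A intro!: homI)
      show ?thesis by (rule h.hom_one)
    qed
    finally show "pointwise_pullback A s W r V n \<rho> f \<in> cocycles A P r V n"
      using pointwise_pullback_in_C[OF s r fC \<rho>] by (simp add: cocycles_eq)
  next
    fix f g assume "f \<in> cocycles A P s W n" "g \<in> cocycles A P s W n"
    then show "pointwise_pullback A s W r V n \<rho> (f \<otimes>\<^bsub>all_cochains A s W n\<^esub> g) =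
      pointwise_pullback A s W r V n \<rho> f \<otimes>\<^bsub>all_cochains A r V n\<^esub> pointwise_pullback A s W r V n \<rho> g"
      by (intro pointwise_pullback_mult A wo G.Z_carrier)
  next
    fix f assume "f \<in> coboundaries A P s W n"
    then obtain g where g: "g \<in> C s W m" "f = coboundary_map A s W m g"
      using m by (auto simp: coboundaries_Suc)
    then show "pointwise_pullback A s W r V n \<rho> f \<in> coboundaries A P r V n"
      using pointwise_pullback_coboundary[OF A wo C_all_cochains[OF s g(1)] pr]
        pointwise_pullback_in_C[OF s r g(1) \<rho>] m
      by (simp add: coboundaries_Suc)
  qed
qed

lemma pullback_class:
  assumes "open_family s W" "open_family r V" "0 < n" "piecewise_refines r V s W \<rho>"
    "f \<in> cocycles A P s W n"
  shows "cohomology_pullback A P n s W r V \<rho> (cohomology_class A P n s W f) =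
    cohomology_class A P n r V (pointwise_pullback A s W r V n \<rho> f)"
  using subquotient_map.induced_coset[OF subquotient_map_pullback[OF assms(1-4)] assms(5)]
  by (simp add: cohomology_pullback_def)

lemma pullback_hom:
  assumes "open_family s W" "open_family r V" "0 < n" "piecewise_refines r V s W \<rho>"
  shows "cohomology_pullback A P n s W r V \<rho> \<in> hom (cover_cohomology n A P s W) (cover_cohomology n A P r V)"
  using subquotient_map.induced_hom[OF subquotient_map_pullback[OF assms]]
  by (simp add: cohomology_pullback_def cover_cohomology_subquot)

lemma pullback_cocycle:
  assumes "open_family s W" "open_family r V" "0 < n" "piecewise_refines r V s W \<rho>"
    "f \<in> cocycles A P s W n"
  shows "pointwise_pullback A s W r V n \<rho> f \<in> cocycles A P r V n"
  using subquotient_map.closed[OF subquotient_map_pullback[OF assms(1-4)] assms(5)] .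

text \<open>The two pullbacks of a cocycle differ by the coboundary of its prism cochain, which lies
  in the presheaf because \<open>\<rho>\<close> and \<open>\<sigma>\<close> are constant on the
  pieces of a common partition.\<close>

lemma pullback_unique:
  assumes s: "open_family s W" and r: "open_family r V" and n: "0 < n"
    and \<rho>: "piecewise_refines r V s W \<rho>" and \<sigma>: "piecewise_refines r V s W \<sigma>"
    and c: "c \<in> carrier (cover_cohomology n A P s W)"
  shows "cohomology_pullback A P n s W r V \<rho> c = cohomology_pullback A P n s W r V \<sigma> c"
proof -
  interpret H: subquotient "all_cochains A r V n" "cocycles A P r V n" "coboundaries A P r V n"
    using r n by (rule subquotient_cohomology)
  obtain f where f: "f \<in> cocycles A P s W n" "c = cohomology_class A P n s W f"
    using c carrier_cohomology[OF s n] by auto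
  obtain m where m: "n = m + 1" using n gr0_implies_Suc by auto
  have fC: "f \<in> C s W (m + 1)" "coboundary_map A s W (m + 1) f = \<one>\<^bsub>all_cochains A s W (m + 2)\<^esub>"
    using f(1) m by (auto simp: cocycles_eq)
  have wo: "Well_order s" "Well_order r" using s r by (auto intro: open_family_Well_order)
  have pr: "pointwise_refines r V s W \<rho>" "pointwise_refines r V s W \<sigma>"
    using \<rho> \<sigma> by (auto simp: piecewise_refines_def)
  have "pointwise_pullback A s W r V n \<sigma> f \<otimes>\<^bsub>all_cochains A r V n\<^esub>
      inv\<^bsub>all_cochains A r V n\<^esub> pointwise_pullback A s W r V n \<rho> f \<in> coboundaries A P r V n"
    unfolding m coboundary_prism_cochain[OF A wo C_all_cochains[OF s fC(1)] fC(2) pr]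
    using prism_cochain_in_C[OF s r fC(1) \<rho> \<sigma>] by (simp add: coboundaries_Suc)
  then have "cohomology_class A P n r V (pointwise_pullback A s W r V n \<sigma> f) =
      cohomology_class A P n r V (pointwise_pullback A s W r V n \<rho> f)"
    using H.coset_eq_iff[OF pullback_cocycle[OF s r n \<sigma> f(1)] pullback_cocycle[OF s r n \<rho> f(1)]]
    by simp
  then show ?thesis
    using \<rho> \<sigma> f by (simp add: pullback_class[OF s r n])
qed

lemma pullback_pullback:
  assumes t: "open_family t X" and s: "open_family s W" and r: "open_family r V" and n: "0 < n"
    and \<sigma>: "piecewise_refines s W t X \<sigma>" and \<rho>: "piecewise_refines r V s W \<rho>"
    and c: "c \<in> carrier (cover_cohomology n A P t X)"
  shows "cohomology_pullback A P n s W r V \<rho> (cohomology_pullback A P n t X s W \<sigma> c) =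
    cohomology_pullback A P n t X r V (\<lambda>x i. \<sigma> x (\<rho> x i)) c"
proof -
  obtain f where f: "f \<in> cocycles A P t X n" "c = cohomology_class A P n t X f"
    using c carrier_cohomology[OF t n] by auto
  then have "f \<in> carrier (all_cochains A t X n)"
    using C_all_cochains[OF t] by (auto simp: cocycles_eq)
  then show ?thesis
    using f \<sigma> \<rho> t s r pullback_cocycle[OF t s n \<sigma> f(1)] piecewise_refines_comp[OF \<sigma> \<rho>]
    by (simp add: pullback_class n pointwise_pullback_pointwise_pullback A open_family_Well_order
        piecewise_refines_def)
qed

text \<open>Any piecewise refinement of a cover by itself can be exchanged for the identity.\<close>

lemma pullback_self:
  assumes r: "open_family r V" and n: "0 < n" and \<rho>: "piecewise_refines r V r V \<rho>"
    and c: "c \<in> carrier (cover_cohomology n A P r V)"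
  shows "cohomology_pullback A P n r V r V \<rho> c = c"
proof -
  obtain f where f: "f \<in> cocycles A P r V n" "c = cohomology_class A P n r V f"
    using c carrier_cohomology[OF r n] by auto
  then have "f \<in> carrier (all_cochains A r V n)"
    using C_all_cochains[OF r] by (auto simp: cocycles_eq)
  then have "cohomology_pullback A P n r V r V (\<lambda>_ i. i) c = c"
    using f r by (simp add: pullback_class n piecewise_refines_id pointwise_pullback_id A open_family_Well_order)
  then show ?thesis using pullback_unique[OF r r n \<rho> piecewise_refines_id c] by simp
qed

text \<open>Both composites are pullbacks along self-refinements, hence trivial on cohomology
  classes in the sense of \<open>pullback_self\<close>.\<close>

lemma pullback_iso:
  assumes s: "open_family s W" and r: "open_family r V" and n: "0 < n"
    and \<rho>: "piecewise_refines r V s W \<rho>" and \<sigma>: "piecewise_refines s W r V \<sigma>"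
  shows "cohomology_pullback A P n s W r V \<rho> \<in> iso (cover_cohomology n A P s W) (cover_cohomology n A P r V)"
proof (rule isoI[OF pullback_hom[OF s r n \<rho>]])
  note hom_\<rho> = pullback_hom[OF s r n \<rho>] and hom_\<sigma> = pullback_hom[OF r s n \<sigma>]
  show "bij_betw (cohomology_pullback A P n s W r V \<rho>) (carrier (cover_cohomology n A P s W))
      (carrier (cover_cohomology n A P r V))"
  proof (rule bij_betwI[of _ _ _ "cohomology_pullback A P n r V s W \<sigma>"])
    fix c assume c: "c \<in> carrier (cover_cohomology n A P s W)"
    show "cohomology_pullback A P n r V s W \<sigma> (cohomology_pullback A P n s W r V \<rho> c) = c"
      unfolding pullback_pullback[OF s r s n \<rho> \<sigma> c]
      using s n piecewise_refines_comp[OF \<rho> \<sigma>] c by (rule pullback_self)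
  next
    fix c assume c: "c \<in> carrier (cover_cohomology n A P r V)"
    show "cohomology_pullback A P n s W r V \<rho> (cohomology_pullback A P n r V s W \<sigma> c) = c"
      unfolding pullback_pullback[OF r s r n \<sigma> \<rho> c]
      using r n piecewise_refines_comp[OF \<sigma> \<rho>] c by (rule pullback_self)
  qed (use hom_\<rho> hom_\<sigma> in \<open>auto simp: hom_def\<close>)
qed

text \<open>Composing two chosen refinement functions gives a refinement function, though perhaps
  not the chosen one; \<open>pullback_unique\<close> removes the difference.\<close>

lemma cech_direct_system:
  assumes n: "0 < n"
  shows "direct_system open_covers (\<lambda>\<W> \<V>. refines \<V> \<W>) (set_cover_cohomology n A P) (refinement_map n A P)"
proof (rule direct_system.intro)
  fix \<U> \<V> \<W> :: "'x set set"
  show "refines \<U> \<U>" by (auto simp: refines_def)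
  show "refines \<W> \<U>" if "refines \<V> \<U>" "refines \<W> \<V>"
    using that unfolding refines_def by (meson order_trans)
  show "\<exists>\<W>\<in>open_covers. refines \<W> \<U> \<and> refines \<W> \<V>" if "\<U> \<in> open_covers" "\<V> \<in> open_covers"
  proof
    let ?W = "(\<lambda>(U, V). U \<inter> V) ` (\<U> \<times> \<V>)"
    show "refines ?W \<U> \<and> refines ?W \<V>" by (auto simp: refines_def)
    have "x \<in> \<Union>?W" for x
    proof -
      have "x \<in> \<Union>\<U>" "x \<in> \<Union>\<V>" using that by (auto simp: open_covers_def)
      then show ?thesis by blast
    qed
    then show "?W \<in> open_covers" using that by (auto simp: open_covers_def)
  qed
  assume \<U>: "\<U> \<in> open_covers"
  note [simp] = set_cover_cohomology_def
  show "Group.monoid (set_cover_cohomology n A P \<U>)"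
    using cohomology_comm_group[OF open_family_chosen[OF \<U>] n] comm_group.axioms(2) group.is_monoid
    by auto
  have self: "refines \<U> \<U>" by (auto simp: refines_def)
  show "refinement_map n A P \<U> \<U> c = c" if "c \<in> carrier (set_cover_cohomology n A P \<U>)" for c
    using that pullback_self[OF open_family_chosen[OF \<U>] n refinement_function_piecewise[OF self]]
    by (simp add: refinement_map_eq[OF self])
  assume \<V>: "\<V> \<in> open_covers"
  show "refinement_map n A P \<U> \<V> \<in> hom (set_cover_cohomology n A P \<U>) (set_cover_cohomology n A P \<V>)"
    if "refines \<V> \<U>"
    using pullback_hom[OF open_family_chosen[OF \<U>] open_family_chosen[OF \<V>] n refinement_function_piecewise[OF that]] that
    by (simp add: refinement_map_eq)
  assume \<W>: "\<W> \<in> open_covers"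
  show "refinement_map n A P \<V> \<W> (refinement_map n A P \<U> \<V> c) = refinement_map n A P \<U> \<W> c"
    if "refines \<V> \<U>" "refines \<W> \<V>" "c \<in> carrier (set_cover_cohomology n A P \<U>)" for c
  proof -
    have "refines \<W> \<U>" using that(1,2) unfolding refines_def by (meson order_trans)
    note \<rho> = refinement_function_piecewise[OF that(1)] refinement_function_piecewise[OF that(2)]
      refinement_function_piecewise[OF this]
    note o = open_family_chosen[OF \<U>] open_family_chosen[OF \<V>] open_family_chosen[OF \<W>]
    show ?thesis
      using that(3) \<open>refines \<W> \<U>\<close> that(1,2)
        pullback_pullback[OF o n \<rho>(1,2)] pullback_unique[OF o(1,3) n piecewise_refines_comp[OF \<rho>(1,2)] \<rho>(3)]
      by (simp add: refinement_map_eq)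
  qed
qed

abbreviation cech_rel where
  "cech_rel n \<equiv> limit_rel open_covers (\<lambda>\<W> \<V>. refines \<V> \<W>) (set_cover_cohomology n A P) (refinement_map n A P)"

definition to_cech ::
  "nat \<Rightarrow> 'i rel \<Rightarrow> ('i \<Rightarrow> 'x set) \<Rightarrow> ('i list \<Rightarrow> 'x \<Rightarrow> 'a) set
    \<Rightarrow> ('x set set \<times> ('x set list \<Rightarrow> 'x \<Rightarrow> 'a) set) set" where
  "to_cech n r V c = cech_rel n `` {(V ` Field r,
     cohomology_pullback A P n r V (chosen_order (V ` Field r)) id (\<lambda>_. inv_into (Field r) V) c)}"

text \<open>If \<W> is finer than the cover, absorption supplies a piecewise refinement in the
  opposite direction. So every transition map from this stage on is bijective and
  \<open>stage_iso\<close> applies.\<close>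

lemma to_cech_iso:
  assumes r: "open_family r V" and cover: "(\<Union>i\<in>Field r. V i) = UNIV" and absorbing: "absorbing r V"
    and n: "0 < n"
  shows "to_cech n r V \<in> iso (cover_cohomology n A P r V) (cech_cohomology n A P)"
proof -
  interpret direct_system open_covers "\<lambda>\<W> \<V>. refines \<V> \<W>" "set_cover_cohomology n A P" "refinement_map n A P"
    using n by (rule cech_direct_system)
  let ?V = "V ` Field r"
  have V: "?V \<in> open_covers" using r cover by (rule open_family_image)
  note oV = open_family_chosen[OF V]
  have into: "piecewise_refines r V (chosen_order ?V) id (\<lambda>_. V)"
    by (auto simp: piecewise_refines_def pointwise_refines_def piecewise_constant_const)
  have "cohomology_pullback A P n r V (chosen_order ?V) id (\<lambda>_. inv_into (Field r) V)
      \<in> iso (cover_cohomology n A P r V) (set_cover_cohomology n A P ?V)"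
    unfolding set_cover_cohomology_def using r oV n inv_into_refines into by (rule pullback_iso)
  moreover have "(\<lambda>c. rel `` {(?V, c)}) \<in> iso (set_cover_cohomology n A P ?V) (cech_cohomology n A P)"
    unfolding cech_cohomology_def
  proof (rule stage_iso[OF V])
    fix \<W> assume \<W>: "\<W> \<in> open_covers" "refines \<W> ?V"
    obtain \<rho> where "piecewise_refines r V (chosen_order \<W>) id \<rho>"
      using absorbing \<W>(1) unfolding absorbing_def by blast
    then have "piecewise_refines (chosen_order ?V) id (chosen_order \<W>) id (\<lambda>x U. \<rho> x (inv_into (Field r) V U))"
      using inv_into_refines by (rule piecewise_refines_comp)
    then show "bij_betw (refinement_map n A P ?V \<W>) (carrier (set_cover_cohomology n A P ?V))
        (carrier (set_cover_cohomology n A P \<W>))"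
      using pullback_iso[OF oV open_family_chosen[OF \<W>(1)] n refinement_function_piecewise[OF \<W>(2)]] \<W>(2)
      by (simp add: set_cover_cohomology_def refinement_map_eq iso_def)
  qed
  ultimately have "(\<lambda>c. rel `` {(?V, c)}) \<circ>
      cohomology_pullback A P n r V (chosen_order ?V) id (\<lambda>_. inv_into (Field r) V)
      \<in> iso (cover_cohomology n A P r V) (cech_cohomology n A P)"
    by (rule iso_set_trans)
  moreover have "(\<lambda>c. rel `` {(?V, c)}) \<circ>
      cohomology_pullback A P n r V (chosen_order ?V) id (\<lambda>_. inv_into (Field r) V) = to_cech n r V"
    by (simp add: fun_eq_iff to_cech_def)
  ultimately show ?thesis by simp
qed

end

section \<open>Open covers of ordinals of uncountable cofinality\<close>

lemma Well_order_ordinal_rel: "Well_order (ordinal_rel :: 'd::wellorder rel)"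
  and Field_ordinal_rel [simp]: "Field (ordinal_rel :: 'd rel) = UNIV"
proof -
  show F: "Field (ordinal_rel :: 'd rel) = UNIV" by (auto simp: Field_def ordinal_rel_def)
  have "ordinal_rel - Id = {(a, b :: 'd). a < b}" by (auto simp: ordinal_rel_def)
  then have "wf (ordinal_rel - Id :: 'd rel)" using wf by simp
  then show "Well_order (ordinal_rel :: 'd rel)"
    unfolding F well_order_on_def linear_order_on_def partial_order_on_def preorder_on_def
    by (auto simp: ordinal_rel_def refl_on_def trans_def antisym_def total_on_def)
qed

text \<open>The first alternative is that \<open>b\<close> is the least element, which has no left
  side.\<close>

lemma open_Ioc_left:
  fixes b :: "'d::{wellorder, linorder_topology}"
  assumes "open U" "b \<in> U"
  shows "(\<forall>x. b \<le> x) \<or> (\<exists>a<b. {a<..b} \<subseteq> U)"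
proof (cases "\<forall>x. b \<le> x")
  case False
  then obtain y where "y < b" by (auto simp: not_le)
  then show ?thesis using open_left[OF assms] by blast
qed simp

context
  assumes cof: "uncountable_cofinality TYPE('d::{wellorder, linorder_topology})"
begin

text \<open>Every use of the cofinality hypothesis passes through this: singletons yield successors,
  and sequences yield suprema.\<close>

lemma countable_bounded: "countable C \<Longrightarrow> \<exists>b::'d. \<forall>c\<in>C. c < b"
  using cof unfolding uncountable_cofinality_def by (meson not_le)

lemma no_maximum: "\<exists>b::'d. a < b"
  using countable_bounded[of "{a}"] by auto

text \<open>The witness is the successor of \<open>a\<close>. Hence closed initial segments are
  open, and \<open>{..a}\<close> and \<open>{a<..}\<close> form a clopen partition.\<close>

lemma atMost_eq_lessThan: "\<exists>b. {..a::'d} = {..<b}"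
proof -
  define b where "b = (LEAST b. a < b)"
  have "a < b" unfolding b_def using no_maximum[of a] by (rule LeastI_ex)
  then have "x \<le> a \<longleftrightarrow> x < b" for x
    using not_less_Least[of x "\<lambda>b. a < b"] by (auto simp: b_def not_less)
  then show ?thesis by (intro exI[of _ b]) (simp add: set_eq_iff)
qed

lemma open_atMost: "open {..a::'d}"
  using atMost_eq_lessThan[of a] open_lessThan by metis

text \<open>
  A substitute for Fodor's lemma: otherwise there are \<open>g 0 < g 1 < \<dots>\<close> such that no interval
  \<open>{g n<..g (n + 1)}\<close> lies in a member of the cover, but a member containing the supremum of the
  \<open>g n\<close> contains almost all of these intervals.
\<close>
lemma tail_absorbed:
  fixes W :: "'j \<Rightarrow> 'd set"
  assumes W: "\<And>j. j \<in> J \<Longrightarrow> open (W j)" "(\<Union>j\<in>J. W j) = UNIV"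
  shows "\<exists>c. \<forall>b. \<exists>j\<in>J. {c<..b} \<subseteq> W j"
proof (rule ccontr)
  assume "\<not> ?thesis"
  then obtain F where F: "\<And>c j. j \<in> J \<Longrightarrow> \<not> {c<..F c} \<subseteq> W j" by metis
  obtain j0 where "j0 \<in> J" using W(2) by auto
  define g where "g n = (F ^^ n) undefined" for n
  have g: "\<not> {g n<..g (Suc n)} \<subseteq> W j" if "j \<in> J" for n j
    using F[OF that, of "g n"] by (simp add: g_def)
  obtain b where "\<forall>c\<in>range g. c < b" using countable_bounded[of "range g"] by auto
  then have ex: "\<exists>b. \<forall>n. g n < b" by blast
  define s where "s = (LEAST b. \<forall>n. g n < b)"
  have s: "g n < s" for n using LeastI_ex[OF ex] by (simp add: s_def)
  obtain j where j: "j \<in> J" "s \<in> W j" using W(2) by blast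
  obtain a where a: "a < s" "{a<..s} \<subseteq> W j"
    using open_Ioc_left[OF W(1)[OF j(1)] j(2)] s[of 0] by (auto simp: not_le)
  obtain n where "a \<le> g n" using not_less_Least[of a "\<lambda>b. \<forall>n. g n < b"] a(1) by (auto simp: s_def not_less)
  then have "{g n<..g (Suc n)} \<subseteq> {a<..s}" using s[of "Suc n"] by auto
  then show False using g[OF j(1), of n] a(2) by blast
qed

text \<open>Compactness of \<open>{..b}\<close> by induction: a piece \<open>{a<..b}\<close> lies in
  one member, and \<open>{..a}\<close> has been dealt with. The value \<open>j\<close> is kept on
  all of \<open>{a<..}\<close>, beyond \<open>b\<close> too, so that the function is piecewise
  constant on the whole space.\<close>

lemma initial_piecewise_choice:
  fixes W :: "'j \<Rightarrow> 'd set"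
  assumes W: "\<And>j. j \<in> J \<Longrightarrow> open (W j)" "(\<Union>j\<in>J. W j) = UNIV"
  shows "\<exists>\<rho>. piecewise_constant \<rho> \<and> (\<forall>x\<le>b. \<rho> x \<in> J \<and> x \<in> W (\<rho> x))"
proof (induction b rule: less_induct)
  case (less b)
  obtain j where j: "j \<in> J" "b \<in> W j" using W(2) by blast
  consider "\<forall>x. b \<le> x" | a where "a < b" "{a<..b} \<subseteq> W j"
    using open_Ioc_left[OF W(1)[OF j(1)] j(2)] by blast
  then show ?case
  proof cases
    case 1
    then have "x = b" if "x \<le> b" for x using that by (meson antisym)
    then show ?thesis using j by (intro exI[of _ "\<lambda>_. j"]) (auto simp: piecewise_constant_const)
  next
    case 2
    then obtain \<rho> where \<rho>: "piecewise_constant \<rho>" "\<forall>x\<le>a. \<rho> x \<in> J \<and> x \<in> W (\<rho> x)"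
      using less by blast
    have "- {a<..} = {..a}" by auto
    then have "piecewise_constant (\<lambda>x. if x \<in> {a<..} then j else \<rho> x)"
      using \<rho>(1) open_atMost[of a] by (intro piecewise_constant_if piecewise_constant_const) auto
    then show ?thesis
      using \<rho>(2) j(1) 2(2) by (intro exI[of _ "\<lambda>x. if x \<in> {a<..} then j else \<rho> x"]) auto
  qed
qed

text \<open>Up to \<open>c\<close> the chosen member depends on the point alone, above
  \<open>c\<close> on the index alone: \<open>V i\<close> is bounded, so its part above
  \<open>c\<close> lies in an interval that one member absorbs.\<close>

lemma bounded_family_absorbing:
  fixes V :: "'i \<Rightarrow> 'd set"
  assumes V: "refines (V ` Field r) (range lessThan)"
  shows "absorbing r V"
  unfolding absorbing_def
proof
  fix \<W> :: "'d set set" assume "\<W> \<in> open_covers"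
  then have W: "\<And>U. U \<in> \<W> \<Longrightarrow> open (id U)" "(\<Union>U\<in>\<W>. id U) = UNIV"
    by (auto simp: open_covers_def)
  obtain c where c: "\<forall>b. \<exists>U\<in>\<W>. {c<..b} \<subseteq> id U" using tail_absorbed[OF W] by blast
  obtain \<rho> where \<rho>: "piecewise_constant \<rho>" "\<forall>x\<le>c. \<rho> x \<in> \<W> \<and> x \<in> id (\<rho> x)"
    using initial_piecewise_choice[OF W, where b=c] by blast
  have "\<exists>U\<in>\<W>. V i \<inter> {c<..} \<subseteq> U" if "i \<in> Field r" for i
  proof -
    have "\<exists>U\<in>range lessThan. V i \<subseteq> U" using V that by (simp add: refines_def)
    then obtain b where "V i \<subseteq> {..<b}" by blast
    moreover obtain U where "U \<in> \<W>" "{c<..b} \<subseteq> U" using c by auto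
    ultimately show ?thesis by (intro bexI[of _ U]) fastforce+
  qed
  then obtain u where u: "\<And>i. i \<in> Field r \<Longrightarrow> u i \<in> \<W> \<and> V i \<inter> {c<..} \<subseteq> u i" by metis
  define \<sigma> where "\<sigma> = (\<lambda>x. if x \<in> {c<..} then u else (\<lambda>_. \<rho> x))"
  have "- {c<..} = {..c}" by auto
  then have "piecewise_constant \<sigma>"
    unfolding \<sigma>_def using open_atMost[of c] piecewise_constant_compose[OF \<rho>(1), of "\<lambda>U _. U"]
    by (intro piecewise_constant_if piecewise_constant_const) auto
  moreover have "pointwise_refines r V (chosen_order \<W>) id \<sigma>"
    using \<rho>(2) u by (auto simp: pointwise_refines_def \<sigma>_def not_less)
  ultimately show "\<exists>\<rho>. piecewise_refines r V (chosen_order \<W>) id \<rho>"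
    unfolding piecewise_refines_def by blast
qed

section \<open>The covers by the initial segments \<open>{..<a}\<close> and
  \<open>{..a}\<close>\<close>

lemma lessThan_cover:
  "open_family ordinal_rel (lessThan :: 'd \<Rightarrow> 'd set)"
  "(\<Union>i\<in>Field ordinal_rel. {..<i::'d}) = UNIV"
  "absorbing ordinal_rel (lessThan :: 'd \<Rightarrow> 'd set)"
  using no_maximum Well_order_ordinal_rel[where 'd='d]
  by (auto simp: open_family_def refines_def intro!: bounded_family_absorbing)

lemma atMost_cover:
  "open_family ordinal_rel (atMost :: 'd \<Rightarrow> 'd set)"
  "(\<Union>i\<in>Field ordinal_rel. {..i::'d}) = UNIV"
  "absorbing ordinal_rel (atMost :: 'd \<Rightarrow> 'd set)"
proof -
  have "\<exists>b. {..i::'d} \<subseteq> {..<b}" for i using atMost_eq_lessThan[of i] by blast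
  then show "absorbing ordinal_rel (atMost :: 'd \<Rightarrow> 'd set)"
    by (intro bounded_family_absorbing) (auto simp: refines_def)
qed (use Well_order_ordinal_rel[where 'd='d] in \<open>auto simp: open_family_def open_atMost\<close>)

lemma cech_cohomology_iso:
  fixes V :: "'i \<Rightarrow> 'd set"
  assumes "function_presheaf A P" "0 < n" "enumerated_open_cover r V"
    "refines (V ` Field r) (range lessThan)"
  shows "cech_cohomology n A P \<cong> cover_cohomology n A P r V"
proof -
  interpret function_presheaf A P by fact
  have r: "open_family r V" "(\<Union>i\<in>Field r. V i) = UNIV"
    using assms(3) by (auto simp: enumerated_open_cover_def open_family_def)
  have "Group.group (cover_cohomology n A P r V)"
    using cohomology_comm_group[OF r(1) assms(2)] by (rule comm_group.axioms(2))
  then show ?thesis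
    using group.iso_set_sym to_cech_iso[OF r bounded_family_absorbing[OF assms(4)] assms(2)]
    unfolding is_iso_def by blast
qed

end

section \<open>Change of coefficients\<close>

lemma alternating_hom:
  assumes "comm_group A" "comm_group B" "h \<in> hom A B" "alternating A f"
  shows "alternating B (\<lambda>zs. h (f zs))"
proof -
  interpret A: comm_group A by fact
  interpret B: comm_group B by fact
  interpret h: group_hom A B h using assms(3) by unfold_locales
  note c = A.alternating_closed[OF assms(4)]
  show ?thesis
  proof (rule B.alternatingI)
    fix us a b vs
    show "h (f (us @ a # b # vs)) = inv\<^bsub>B\<^esub> h (f (us @ b # a # vs))"
      unfolding A.alternating_swap[OF assms(4), of us a b vs] using c by (rule h.hom_inv)
    show "h (f (us @ a # a # vs)) = \<one>\<^bsub>B\<^esub>"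
      unfolding A.alternating_repeat[OF assms(4), of us a vs] by (rule h.hom_one)
  qed (use c in auto)
qed

locale coefficient_change = dom: function_presheaf A P + cod: function_presheaf B Q
  for A :: "'a monoid" and P :: "'x::topological_space set \<Rightarrow> ('x \<Rightarrow> 'a) set"
    and B :: "'a monoid" and Q :: "'x set \<Rightarrow> ('x \<Rightarrow> 'a) set" +
  fixes h :: "'a \<Rightarrow> 'a"
  assumes hom: "h \<in> hom A B"
    and sections: "open U \<Longrightarrow> f \<in> P U \<Longrightarrow> (\<lambda>x\<in>U. h (f x)) \<in> Q U"
begin

sublocale h: group_hom A B h using hom by unfold_locales

abbreviation change where
  "change n r V \<equiv> induced_map (all_cochains B r V n) (coboundaries B Q r V n) (cochain_change r V n h)"

lemma cochain_change_apply:
  "xs \<in> increasing_tuples r (n + 1) \<Longrightarrow> x \<in> overlap V xs \<Longrightarrow> cochain_change r V n h f xs x = h (f xs x)"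
  by (simp add: cochain_change_def)

lemma cochain_change_closed:
  assumes "f \<in> carrier (all_cochains A r V n)"
  shows "cochain_change r V n h f \<in> carrier (all_cochains B r V n)"
  using all_cochains_value[OF assms]
  by (intro all_cochains_carrierI) (auto simp: cochain_change_def)

lemma cochain_change_mult:
  assumes f: "f \<in> carrier (all_cochains A r V n)" and g: "g \<in> carrier (all_cochains A r V n)"
  shows "cochain_change r V n h (f \<otimes>\<^bsub>all_cochains A r V n\<^esub> g) =
    cochain_change r V n h f \<otimes>\<^bsub>all_cochains B r V n\<^esub> cochain_change r V n h g"
proof (rule all_cochains_eqI)
  interpret M: comm_group "all_cochains A r V n" by (rule comm_group_all_cochains[OF dom.A])
  interpret N: comm_group "all_cochains B r V n" by (rule comm_group_all_cochains[OF cod.A])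
  show "cochain_change r V n h (f \<otimes>\<^bsub>all_cochains A r V n\<^esub> g) \<in> carrier (all_cochains B r V n)"
    using f g by (intro cochain_change_closed M.m_closed)
  show "cochain_change r V n h f \<otimes>\<^bsub>all_cochains B r V n\<^esub> cochain_change r V n h g
      \<in> carrier (all_cochains B r V n)"
    using f g by (intro cochain_change_closed N.m_closed)
  fix xs x assume xs: "xs \<in> increasing_tuples r (n + 1)" "x \<in> overlap V xs"
  show "cochain_change r V n h (f \<otimes>\<^bsub>all_cochains A r V n\<^esub> g) xs x =
    (cochain_change r V n h f \<otimes>\<^bsub>all_cochains B r V n\<^esub> cochain_change r V n h g) xs x"
    unfolding all_cochains_mult[OF xs] cochain_change_apply[OF xs]
    using all_cochains_value[OF f xs] all_cochains_value[OF g xs] by (rule h.hom_mult)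
qed

lemma cochain_change_one:
  "cochain_change r V n h \<one>\<^bsub>all_cochains A r V n\<^esub> = \<one>\<^bsub>all_cochains B r V n\<^esub>"
proof -
  interpret h: group_hom "all_cochains A r V n" "all_cochains B r V n" "cochain_change r V n h"
    by (simp add: group_hom_def group_hom_axioms_def group_all_cochains dom.A cod.A homI
        cochain_change_closed cochain_change_mult)
  show ?thesis by (rule h.hom_one)
qed

lemma coboundary_cochain_change:
  assumes r: "Well_order r" and f: "f \<in> carrier (all_cochains A r V n)"
  shows "coboundary_map B r V n (cochain_change r V n h f) =
    cochain_change r V (n + 1) h (coboundary_map A r V n f)"
proof (rule all_cochains_eqI)
  show "coboundary_map B r V n (cochain_change r V n h f) \<in> carrier (all_cochains B r V (n + 1))"
    using cod.A r cochain_change_closed[OF f] by (rule coboundary_closed)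
  show "cochain_change r V (n + 1) h (coboundary_map A r V n f) \<in> carrier (all_cochains B r V (n + 1))"
    using coboundary_closed[OF dom.A r f] by (rule cochain_change_closed)
  fix xs x assume xs: "xs \<in> increasing_tuples r (n + 1 + 1)" "x \<in> overlap V xs"
  have "coboundary_map B r V n (cochain_change r V n h f) xs x =
      asum B xs (\<lambda>zs. h (alt_ext A r V n f x zs))"
  proof (rule coboundary_eq_asum[OF cod.A])
    show "range (\<lambda>zs. h (alt_ext A r V n f x zs)) \<subseteq> carrier B"
      using alt_ext_closed[OF dom.A r f] by auto
    show "cochain_change r V n h f zs x = h (alt_ext A r V n f x zs)"
      if "zs \<in> increasing_tuples r (n + 1)" "x \<in> overlap V zs" for zs
      using alt_ext_increasing[OF dom.A r f that] that by (simp add: cochain_change_def)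
  qed (use xs in auto)
  also have "\<dots> = h (asum A xs (alt_ext A r V n f x))"
    using dom.A.asum_hom[OF cod.A hom alt_ext_range[OF dom.A r f]] by simp
  also have "\<dots> = cochain_change r V (n + 1) h (coboundary_map A r V n f) xs x"
    using xs coboundary_alt_ext[OF dom.A r f, of xs x] by (simp add: cochain_change_def)
  finally show "coboundary_map B r V n (cochain_change r V n h f) xs x =
    cochain_change r V (n + 1) h (coboundary_map A r V n f) xs x" .
qed

text \<open>Composing the alternating extension with \<open>h\<close> gives an alternating function
  that extends the changed cochain; by uniqueness it is the extension.\<close>

lemma pointwise_pullback_cochain_change:
  assumes s: "Well_order s" and f: "f \<in> carrier (all_cochains A s W n)"
    and \<rho>: "pointwise_refines r V s W \<rho>"
  shows "pointwise_pullback B s W r V n \<rho> (cochain_change s W n h f) =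
    cochain_change r V n h (pointwise_pullback A s W r V n \<rho> f)"
proof (rule all_cochains_eqI)
  show "pointwise_pullback B s W r V n \<rho> (cochain_change s W n h f) \<in> carrier (all_cochains B r V n)"
    using cod.A s cochain_change_closed[OF f] by (rule pointwise_pullback_closed)
  show "cochain_change r V n h (pointwise_pullback A s W r V n \<rho> f) \<in> carrier (all_cochains B r V n)"
    using pointwise_pullback_closed[OF dom.A s f] by (rule cochain_change_closed)
  fix xs x assume xs: "xs \<in> increasing_tuples r (n + 1)" "x \<in> overlap V xs"
  then have sub: "set xs \<subseteq> Field r" and len: "length xs = n + 1" by (auto simp: increasing_tuples_def)
  have "alt_ext B s W n (cochain_change s W n h f) x (map (\<rho> x) xs) =
      h (alt_ext A s W n f x (map (\<rho> x) xs))"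
  proof (rule alt_ext_unique[OF cod.A s cochain_change_closed[OF f]
        alternating_hom[OF dom.A cod.A hom alternating_alt_ext[OF dom.A s f]]])
    show "cochain_change s W n h f zs x = h (alt_ext A s W n f x zs)"
      if "zs \<in> increasing_tuples s (n + 1)" "x \<in> overlap W zs" for zs
      using alt_ext_increasing[OF dom.A s f that] that by (simp add: cochain_change_def)
  qed (use pointwise_refines_map[OF \<rho> sub xs(2)] len in auto)
  then show "pointwise_pullback B s W r V n \<rho> (cochain_change s W n h f) xs x =
    cochain_change r V n h (pointwise_pullback A s W r V n \<rho> f) xs x"
    by (simp only: cochain_change_apply[OF xs] pointwise_pullback_apply[OF xs])
qed

lemma cochain_change_in_C:
  assumes r: "open_family r V" and f: "f \<in> dom.C r V n"
  shows "cochain_change r V n h f \<in> cod.C r V n"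
proof (rule cod.C_I)
  fix xs assume xs: "xs \<in> increasing_tuples r (n + 1)"
  then have "open (overlap V xs)"
    using open_overlap[OF r] by (auto simp: increasing_tuples_def)
  then show "cochain_change r V n h f xs \<in> Q (overlap V xs)"
    using sections dom.C_sections[OF f xs] xs by (simp add: cochain_change_def)
qed (auto simp: cochain_change_def)

lemma subquotient_map_change:
  assumes r: "open_family r V" and n: "0 < n"
  shows "subquotient_map (all_cochains A r V n) (cocycles A P r V n) (coboundaries A P r V n)
    (all_cochains B r V n) (cocycles B Q r V n) (coboundaries B Q r V n) (cochain_change r V n h)"
proof -
  interpret G: subquotient "all_cochains A r V n" "cocycles A P r V n" "coboundaries A P r V n"
    using r n by (rule dom.subquotient_cohomology)
  interpret H: subquotient "all_cochains B r V n" "cocycles B Q r V n" "coboundaries B Q r V n"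
    using r n by (rule cod.subquotient_cohomology)
  have wo: "Well_order r" using r by (rule open_family_Well_order)
  obtain m where m: "n = Suc m" using n gr0_implies_Suc by blast
  show ?thesis
  proof
    fix f assume "f \<in> cocycles A P r V n"
    then have "f \<in> dom.C r V n" "coboundary_map A r V n f = \<one>\<^bsub>all_cochains A r V (n + 1)\<^esub>"
      by (auto simp: dom.cocycles_eq)
    then show "cochain_change r V n h f \<in> cocycles B Q r V n"
      using cochain_change_in_C[OF r] coboundary_cochain_change[OF wo dom.C_all_cochains[OF r]]
      by (simp add: cod.cocycles_eq cochain_change_one)
  next
    fix f g assume "f \<in> cocycles A P r V n" "g \<in> cocycles A P r V n"
    then show "cochain_change r V n h (f \<otimes>\<^bsub>all_cochains A r V n\<^esub> g) =
      cochain_change r V n h f \<otimes>\<^bsub>all_cochains B r V n\<^esub> cochain_change r V n h g"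
      by (intro cochain_change_mult G.Z_carrier)
  next
    fix f assume "f \<in> coboundaries A P r V n"
    then obtain g where g: "g \<in> dom.C r V m" "f = coboundary_map A r V m g"
      using m by (auto simp: dom.coboundaries_Suc)
    then have "cochain_change r V n h f = coboundary_map B r V m (cochain_change r V m h g)"
      using coboundary_cochain_change[OF wo dom.C_all_cochains[OF r g(1)]] m by simp
    then show "cochain_change r V n h f \<in> coboundaries B Q r V n"
      using cochain_change_in_C[OF r g(1)] m by (simp add: cod.coboundaries_Suc)
  qed
qed

lemma change_class:
  assumes "open_family r V" "0 < n" "f \<in> cocycles A P r V n"
  shows "change n r V (cohomology_class A P n r V f) = cohomology_class B Q n r V (cochain_change r V n h f)"
  using subquotient_map.induced_coset[OF subquotient_map_change[OF assms(1,2)] assms(3)] .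

lemma change_cocycle:
  assumes "open_family r V" "0 < n" "f \<in> cocycles A P r V n"
  shows "cochain_change r V n h f \<in> cocycles B Q r V n"
  using subquotient_map.closed[OF subquotient_map_change[OF assms(1,2)] assms(3)] .

lemma change_closed:
  assumes "open_family r V" "0 < n" "c \<in> carrier (cover_cohomology n A P r V)"
  shows "change n r V c \<in> carrier (cover_cohomology n B Q r V)"
  using subquotient_map.induced_hom[OF subquotient_map_change[OF assms(1,2)]] assms(3)
  by (auto simp: hom_def cover_cohomology_subquot)

lemma change_pullback:
  assumes s: "open_family s W" and r: "open_family r V" and n: "0 < n"
    and \<rho>: "piecewise_refines r V s W \<rho>" and c: "c \<in> carrier (cover_cohomology n A P s W)"
  shows "change n r V (cohomology_pullback A P n s W r V \<rho> c) =
    cohomology_pullback B Q n s W r V \<rho> (change n s W c)"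
proof -
  obtain f where f: "f \<in> cocycles A P s W n" "c = cohomology_class A P n s W f"
    using c dom.carrier_cohomology[OF s n] by auto
  have "f \<in> carrier (all_cochains A s W n)"
    using f(1) dom.C_all_cochains[OF s] by (auto simp: dom.cocycles_eq)
  then have "pointwise_pullback B s W r V n \<rho> (cochain_change s W n h f) =
    cochain_change r V n h (pointwise_pullback A s W r V n \<rho> f)"
    using open_family_Well_order[OF s] \<rho>
    by (intro pointwise_pullback_cochain_change) (auto simp: piecewise_refines_def)
  then show ?thesis
    using f dom.pullback_cocycle[OF s r n \<rho> f(1)] change_cocycle[OF s n f(1)]
    by (simp add: dom.pullback_class[OF s r n \<rho>] cod.pullback_class[OF s r n \<rho>]
        change_class[OF s n] change_class[OF r n])
qed

text \<open>The left side is the union over all representatives from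
  \<open>cech_cohomology_change\<close>. Each agrees with the representative at the cover itself
  after passing to a finer cover, and change of coefficients commutes with refinement maps, so all
  contribute one class.\<close>

lemma cech_change_to_cech:
  assumes r: "open_family r V" and cover: "(\<Union>i\<in>Field r. V i) = UNIV" and n: "0 < n"
    and c: "c \<in> carrier (cover_cohomology n A P r V)"
  shows "(\<Union>(\<V>, c)\<in>dom.to_cech n r V c. cod.cech_rel n `` {(\<V>, change n (chosen_order \<V>) id c)}) =
    cod.to_cech n r V (change n r V c)"
proof -
  interpret DA: direct_system open_covers "\<lambda>\<W> \<V>. refines \<V> \<W>" "set_cover_cohomology n A P" "refinement_map n A P"
    using n by (rule dom.cech_direct_system)
  interpret DB: direct_system open_covers "\<lambda>\<W> \<V>. refines \<V> \<W>" "set_cover_cohomology n B Q" "refinement_map n B Q"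
    using n by (rule cod.cech_direct_system)
  let ?V = "V ` Field r"
  define d where "d = cohomology_pullback A P n r V (chosen_order ?V) id (\<lambda>_. inv_into (Field r) V) c"
  define e where "e = change n (chosen_order ?V) id d"
  have V: "?V \<in> open_covers" using r cover by (rule open_family_image)
  note o = open_family_chosen
  have d: "d \<in> carrier (set_cover_cohomology n A P ?V)"
    using dom.pullback_hom[OF r o[OF V] n inv_into_refines] c
    by (auto simp: d_def hom_def set_cover_cohomology_def)
  have cl: "change n (chosen_order \<V>) id c \<in> carrier (set_cover_cohomology n B Q \<V>)"
    if "\<V> \<in> open_covers" "c \<in> carrier (set_cover_cohomology n A P \<V>)" for \<V> c
    using that change_closed[OF o n] by (simp add: set_cover_cohomology_def)
  have push: "change n (chosen_order \<W>) id (refinement_map n A P \<V> \<W> c) =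
      refinement_map n B Q \<V> \<W> (change n (chosen_order \<V>) id c)"
    if "\<V> \<in> open_covers" "\<W> \<in> open_covers" "refines \<W> \<V>" "c \<in> carrier (set_cover_cohomology n A P \<V>)"
    for \<V> \<W> c
    using that change_pullback[OF o[OF that(1)] o[OF that(2)] n refinement_function_piecewise]
    by (simp add: dom.refinement_map_eq cod.refinement_map_eq set_cover_cohomology_def)
  have *: "DB.rel `` {(\<V>, change n (chosen_order \<V>) id x)} = DB.rel `` {(?V, e)}"
    if "((?V, d), (\<V>, x)) \<in> DA.rel" for \<V> x
  proof (rule DA.relE[OF that])
    fix \<W> assume W: "?V \<in> open_covers" "d \<in> carrier (set_cover_cohomology n A P ?V)"
      "\<V> \<in> open_covers" "x \<in> carrier (set_cover_cohomology n A P \<V>)" "\<W> \<in> open_covers"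
      "refines \<W> ?V" "refines \<W> \<V>" "refinement_map n A P ?V \<W> d = refinement_map n A P \<V> \<W> x"
    have "refinement_map n B Q \<V> \<W> (change n (chosen_order \<V>) id x) = refinement_map n B Q ?V \<W> e"
      unfolding e_def push[OF W(3,5,7,4), symmetric] push[OF W(1,5,6,2), symmetric] W(8) ..
    then have "((\<V>, change n (chosen_order \<V>) id x), (?V, e)) \<in> DB.rel"
      using W cl[OF W(3,4)] cl[OF V d] by (intro DB.relI) (auto simp: e_def)
    then show ?thesis
      using DB.class_eq_iff[OF W(3) cl[OF W(3,4)] V] cl[OF V d] by (simp add: e_def)
  qed
  have self: "(?V, d) \<in> DA.rel `` {(?V, d)}"
    using DA.relI[OF V d V d V] by (simp add: DA.refl[OF V])
  have "(\<Union>(\<V>, c)\<in>DA.rel `` {(?V, d)}. DB.rel `` {(\<V>, change n (chosen_order \<V>) id c)}) =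
      (\<Union>p\<in>DA.rel `` {(?V, d)}. DB.rel `` {(?V, e)})"
  proof (rule SUP_cong[OF HOL.refl])
    fix p assume "p \<in> DA.rel `` {(?V, d)}"
    then show "(case p of (\<V>, c) \<Rightarrow> DB.rel `` {(\<V>, change n (chosen_order \<V>) id c)}) = DB.rel `` {(?V, e)}"
      using *[of "fst p" "snd p"] by (simp add: case_prod_beta)
  qed
  also have "\<dots> = DB.rel `` {(?V, e)}" using self by (intro UN_constant[THEN trans]) auto
  also have "e = cohomology_pullback B Q n r V (chosen_order ?V) id (\<lambda>_. inv_into (Field r) V) (change n r V c)"
    unfolding e_def d_def using r o[OF V] n inv_into_refines c by (rule change_pullback)
  finally show ?thesis by (simp only: dom.to_cech_def cod.to_cech_def d_def)
qed

end

definition coefficient_functor :: "('a monoid \<Rightarrow> 'x::topological_space set \<Rightarrow> ('x \<Rightarrow> 'a) set) \<Rightarrow> bool" where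
  "coefficient_functor \<P> \<longleftrightarrow>
     (\<forall>A. comm_group A \<longrightarrow> function_presheaf A (\<P> A)) \<and>
     (\<forall>A B h. comm_group A \<and> comm_group B \<and> h \<in> hom A B \<longrightarrow> coefficient_change A (\<P> A) B (\<P> B) h)"

lemma coefficient_functorD:
  assumes "coefficient_functor \<P>" "comm_group A"
  shows "function_presheaf A (\<P> A)"
    and "comm_group B \<Longrightarrow> h \<in> hom A B \<Longrightarrow> coefficient_change A (\<P> A) B (\<P> B) h"
  using assms unfolding coefficient_functor_def by blast+

lemma cover_cohomology_change_eq:
  "cover_cohomology_change n \<P> r V B h =
     induced_map (all_cochains B r V n) (coboundaries B (\<P> B) r V n) (cochain_change r V n h)"
  by (simp add: cover_cohomology_change_def induced_map_cochains)

text \<open>\<open>to_cech\<close> leads from the cover into the limit; naturality is shown in that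
  direction and then inverted.\<close>

lemma cech_natural:
  assumes \<P>: "coefficient_functor \<P>" and r: "open_family r V" and cover: "(\<Union>i\<in>Field r. V i) = UNIV"
    and absorbing: "absorbing r V" and n: "0 < n"
  shows "naturally_isomorphic
    (\<lambda>A. cech_cohomology n A (\<P> A)) (cech_cohomology_change n \<P>)
    (\<lambda>A. cover_cohomology n A (\<P> A) r V) (cover_cohomology_change n \<P> r V)"
proof (rule naturally_isomorphic_sym)
  show "naturally_isomorphic
    (\<lambda>A. cover_cohomology n A (\<P> A) r V) (cover_cohomology_change n \<P> r V)
    (\<lambda>A. cech_cohomology n A (\<P> A)) (cech_cohomology_change n \<P>)"
  proof (rule naturally_isomorphicI[of "\<lambda>A. function_presheaf.to_cech A (\<P> A) n r V"])
    fix A :: "'a monoid" assume A: "comm_group A"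
    interpret function_presheaf A "\<P> A" using \<P> A by (rule coefficient_functorD)
    show "to_cech n r V \<in> iso (cover_cohomology n A (\<P> A) r V) (cech_cohomology n A (\<P> A))"
      using r cover absorbing n by (rule to_cech_iso)
    fix B :: "'a monoid" and h c
    assume B: "comm_group B" "h \<in> hom A B" and c: "c \<in> carrier (cover_cohomology n A (\<P> A) r V)"
    interpret change: coefficient_change A "\<P> A" B "\<P> B" h
      using \<P> A B by (rule coefficient_functorD)
    show "change.cod.to_cech n r V (cover_cohomology_change n \<P> r V B h c) =
        cech_cohomology_change n \<P> B h (to_cech n r V c)"
      using change.cech_change_to_cech[OF r cover n c]
      by (simp add: cech_cohomology_change_def cover_cohomology_change_eq)
  qed
  fix A :: "'a monoid" assume A: "comm_group A"
  interpret function_presheaf A "\<P> A" using \<P> A by (rule coefficient_functorD)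
  show "Group.group (cover_cohomology n A (\<P> A) r V)"
    using cohomology_comm_group[OF r n] by (rule comm_group.axioms(2))
  fix B :: "'a monoid" and h c
  assume B: "comm_group B" "h \<in> hom A B" and c: "c \<in> carrier (cover_cohomology n A (\<P> A) r V)"
  interpret change: coefficient_change A "\<P> A" B "\<P> B" h
    using \<P> A B by (rule coefficient_functorD)
  show "cover_cohomology_change n \<P> r V B h c \<in> carrier (cover_cohomology n B (\<P> B) r V)"
    using change.change_closed[OF r n c] by (simp add: cover_cohomology_change_eq)
qed

section \<open>Finitely supported and locally constant functions\<close>

lemma finite_support_presheaf_eq:
  assumes "comm_group A"
  shows "finite_support_presheaf A U = {f \<in> U \<rightarrow>\<^sub>E carrier A. finite {x \<in> U. f x \<noteq> \<one>\<^bsub>A\<^esub>}}"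
  unfolding finite_support_presheaf_def
  using assms by (intro carrier_sum_group) (simp add: comm_group_def)

lemma function_presheaf_finite_support:
  assumes "comm_group A"
  shows "function_presheaf A (finite_support_presheaf A :: 'x::topological_space set \<Rightarrow> _)"
proof (rule function_presheaf.intro)
  interpret comm_group A by fact
  show "comm_group A" by fact
  show "presheaf_of_functions A (finite_support_presheaf A)"
    unfolding presheaf_of_functions_def finite_support_presheaf_eq[OF assms]
  proof (intro conjI allI impI ballI, goal_cases)
    case (1 U)
    show "subgroup {f \<in> U \<rightarrow>\<^sub>E carrier A. finite {x \<in> U. f x \<noteq> \<one>\<^bsub>A\<^esub>}} (product_group U (\<lambda>_. A))"
      by (intro subgroup_sum_group) simp
  next
    case (2 U W f)
    note W = 2(1) and f = 2(2)
    have "finite {x \<in> W. restrict f W x \<noteq> \<one>\<^bsub>A\<^esub>}"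
      by (rule finite_subset[of _ "{x \<in> U. f x \<noteq> \<one>\<^bsub>A\<^esub>}"]) (use W f in auto)
    then show "restrict f W \<in> {f \<in> W \<rightarrow>\<^sub>E carrier A. finite {x \<in> W. f x \<noteq> \<one>\<^bsub>A\<^esub>}}"
      using W f by auto
  qed
  show "disjointly_additive (finite_support_presheaf A)"
    unfolding disjointly_additive_def finite_support_presheaf_eq[OF assms]
  proof (intro allI impI, elim conjE, goal_cases)
    case (1 U W f)
    note ext = 1(4) and U = 1(5) and W = 1(6)
    have "finite ({x \<in> U. restrict f U x \<noteq> \<one>\<^bsub>A\<^esub>} \<union> {x \<in> W. restrict f W x \<noteq> \<one>\<^bsub>A\<^esub>})"
      using U W by blast
    then have "finite {x \<in> U \<union> W. f x \<noteq> \<one>\<^bsub>A\<^esub>}"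
      by (rule rev_finite_subset) auto
    moreover have "f x \<in> carrier A" if "x \<in> U \<union> W" for x
      using that U W by (auto simp: PiE_iff)
    ultimately show "f \<in> {f \<in> (U \<union> W) \<rightarrow>\<^sub>E carrier A. finite {x \<in> U \<union> W. f x \<noteq> \<one>\<^bsub>A\<^esub>}}"
      using ext by (simp add: PiE_iff)
  qed
qed

lemma coefficient_functor_finite_support: "coefficient_functor (finite_support_presheaf :: 'a monoid \<Rightarrow> 'x::topological_space set \<Rightarrow> _)"
  unfolding coefficient_functor_def
proof (intro conjI allI impI)
  fix A B :: "'a monoid" and h
  assume "comm_group A \<and> comm_group B \<and> h \<in> hom A B"
  then have AB: "comm_group A" "comm_group B" "h \<in> hom A B" by auto
  interpret dom: function_presheaf A "finite_support_presheaf A :: 'x set \<Rightarrow> _"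
    by (rule function_presheaf_finite_support) fact
  interpret cod: function_presheaf B "finite_support_presheaf B :: 'x set \<Rightarrow> _"
    by (rule function_presheaf_finite_support) fact
  interpret h: group_hom A B h using AB(3) by unfold_locales
  show "coefficient_change A (finite_support_presheaf A :: 'x set \<Rightarrow> _) B (finite_support_presheaf B) h"
  proof
    show "h \<in> hom A B" by fact
    fix U :: "'x set" and f assume f: "f \<in> finite_support_presheaf A U"
    then have fin: "finite {x \<in> U. f x \<noteq> \<one>\<^bsub>A\<^esub>}" and c: "\<And>x. x \<in> U \<Longrightarrow> f x \<in> carrier A"
      by (auto simp: finite_support_presheaf_eq AB)
    have "finite {x \<in> U. h (f x) \<noteq> \<one>\<^bsub>B\<^esub>}"
      by (rule finite_subset[OF _ fin]) auto
    then show "(\<lambda>x\<in>U. h (f x)) \<in> finite_support_presheaf B U"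
      using c by (simp add: finite_support_presheaf_eq AB cong: conj_cong)
  qed
qed (rule function_presheaf_finite_support)

lemma locally_constant_sheafI:
  assumes "f \<in> U \<rightarrow>\<^sub>E carrier A"
    and "\<And>x. x \<in> U \<Longrightarrow> \<exists>W. open W \<and> x \<in> W \<and> W \<subseteq> U \<and> (\<forall>y\<in>W. f y = f x)"
  shows "f \<in> locally_constant_sheaf A U"
  using assms by (simp add: locally_constant_sheaf_def)

lemma locally_constant_sheafE:
  assumes "f \<in> locally_constant_sheaf A U" "x \<in> U"
  obtains W where "open W" "x \<in> W" "W \<subseteq> U" "\<forall>y\<in>W. f y = f x"
  using assms unfolding locally_constant_sheaf_def by blast

lemma locally_constant_sheaf_carrier: "f \<in> locally_constant_sheaf A U \<Longrightarrow> f \<in> U \<rightarrow>\<^sub>E carrier A"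
  by (simp add: locally_constant_sheaf_def)

text \<open>Handles products, inverses and change of coefficients together: a function computed
  pointwise from \<open>f\<close> and \<open>g\<close> is constant wherever both are.\<close>

lemma locally_constant_sheaf_determined:
  assumes "f \<in> locally_constant_sheaf A U" "g \<in> locally_constant_sheaf A U" "k \<in> U \<rightarrow>\<^sub>E carrier B"
    and eq: "\<And>x y. x \<in> U \<Longrightarrow> y \<in> U \<Longrightarrow> f y = f x \<Longrightarrow> g y = g x \<Longrightarrow> k y = k x"
  shows "k \<in> locally_constant_sheaf B U"
proof (rule locally_constant_sheafI)
  fix x assume x: "x \<in> U"
  obtain W where W: "open W" "x \<in> W" "W \<subseteq> U" "\<forall>y\<in>W. f y = f x"
    using assms(1) x by (rule locally_constant_sheafE)
  obtain W' where W': "open W'" "x \<in> W'" "W' \<subseteq> U" "\<forall>y\<in>W'. g y = g x"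
    using assms(2) x by (rule locally_constant_sheafE)
  have "k y = k x" if "y \<in> W \<inter> W'" for y
    using that W(3,4) W'(4) x by (intro eq) blast+
  moreover have "open (W \<inter> W')" using W(1) W'(1) by (rule open_Int)
  ultimately show "\<exists>X. open X \<and> x \<in> X \<and> X \<subseteq> U \<and> (\<forall>y\<in>X. k y = k x)"
    using W(2,3) W'(2) by blast
qed fact

lemma function_presheaf_locally_constant:
  assumes "comm_group A"
  shows "function_presheaf A (locally_constant_sheaf A :: 'x::topological_space set \<Rightarrow> _)"
proof (rule function_presheaf.intro)
  interpret comm_group A by fact
  show "comm_group A" by fact
  show "presheaf_of_functions A (locally_constant_sheaf A)"
    unfolding presheaf_of_functions_def
  proof (intro conjI allI impI ballI, goal_cases)
    case U: (1 U)
    interpret PU: group "product_group U (\<lambda>_. A)" by simp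
    show "subgroup (locally_constant_sheaf A U) (product_group U (\<lambda>_. A))"
    proof (rule PU.subgroupI)
      show "locally_constant_sheaf A U \<subseteq> carrier (product_group U (\<lambda>_. A))"
        by (auto dest: locally_constant_sheaf_carrier)
      have "(\<lambda>x\<in>U. \<one>\<^bsub>A\<^esub>) \<in> locally_constant_sheaf A U"
        by (rule locally_constant_sheafI) (use U in auto)
      then show "locally_constant_sheaf A U \<noteq> {}" by blast
      fix f assume f: "f \<in> locally_constant_sheaf A U"
      have fc: "f \<in> U \<rightarrow>\<^sub>E carrier A" using f by (rule locally_constant_sheaf_carrier)
      show "inv\<^bsub>product_group U (\<lambda>_. A)\<^esub> f \<in> locally_constant_sheaf A U"
        using f f by (rule locally_constant_sheaf_determined) (use fc in auto)
      fix g assume g: "g \<in> locally_constant_sheaf A U"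
      have gc: "g \<in> U \<rightarrow>\<^sub>E carrier A" using g by (rule locally_constant_sheaf_carrier)
      show "f \<otimes>\<^bsub>product_group U (\<lambda>_. A)\<^esub> g \<in> locally_constant_sheaf A U"
        using f g by (rule locally_constant_sheaf_determined) (use fc gc in auto)
    qed
  next
    case (2 U W f)
    note W = 2(1) and f = 2(2)
    show "restrict f W \<in> locally_constant_sheaf A W"
    proof (rule locally_constant_sheafI)
      fix x assume x: "x \<in> W"
      obtain W' where W': "open W'" "x \<in> W'" "W' \<subseteq> U" "\<forall>y\<in>W'. f y = f x"
        using locally_constant_sheafE[OF f, of x] x W by blast
      have "restrict f W y = restrict f W x" if "y \<in> W \<inter> W'" for y
      proof -
        have "f y = f x" using that W'(4) by blast
        then show ?thesis using that x by simp
      qed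
      moreover have "open (W \<inter> W')" using W W'(1) by auto
      ultimately show "\<exists>W'. open W' \<and> x \<in> W' \<and> W' \<subseteq> W \<and> (\<forall>y\<in>W'. restrict f W y = restrict f W x)"
        using W'(2) x by blast
    qed (use W locally_constant_sheaf_carrier[OF f] in auto)
  qed
  show "disjointly_additive (locally_constant_sheaf A)"
    unfolding disjointly_additive_def
  proof (intro allI impI, elim conjE, goal_cases)
    case (1 U W f)
    note ext = 1(4) and U = 1(5) and W = 1(6)
    have piece: "\<exists>X. open X \<and> x \<in> X \<and> X \<subseteq> U \<union> W \<and> (\<forall>y\<in>X. f y = f x)"
      if T: "restrict f T \<in> locally_constant_sheaf A T" "x \<in> T" "T \<subseteq> U \<union> W" for T x
    proof -
      obtain X where X: "open X" "x \<in> X" "X \<subseteq> T" "\<forall>y\<in>X. restrict f T y = restrict f T x"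
        using T(1,2) by (rule locally_constant_sheafE)
      then have "\<forall>y\<in>X. f y = f x" using T(2) by (metis restrict_apply' subsetD)
      then show ?thesis using X T(3) by blast
    qed
    show "f \<in> locally_constant_sheaf A (U \<union> W)"
    proof (rule locally_constant_sheafI)
      show "f \<in> U \<union> W \<rightarrow>\<^sub>E carrier A"
        using ext locally_constant_sheaf_carrier[OF U] locally_constant_sheaf_carrier[OF W]
        by (auto simp: PiE_iff)
      show "\<exists>X. open X \<and> x \<in> X \<and> X \<subseteq> U \<union> W \<and> (\<forall>y\<in>X. f y = f x)" if "x \<in> U \<union> W" for x
        using that piece[OF U] piece[OF W] by blast
    qed
  qed
qed

lemma coefficient_functor_locally_constant: "coefficient_functor (locally_constant_sheaf :: 'a monoid \<Rightarrow> 'x::topological_space set \<Rightarrow> _)"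
  unfolding coefficient_functor_def
proof (intro conjI allI impI)
  fix A B :: "'a monoid" and h
  assume "comm_group A \<and> comm_group B \<and> h \<in> hom A B"
  then have AB: "comm_group A" "comm_group B" "h \<in> hom A B" by auto
  interpret dom: function_presheaf A "locally_constant_sheaf A :: 'x set \<Rightarrow> _"
    by (rule function_presheaf_locally_constant) fact
  interpret cod: function_presheaf B "locally_constant_sheaf B :: 'x set \<Rightarrow> _"
    by (rule function_presheaf_locally_constant) fact
  show "coefficient_change A (locally_constant_sheaf A :: 'x set \<Rightarrow> _) B (locally_constant_sheaf B) h"
  proof
    show "h \<in> hom A B" by fact
    fix U :: "'x set" and f assume f: "f \<in> locally_constant_sheaf A U"
    show "(\<lambda>x\<in>U. h (f x)) \<in> locally_constant_sheaf B U"
      using f f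
    proof (rule locally_constant_sheaf_determined)
      show "(\<lambda>x\<in>U. h (f x)) \<in> U \<rightarrow>\<^sub>E carrier B"
        using locally_constant_sheaf_carrier[OF f] AB(3) by (auto simp: hom_def)
    qed simp
  qed
qed (rule function_presheaf_locally_constant)

section \<open>Coherent and trivial families\<close>

text \<open>In the vanishing coboundary at \<open>b # xs\<close>, deleting \<open>b\<close> gives
  the value at \<open>xs\<close>, and the other faces give the left side. This is the contracting
  homotopy with cone point \<open>b\<close>.\<close>

lemma asum_cone:
  assumes A: "comm_group A" "Well_order r" and f: "f \<in> carrier (all_cochains A r V n)"
    and df: "coboundary_map A r V n f = \<one>\<^bsub>all_cochains A r V (n + 1)\<^esub>"
    and b: "set (b # xs) \<subseteq> Field r" "x \<in> overlap V (b # xs)"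
  shows "asum A xs (\<lambda>zs. alt_ext A r V n f x (b # zs)) = alt_ext A r V n f x xs"
proof -
  interpret comm_group A by fact
  let ?F = "alt_ext A r V n f x"
  have F: "range ?F \<subseteq> carrier A" using alt_ext_range[OF A f] .
  have c: "asum A xs (\<lambda>zs. ?F (b # zs)) \<in> carrier A" "?F xs \<in> carrier A"
    using F by (auto intro!: asum_closed)
  have "asum A (b # xs) ?F = \<one>\<^bsub>A\<^esub>"
    using alt_ext_coboundary[OF A f b] alt_ext_one[OF A] df by metis
  then have "?F xs \<otimes>\<^bsub>A\<^esub> inv\<^bsub>A\<^esub> asum A xs (\<lambda>zs. ?F (b # zs)) = \<one>\<^bsub>A\<^esub>" by simp
  then have "?F xs = asum A xs (\<lambda>zs. ?F (b # zs))"
    using c by (metis inv_equality inv_inv inv_closed)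
  then show ?thesis by simp
qed

text \<open>The cone point \<open>b x\<close> is chosen separately for each \<open>x\<close>. This
  is legitimate among all functions, where nothing relates the values at different points.\<close>

lemma all_cochains_exact:
  assumes A: "comm_group A" "Well_order r" and cover: "(\<Union>i\<in>Field r. V i) = UNIV"
    and f: "f \<in> carrier (all_cochains A r V (n + 1))"
    and df: "coboundary_map A r V (n + 1) f = \<one>\<^bsub>all_cochains A r V (n + 2)\<^esub>"
  shows "\<exists>g\<in>carrier (all_cochains A r V n). coboundary_map A r V n g = f"
proof -
  have "\<forall>x. \<exists>i. i \<in> Field r \<and> x \<in> V i" using cover by blast
  then obtain b where b: "\<And>x. b x \<in> Field r \<and> x \<in> V (b x)" by metis
  define g where "g = (\<lambda>xs\<in>increasing_tuples r (n + 1). \<lambda>x\<in>overlap V xs.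
    alt_ext A r V (n + 1) f x (b x # xs))"
  have g: "g \<in> carrier (all_cochains A r V n)"
    using alt_ext_closed[OF A f] by (intro all_cochains_carrierI) (auto simp: g_def)
  have "coboundary_map A r V n g = f"
  proof (rule all_cochains_eqI)
    show "coboundary_map A r V n g \<in> carrier (all_cochains A r V (n + 1))"
      using A g by (rule coboundary_closed)
    show "f \<in> carrier (all_cochains A r V (n + 1))" by fact
    fix xs x assume xs: "xs \<in> increasing_tuples r (n + 1 + 1)" "x \<in> overlap V xs"
    have "coboundary_map A r V n g xs x = asum A xs (\<lambda>zs. alt_ext A r V (n + 1) f x (b x # zs))"
      using xs alt_ext_closed[OF A f] by (intro coboundary_eq_asum A) (auto simp: g_def)
    also have "\<dots> = alt_ext A r V (n + 1) f x xs"
      using b[of x] xs df by (intro asum_cone A f) (auto simp: increasing_tuples_def overlap_def)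
    also have "\<dots> = f xs x" using xs by (intro alt_ext_increasing A f)
    finally show "coboundary_map A r V n g xs x = f xs x" .
  qed
  then show ?thesis using g by blast
qed

lemma ordinal_rel_iff: "(a, b) \<in> ordinal_rel \<longleftrightarrow> a \<le> b"
  by (simp add: ordinal_rel_def)

lemma overlap_lessThan:
  assumes "xs \<in> increasing_tuples (ordinal_rel :: 'd::wellorder rel) (Suc n)"
  shows "overlap lessThan xs = {..<hd xs}" and "overlap atMost xs = {..hd xs}"
proof -
  obtain y ys where xs: "xs = y # ys" using assms by (cases xs) (auto simp: increasing_tuples_def)
  then have "y \<le> z" if "z \<in> set ys" for z
    using assms that by (auto simp: increasing_tuples_def ordinal_rel_iff)
  then show "overlap lessThan xs = {..<hd xs}" "overlap atMost xs = {..hd xs}"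
    unfolding xs overlap_def by (auto intro: less_le_trans order_trans)
qed

lemma product_group_cong:
  assumes "\<And>i. i \<in> I \<Longrightarrow> G i = H i" shows "product_group I G = product_group I H"
  using assms unfolding product_group_def by (auto cong: PiE_cong restrict_cong)

text \<open>Families with \<open>Suc m\<close> indices are cochains of degree \<open>m\<close>; this
  is the origin of the shift of degree between families and cohomology.\<close>

lemma families_eq:
  "families A (Suc m) = all_cochains A (ordinal_rel :: 'd::wellorder rel) lessThan m"
  unfolding families_def all_cochains_def
  by (simp, intro product_group_cong) (simp add: overlap_lessThan)

section \<open>Coherence and triviality as conditions on the coboundary\<close>

context
  assumes cof: "uncountable_cofinality TYPE('d::{wellorder, linorder_topology})"
  fixes A :: "'a monoid"
  assumes A: "comm_group A"
begin

interpretation comm_group A by (rule A)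

interpretation D: function_presheaf A "finite_support_presheaf A :: 'd set \<Rightarrow> _"
  by (rule function_presheaf_finite_support[OF A])

private abbreviation F where "F m \<equiv> all_cochains A ordinal_rel (lessThan :: 'd \<Rightarrow> 'd set) m"
private abbreviation dF where "dF m \<equiv> coboundary_map A ordinal_rel (lessThan :: 'd \<Rightarrow> 'd set) m"
private abbreviation CF where "CF m \<equiv> D.C ordinal_rel (lessThan :: 'd \<Rightarrow> 'd set) m"
private abbreviation ZF where "ZF \<equiv> cocycles A (finite_support_presheaf A) ordinal_rel (lessThan :: 'd \<Rightarrow> 'd set)"
private abbreviation BF where "BF \<equiv> coboundaries A (finite_support_presheaf A) ordinal_rel (lessThan :: 'd \<Rightarrow> 'd set)"

lemma finite_support_cochains_iff:
  assumes "f \<in> carrier (F m)"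
  shows "f \<in> CF m \<longleftrightarrow>
    (\<forall>xs\<in>increasing_tuples ordinal_rel (m + 1). finite {x \<in> {..<hd xs}. f xs x \<noteq> \<one>\<^bsub>A\<^esub>})"
proof -
  have "f \<in> CF m \<longleftrightarrow> (\<forall>xs\<in>increasing_tuples ordinal_rel (m + 1).
      finite {x \<in> overlap lessThan xs. f xs x \<noteq> \<one>\<^bsub>A\<^esub>})"
    using assms unfolding D.C_eq by (auto simp: all_cochains_def PiE_iff finite_support_presheaf_eq[OF A])
  then show ?thesis by (simp add: overlap_lessThan)
qed

lemma coherent_families_eq:
  "coherent_families A (Suc m) = {\<Phi> \<in> carrier (F m). dF m \<Phi> \<in> CF (m + 1)}"
proof -
  have "dF m \<Phi> xs x = alternating_sum A \<Phi> xs x"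
    if "xs \<in> increasing_tuples ordinal_rel (Suc (Suc m))" "x < hd xs" for \<Phi> xs x
    using that overlap_lessThan(1)[OF that(1)] by (simp add: coboundary_map_def)
  then have "{x \<in> {..<hd xs}. dF m \<Phi> xs x \<noteq> \<one>\<^bsub>A\<^esub>} =
      {x \<in> {..<hd xs}. alternating_sum A \<Phi> xs x \<noteq> \<one>\<^bsub>A\<^esub>}"
    if "xs \<in> increasing_tuples ordinal_rel (Suc (Suc m))" for \<Phi> xs
    using that by auto
  then have "(\<forall>xs\<in>increasing_tuples ordinal_rel (Suc m + 1).
        finite {x \<in> {..<hd xs}. alternating_sum A \<Phi> xs x \<noteq> \<one>\<^bsub>A\<^esub>}) \<longleftrightarrow>
      dF m \<Phi> \<in> CF (m + 1)" if "\<Phi> \<in> carrier (F m)" for \<Phi>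
    unfolding finite_support_cochains_iff[OF coboundary_closed[OF A Well_order_ordinal_rel that]]
    by (intro ball_cong) auto
  then show ?thesis
    unfolding coherent_families_def families_eq by (intro Collect_cong conj_cong) auto
qed

text \<open>Turns a function that trivialises a 1-coherent family into a cocycle of degree
  0.\<close>

lemma constant_cochain_cocycle:
  fixes \<phi> :: "'d \<Rightarrow> 'a"
  assumes "\<phi> \<in> UNIV \<rightarrow> carrier A"
  defines "\<Theta> \<equiv> \<lambda>xs\<in>increasing_tuples ordinal_rel (0 + 1). \<lambda>x\<in>overlap lessThan xs. \<phi> x"
  shows "\<Theta> \<in> carrier (F 0)" "dF 0 \<Theta> = \<one>\<^bsub>F 1\<^esub>"
proof -
  show \<Theta>: "\<Theta> \<in> carrier (F 0)"
    by (rule all_cochains_carrierI) (use assms in auto)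
  interpret M1: comm_group "F 1" by (rule comm_group_all_cochains[OF A])
  show "dF 0 \<Theta> = \<one>\<^bsub>F 1\<^esub>"
  proof (rule all_cochains_eqI)
    show "dF 0 \<Theta> \<in> carrier (F 1)"
      using coboundary_closed[OF A Well_order_ordinal_rel \<Theta>] by simp
    fix xs :: "'d list" and x assume xs: "xs \<in> increasing_tuples ordinal_rel (1 + 1)" "x \<in> overlap lessThan xs"
    then obtain a b where ab: "xs = [a, b]"
      by (auto simp: increasing_tuples_def length_Suc_conv numeral_2_eq_2)
    have \<phi>: "\<phi> x \<in> carrier A" using assms by auto
    have "dF 0 \<Theta> xs x = asum A xs (\<lambda>zs. \<phi> x)"
      using xs \<phi> by (intro coboundary_eq_asum A) (auto simp: \<Theta>_def)
    also have "\<dots> = \<one>\<^bsub>A\<^esub>" using \<phi> by (simp add: ab)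
    finally show "dF 0 \<Theta> xs x = \<one>\<^bsub>F 1\<^esub> xs x" using all_cochains_one[OF xs, of A] by simp
  qed (rule M1.one_closed)
qed

lemma cocycle_0_constant:
  assumes \<Theta>: "\<Theta> \<in> carrier (F 0)" "dF 0 \<Theta> = \<one>\<^bsub>F 1\<^esub>" and ab: "x < a" "a < b"
  shows "\<Theta> [a] x = \<Theta> [b] x"
proof -
  have xs: "[a, b] \<in> increasing_tuples ordinal_rel (0 + 2)" "x \<in> overlap lessThan [a, b]"
    "[a, b] \<in> increasing_tuples ordinal_rel (1 + 1)"
    using ab by (auto simp: increasing_tuples_def ordinal_rel_iff overlap_def)
  have c: "\<Theta> [a] x \<in> carrier A" "\<Theta> [b] x \<in> carrier A"
    using ab by (auto intro!: all_cochains_value[OF \<Theta>(1)] simp: increasing_tuples_def overlap_def)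
  \<comment> \<open>Spelling out the values at \<open>[a]\<close> and \<open>[b]\<close> lets
    \<open>asum\<close> be evaluated; elsewhere the extension merely keeps the function
    total.\<close>
  let ?F = "\<lambda>zs. if zs = [a] then \<Theta> [a] x else if zs = [b] then \<Theta> [b] x else
    alt_ext A ordinal_rel lessThan 0 \<Theta> x zs"
  have "dF 0 \<Theta> [a, b] x = asum A [a, b] ?F"
    using xs c alt_ext_closed[OF A Well_order_ordinal_rel \<Theta>(1)]
      alt_ext_increasing[OF A Well_order_ordinal_rel \<Theta>(1)]
    by (intro coboundary_eq_asum A) auto
  also have "\<dots> = \<Theta> [b] x \<otimes>\<^bsub>A\<^esub> inv\<^bsub>A\<^esub> \<Theta> [a] x" using c ab(2) by simp
  finally have "\<Theta> [b] x \<otimes>\<^bsub>A\<^esub> inv\<^bsub>A\<^esub> \<Theta> [a] x = \<one>\<^bsub>A\<^esub>"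
    using \<Theta>(2) all_cochains_one[OF xs(3,2), of A] by simp
  then show ?thesis using c by (metis inv_equality inv_inv inv_closed)
qed

text \<open>
  The families that are exactly trivial, without finite errors, are the cocycles: in degree 0 these
  are the restrictions of a single function, in positive degrees they are the coboundaries.
\<close>
lemma trivial_families_iff:
  "\<Phi> \<in> trivial_families A (Suc m) \<longleftrightarrow> \<Phi> \<in> carrier (F m) \<and>
     (\<exists>\<Theta>\<in>carrier (F m). dF m \<Theta> = \<one>\<^bsub>F (m + 1)\<^esub> \<and>
        (\<forall>xs\<in>increasing_tuples ordinal_rel (m + 1). finite {x \<in> {..<hd xs}. \<Theta> xs x \<noteq> \<Phi> xs x}))"
proof (cases m)
  case 0
  have single: "xs \<in> increasing_tuples (ordinal_rel :: 'd rel) (Suc 0) \<longleftrightarrow> (\<exists>b. xs = [b])" for xs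
    by (auto simp: increasing_tuples_def length_Suc_conv)
  have "(\<exists>\<phi>\<in>UNIV \<rightarrow> carrier A. \<forall>b. finite {x \<in> {..<b}. \<phi> x \<noteq> \<Phi> [b] x}) \<longleftrightarrow>
    (\<exists>\<Theta>\<in>carrier (F 0). dF 0 \<Theta> = \<one>\<^bsub>F 1\<^esub> \<and> (\<forall>b. finite {x \<in> {..<b}. \<Theta> [b] x \<noteq> \<Phi> [b] x}))"
    (is "?l \<longleftrightarrow> ?r")
  proof
    assume ?l
    then obtain \<phi> where \<phi>: "\<phi> \<in> UNIV \<rightarrow> carrier A" "\<And>b. finite {x \<in> {..<b}. \<phi> x \<noteq> \<Phi> [b] x}" by blast
    define \<Theta> where "\<Theta> = (\<lambda>xs\<in>increasing_tuples ordinal_rel (0 + 1). \<lambda>x\<in>overlap lessThan xs. \<phi> x)"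
    have "\<Theta> [b] x = \<phi> x" if "x < b" for b x
      using that single by (auto simp: \<Theta>_def overlap_def)
    then have eq: "{x \<in> {..<b}. \<Theta> [b] x \<noteq> \<Phi> [b] x} = {x \<in> {..<b}. \<phi> x \<noteq> \<Phi> [b] x}" for b by auto
    have "finite {x \<in> {..<b}. \<Theta> [b] x \<noteq> \<Phi> [b] x}" for b unfolding eq by (rule \<phi>(2))
    then show ?r using constant_cochain_cocycle[OF \<phi>(1), folded \<Theta>_def] by blast
  next
    assume ?r
    then obtain \<Theta> where \<Theta>: "\<Theta> \<in> carrier (F 0)" "dF 0 \<Theta> = \<one>\<^bsub>F 1\<^esub>"
      "\<And>b. finite {x \<in> {..<b}. \<Theta> [b] x \<noteq> \<Phi> [b] x}" by blast
    \<comment> \<open>\<open>\<Theta> [b]\<close> sees only points below \<open>b\<close>, so the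
      value at \<open>x\<close> is read off at some \<open>u x\<close> above \<open>x\<close>; the
      cocycle condition makes it independent of this choice.\<close>
    obtain u where u: "\<And>x :: 'd. x < u x" using no_maximum[OF cof] by metis
    define \<phi> where "\<phi> x = \<Theta> [u x] x" for x
    have "\<phi> x = \<Theta> [b] x" if "x < b" for b x
    proof (cases "u x" b rule: linorder_cases)
      case less
      then show ?thesis unfolding \<phi>_def by (rule cocycle_0_constant[OF \<Theta>(1,2) u])
    next
      case greater
      then show ?thesis unfolding \<phi>_def by (rule cocycle_0_constant[OF \<Theta>(1,2) that, symmetric])
    qed (simp add: \<phi>_def)
    then have eq: "{x \<in> {..<b}. \<phi> x \<noteq> \<Phi> [b] x} = {x \<in> {..<b}. \<Theta> [b] x \<noteq> \<Phi> [b] x}" for b by auto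
    have "finite {x \<in> {..<b}. \<phi> x \<noteq> \<Phi> [b] x}" for b unfolding eq by (rule \<Theta>(3))
    moreover have "\<phi> x \<in> carrier A" for x
      using u[of x] single by (auto simp: \<phi>_def overlap_def intro!: all_cochains_value[OF \<Theta>(1)])
    ultimately show ?l by (intro bexI[of _ \<phi>]) auto
  qed
  moreover have "(\<forall>xs\<in>increasing_tuples (ordinal_rel :: 'd rel) (Suc 0). Q xs) \<longleftrightarrow> (\<forall>b. Q [b])" for Q
    using single by auto
  ultimately show ?thesis
    unfolding 0 trivial_families_def families_eq by (simp add: 0)
next
  case (Suc k)
  have val: "dF k \<Psi> xs x = alternating_sum A \<Psi> xs x"
    if "xs \<in> increasing_tuples ordinal_rel (Suc (Suc k))" "x < hd xs" for \<Psi> xs x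
    using that overlap_lessThan(1)[OF that(1)] by (simp add: coboundary_map_def)
  have eq: "{x \<in> {..<hd xs}. alternating_sum A \<Psi> xs x \<noteq> \<Phi> xs x} = {x \<in> {..<hd xs}. dF k \<Psi> xs x \<noteq> \<Phi> xs x}"
    if "xs \<in> increasing_tuples ordinal_rel (Suc (Suc k))" for \<Psi> xs
    using val[OF that] by auto
  have "(\<exists>\<Psi>\<in>carrier (F k). \<forall>xs\<in>increasing_tuples ordinal_rel (Suc (Suc k)).
      finite {x \<in> {..<hd xs}. dF k \<Psi> xs x \<noteq> \<Phi> xs x}) \<longleftrightarrow>
    (\<exists>\<Theta>\<in>carrier (F m). dF m \<Theta> = \<one>\<^bsub>F (m + 1)\<^esub> \<and>
        (\<forall>xs\<in>increasing_tuples ordinal_rel (Suc (Suc k)). finite {x \<in> {..<hd xs}. \<Theta> xs x \<noteq> \<Phi> xs x}))"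
    (is "?l \<longleftrightarrow> ?r")
  proof
    assume ?l
    then obtain \<Psi> where \<Psi>: "\<Psi> \<in> carrier (F k)" "\<forall>xs\<in>increasing_tuples ordinal_rel (Suc (Suc k)).
      finite {x \<in> {..<hd xs}. dF k \<Psi> xs x \<noteq> \<Phi> xs x}" by blast
    then show ?r
      using coboundary_closed[OF A Well_order_ordinal_rel \<Psi>(1)]
        coboundary_coboundary[OF A Well_order_ordinal_rel \<Psi>(1)] Suc by auto
  next
    assume ?r
    then obtain \<Theta> where \<Theta>: "\<Theta> \<in> carrier (F (k + 1))" "dF (k + 1) \<Theta> = \<one>\<^bsub>F (k + 2)\<^esub>"
      "\<forall>xs\<in>increasing_tuples ordinal_rel (Suc (Suc k)). finite {x \<in> {..<hd xs}. \<Theta> xs x \<noteq> \<Phi> xs x}"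
      using Suc by auto
    then obtain \<Psi> where "\<Psi> \<in> carrier (F k)" "dF k \<Psi> = \<Theta>"
      using all_cochains_exact[OF A Well_order_ordinal_rel lessThan_cover(2)[OF cof] \<Theta>(1,2)] by blast
    then show ?l using \<Theta>(3) by blast
  qed
  then show ?thesis
    unfolding trivial_families_def families_eq by (simp add: Suc families_eq eq[simplified])
qed

text \<open>Write \<open>\<Phi>\<close> as a cocycle \<open>\<Theta>\<close> times a finitely
  supported \<open>\<eta>\<close>: then \<open>\<Phi>\<close> and \<open>\<eta>\<close> have the
  same coboundary. Conversely, if they do, their quotient is a cocycle that differs from
  \<open>\<Phi>\<close> by finite errors.\<close>

lemma trivial_families_eq:
  "trivial_families A (Suc m) = {\<Phi> \<in> carrier (F m). dF m \<Phi> \<in> dF m ` CF m}"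
proof -
  interpret h: group_hom "F m" "F (Suc m)" "dF m"
    using D.coboundary_group_hom[OF lessThan_cover(1)[OF cof], of m] by simp
  interpret F: comm_group "F m" by (rule comm_group_all_cochains[OF A])
  have CF: "\<eta> \<in> carrier (F m)" if "\<eta> \<in> CF m" for \<eta>
    using D.C_all_cochains[OF lessThan_cover(1)[OF cof] that] .
  have diff: "(\<Phi> \<otimes>\<^bsub>F m\<^esub> inv\<^bsub>F m\<^esub> \<Theta>) xs x = \<Phi> xs x \<otimes>\<^bsub>A\<^esub> inv\<^bsub>A\<^esub> \<Theta> xs x"
    "\<Phi> xs x \<in> carrier A" "\<Theta> xs x \<in> carrier A"
    if "\<Phi> \<in> carrier (F m)" "\<Theta> \<in> carrier (F m)" "xs \<in> increasing_tuples ordinal_rel (m + 1)" "x < hd xs"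
    for \<Phi> \<Theta> xs x
  proof -
    have x: "x \<in> overlap lessThan xs" using that overlap_lessThan(1)[of xs m] by simp
    show "(\<Phi> \<otimes>\<^bsub>F m\<^esub> inv\<^bsub>F m\<^esub> \<Theta>) xs x = \<Phi> xs x \<otimes>\<^bsub>A\<^esub> inv\<^bsub>A\<^esub> \<Theta> xs x"
      "\<Phi> xs x \<in> carrier A" "\<Theta> xs x \<in> carrier A"
      using all_cochains_mult[OF that(3) x, of A] all_cochains_inv[OF A that(2,3) x]
        all_cochains_value[OF that(1,3) x] all_cochains_value[OF that(2,3) x] by auto
  qed
  show ?thesis
  proof (intro equalityI subsetI)
    fix \<Phi> :: "'d list \<Rightarrow> 'd \<Rightarrow> 'a" assume "\<Phi> \<in> trivial_families A (Suc m)"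
    then obtain \<Theta> where \<Phi>: "\<Phi> \<in> carrier (F m)" and \<Theta>: "\<Theta> \<in> carrier (F m)" "dF m \<Theta> = \<one>\<^bsub>F (m + 1)\<^esub>"
      and fin: "\<And>xs. xs \<in> increasing_tuples ordinal_rel (m + 1) \<Longrightarrow> finite {x \<in> {..<hd xs}. \<Theta> xs x \<noteq> \<Phi> xs x}"
      unfolding trivial_families_iff by blast
    define \<eta> where "\<eta> = \<Phi> \<otimes>\<^bsub>F m\<^esub> inv\<^bsub>F m\<^esub> \<Theta>"
    have \<eta>: "\<eta> \<in> carrier (F m)" using \<Phi> \<Theta>(1) by (simp add: \<eta>_def)
    have "finite {x \<in> {..<hd xs}. \<eta> xs x \<noteq> \<one>\<^bsub>A\<^esub>}" if xs: "xs \<in> increasing_tuples ordinal_rel (m + 1)" for xs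
      by (rule finite_subset[OF _ fin[OF xs]]) (use diff[OF \<Phi> \<Theta>(1) xs] in \<open>auto simp: \<eta>_def\<close>)
    then have "\<eta> \<in> CF m" using finite_support_cochains_iff[OF \<eta>] by blast
    moreover have "dF m \<Phi> = dF m \<eta>" using \<Phi> \<Theta> by (simp add: \<eta>_def)
    ultimately show "\<Phi> \<in> {\<Phi> \<in> carrier (F m). dF m \<Phi> \<in> dF m ` CF m}" using \<Phi> by blast
  next
    fix \<Phi> assume "\<Phi> \<in> {\<Phi> \<in> carrier (F m). dF m \<Phi> \<in> dF m ` CF m}"
    then obtain \<eta> where \<Phi>: "\<Phi> \<in> carrier (F m)" and \<eta>: "\<eta> \<in> CF m" "dF m \<Phi> = dF m \<eta>" by blast
    define \<Theta> where "\<Theta> = \<Phi> \<otimes>\<^bsub>F m\<^esub> inv\<^bsub>F m\<^esub> \<eta>"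
    have \<Theta>: "\<Theta> \<in> carrier (F m)" using \<Phi> CF[OF \<eta>(1)] by (simp add: \<Theta>_def)
    have "dF m \<Theta> = \<one>\<^bsub>F (m + 1)\<^esub>" using \<Phi> CF[OF \<eta>(1)] \<eta>(2) by (simp add: \<Theta>_def)
    moreover have "finite {x \<in> {..<hd xs}. \<Theta> xs x \<noteq> \<Phi> xs x}"
      if xs: "xs \<in> increasing_tuples ordinal_rel (m + 1)" for xs
    proof (rule finite_subset)
      show "finite {x \<in> {..<hd xs}. \<eta> xs x \<noteq> \<one>\<^bsub>A\<^esub>}"
        using \<eta>(1) finite_support_cochains_iff[OF CF[OF \<eta>(1)]] xs by blast
    qed (use diff[OF \<Phi> CF[OF \<eta>(1)] xs] in \<open>auto simp: \<Theta>_def\<close>)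
    ultimately show "\<Phi> \<in> trivial_families A (Suc m)"
      unfolding trivial_families_iff using \<Phi> \<Theta> by blast
  qed
qed

text \<open>Both groups are preimages under the coboundary: of the finitely supported cochains, and
  of the coboundaries of such cochains.\<close>

lemma subquotient_coherent:
  "subquotient (F m) (coherent_families A (Suc m)) (trivial_families A (Suc m) :: ('d list \<Rightarrow> 'd \<Rightarrow> 'a) set)"
proof -
  note U = lessThan_cover(1)[OF cof]
  interpret h: group_hom "F m" "F (Suc m)" "dF m"
    using D.coboundary_group_hom[OF U, of m] by simp
  interpret F: comm_group "F m" by (rule comm_group_all_cochains[OF A])
  have preimage: "subgroup {\<Phi> \<in> carrier (F m). dF m \<Phi> \<in> S} (F m)" if S: "subgroup S (F (Suc m))" for S
    by (rule group.subgroupI[OF group_all_cochains[OF A]])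
      (auto simp: subgroup.m_closed[OF S] subgroup.m_inv_closed[OF S] subgroup.one_closed[OF S]
        intro!: exI[of _ "\<one>\<^bsub>F m\<^esub>"])
  have sub: "dF m ` CF m \<subseteq> CF (m + 1)" using D.coboundary_in_C[OF U] by blast
  show ?thesis
  proof (intro subquotient.intro subquotient_axioms.intro comm_group_all_cochains A)
    show "subgroup (coherent_families A (Suc m)) (F m)"
      unfolding coherent_families_eq using preimage[OF D.C_subgroup[OF U]] by simp
    show "subgroup (trivial_families A (Suc m)) (F m)"
      unfolding trivial_families_eq
      by (intro preimage h.subgroup_img_is_subgroup D.C_subgroup[OF U])
    show "trivial_families A (Suc m) \<subseteq> (coherent_families A (Suc m) :: ('d list \<Rightarrow> 'd \<Rightarrow> 'a) set)"
      unfolding coherent_families_eq trivial_families_eq using sub by blast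
  qed
qed

lemma subquotient_map_coboundary:
  "subquotient_map (F m) (coherent_families A (Suc m)) (trivial_families A (Suc m))
     (F (Suc m)) (ZF (Suc m))
     (BF (Suc m)) (dF m)"
proof -
  note U = lessThan_cover(1)[OF cof]
  interpret G: subquotient "F m" "coherent_families A (Suc m)" "trivial_families A (Suc m)"
    by (rule subquotient_coherent)
  interpret H: subquotient "F (Suc m)"
    "ZF (Suc m)"
    "BF (Suc m)"
    by (rule D.subquotient_cohomology[OF U]) simp
  show ?thesis
  proof
    show "dF m z \<in> ZF (Suc m)"
      if "z \<in> coherent_families A (Suc m)" for z
      using that coboundary_coboundary[OF A Well_order_ordinal_rel, of z lessThan m]
      by (auto simp: coherent_families_eq D.cocycles_eq)
    show "dF m (x \<otimes>\<^bsub>F m\<^esub> y) = dF m x \<otimes>\<^bsub>F (Suc m)\<^esub> dF m y"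
      if "x \<in> coherent_families A (Suc m)" "y \<in> coherent_families A (Suc m)" for x y
      using coboundary_mult[OF A Well_order_ordinal_rel G.Z_carrier[OF that(1)] G.Z_carrier[OF that(2)]] by simp
    show "dF m b \<in> BF (Suc m)"
      if "b \<in> trivial_families A (Suc m)" for b
      using that by (auto simp: trivial_families_eq D.coboundaries_Suc)
  qed
qed

text \<open>Injectivity is \<open>trivial_families_eq\<close>. A finitely supported cocycle is the
  coboundary of some family by exactness, and that family is coherent because its coboundary is
  finitely supported.\<close>

lemma coboundary_iso:
  "induced_map (F (Suc m)) (BF (Suc m)) (dF m)
     \<in> iso (coherent_mod_trivial (Suc m) A)
         (cover_cohomology (Suc m) A (finite_support_presheaf A) ordinal_rel (lessThan :: 'd \<Rightarrow> 'd set))"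
proof -
  note U = lessThan_cover(1)[OF cof]
  interpret m: subquotient_map "F m" "coherent_families A (Suc m)" "trivial_families A (Suc m)"
     "F (Suc m)" "ZF (Suc m)"
     "BF (Suc m)" "dF m"
    by (rule subquotient_map_coboundary)
  have "induced_map (F (Suc m)) (BF (Suc m)) (dF m)
      \<in> iso m.G.subquot m.H.subquot"
  proof (rule m.induced_iso)
    show "x \<in> trivial_families A (Suc m)"
      if "x \<in> coherent_families A (Suc m)"
        "dF m x \<in> BF (Suc m)" for x
      using that by (auto simp: trivial_families_eq coherent_families_eq D.coboundaries_Suc)
    fix y assume y: "y \<in> ZF (Suc m)"
    then have yC: "y \<in> CF (m + 1)" "dF (m + 1) y = \<one>\<^bsub>F (m + 2)\<^esub>" by (auto simp: D.cocycles_eq)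
    obtain x where x: "x \<in> carrier (F m)" "dF m x = y"
      using all_cochains_exact[OF A Well_order_ordinal_rel lessThan_cover(2)[OF cof]
          D.C_all_cochains[OF U yC(1)] yC(2)] by blast
    then have "x \<in> coherent_families A (Suc m)" using yC(1) by (simp add: coherent_families_eq)
    moreover have "y \<otimes>\<^bsub>F (Suc m)\<^esub> inv\<^bsub>F (Suc m)\<^esub> dF m x
        \<in> BF (Suc m)"
      using x(2) m.H.Z_carrier[OF y] subgroup.one_closed[OF m.H.B] by simp
    ultimately show "\<exists>x\<in>coherent_families A (Suc m). y \<otimes>\<^bsub>F (Suc m)\<^esub> inv\<^bsub>F (Suc m)\<^esub> dF m x
        \<in> BF (Suc m)" by blast
  qed
  then show ?thesis
    by (simp add: coherent_mod_trivial_def families_eq cover_cohomology_subquot)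
qed

end

text \<open>The second statement is what inverting the natural isomorphism requires.\<close>

lemma coherent_natural:
  assumes cof: "uncountable_cofinality TYPE('d::{wellorder, linorder_topology})"
  shows "naturally_isomorphic
    (coherent_mod_trivial (Suc m) :: 'a monoid \<Rightarrow> ('d list \<Rightarrow> 'd \<Rightarrow> 'a) set monoid)
    (coherent_mod_trivial_change (Suc m))
    (\<lambda>A. cover_cohomology (Suc m) A (finite_support_presheaf A) ordinal_rel (lessThan :: 'd \<Rightarrow> 'd set))
    (cover_cohomology_change (Suc m) finite_support_presheaf ordinal_rel lessThan)"
    (is ?natural)
  and coherent_closed: "\<And>(A :: 'a monoid) B h c. comm_group A \<Longrightarrow> comm_group B \<Longrightarrow> h \<in> hom A B \<Longrightarrow>
    c \<in> carrier (coherent_mod_trivial (Suc m) A :: ('d list \<Rightarrow> 'd \<Rightarrow> 'a) set monoid) \<Longrightarrow>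
    coherent_mod_trivial_change (Suc m) B h c \<in> carrier (coherent_mod_trivial (Suc m) B)"
proof -
  note U = lessThan_cover(1)[OF cof]
  let ?M = "\<lambda>A n. all_cochains A ordinal_rel (lessThan :: 'd \<Rightarrow> 'd set) n"
  let ?d = "\<lambda>A n. coboundary_map A ordinal_rel (lessThan :: 'd \<Rightarrow> 'd set) n"
  let ?ch = "\<lambda>n h. cochain_change ordinal_rel (lessThan :: 'd \<Rightarrow> 'd set) n h :: ('d list \<Rightarrow> 'd \<Rightarrow> 'a) \<Rightarrow> _"
  let ?coh = "\<lambda>A. coherent_families A (Suc m) :: ('d list \<Rightarrow> 'd \<Rightarrow> 'a) set"
  let ?triv = "\<lambda>A. trivial_families A (Suc m) :: ('d list \<Rightarrow> 'd \<Rightarrow> 'a) set"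
  let ?B = "\<lambda>A. coboundaries A (finite_support_presheaf A) ordinal_rel (lessThan :: 'd \<Rightarrow> 'd set) (Suc m)"
  let ?\<theta> = "\<lambda>A. induced_map (?M A (Suc m)) (?B A) (?d A m)"
  have change: "coherent_mod_trivial_change (Suc m) B h =
      induced_map (?M B m) (?triv B) (?ch m h)" for B :: "'a monoid" and h
  proof -
    have "(\<lambda>\<Phi>. \<lambda>xs\<in>increasing_tuples ordinal_rel (Suc m). \<lambda>x\<in>{..<hd xs}. h (\<Phi> xs x)) = ?ch m h"
      unfolding cochain_change_def
      by (intro ext[of _ "cochain_change _ _ _ _", unfolded cochain_change_def] restrict_ext ext)
        (simp add: overlap_lessThan)
    then show ?thesis by (simp add: coherent_mod_trivial_change_def families_eq)
  qed
  have step: "subquotient_map (?M A m) (?coh A) (?triv A) (?M B m) (?coh B) (?triv B) (?ch m h)"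
    and commute: "\<And>\<Phi>. \<Phi> \<in> ?coh A \<Longrightarrow> ?d B m (?ch m h \<Phi>) = ?ch (m + 1) h (?d A m \<Phi>)"
    if AB: "comm_group A" "comm_group B" "h \<in> hom A B" for A B :: "'a monoid" and h
  proof -
    interpret change: coefficient_change A "finite_support_presheaf A :: 'd set \<Rightarrow> _" B "finite_support_presheaf B" h
      using coefficient_functor_finite_support AB by (rule coefficient_functorD)
    interpret G: subquotient "?M A m" "?coh A" "?triv A" by (rule subquotient_coherent[OF cof AB(1)])
    interpret H: subquotient "?M B m" "?coh B" "?triv B" by (rule subquotient_coherent[OF cof AB(2)])
    have comm: "?d B m (?ch m h \<Phi>) = ?ch (m + 1) h (?d A m \<Phi>)" if "\<Phi> \<in> carrier (?M A m)" for \<Phi>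
      using Well_order_ordinal_rel that by (rule change.coboundary_cochain_change)
    then show "?d B m (?ch m h \<Phi>) = ?ch (m + 1) h (?d A m \<Phi>)" if "\<Phi> \<in> ?coh A" for \<Phi>
      using G.Z_carrier[OF that] by blast
    show "subquotient_map (?M A m) (?coh A) (?triv A) (?M B m) (?coh B) (?triv B) (?ch m h)"
    proof
      fix z assume z: "z \<in> ?coh A"
      then show "?ch m h z \<in> ?coh B"
        using comm[OF G.Z_carrier[OF z]] change.cochain_change_closed[OF G.Z_carrier[OF z]]
          change.cochain_change_in_C[OF U]
        by (simp add: coherent_families_eq[OF cof AB(1)] coherent_families_eq[OF cof AB(2)])
    next
      fix x y assume "x \<in> ?coh A" "y \<in> ?coh A"
      then show "?ch m h (x \<otimes>\<^bsub>?M A m\<^esub> y) = ?ch m h x \<otimes>\<^bsub>?M B m\<^esub> ?ch m h y"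
        by (intro change.cochain_change_mult G.Z_carrier)
    next
      fix b assume "b \<in> ?triv A"
      then obtain \<eta> where b: "b \<in> carrier (?M A m)" and
        \<eta>: "\<eta> \<in> change.dom.C ordinal_rel lessThan m" "?d A m b = ?d A m \<eta>"
        by (auto simp: trivial_families_eq[OF cof AB(1)])
      have "?d B m (?ch m h b) = ?d B m (?ch m h \<eta>)"
        using comm[OF b] comm[OF change.dom.C_all_cochains[OF U \<eta>(1)]] \<eta>(2) by simp
      then show "?ch m h b \<in> ?triv B"
        using change.cochain_change_in_C[OF U \<eta>(1)] change.cochain_change_closed[OF b]
        by (simp add: trivial_families_eq[OF cof AB(2)])
    qed
  qed
  have carrier: "carrier (coherent_mod_trivial (Suc m) A) = (\<lambda>z. ?triv A #>\<^bsub>?M A m\<^esub> z) ` ?coh A"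
    if "comm_group A" for A :: "'a monoid"
    using subquotient.carrier_subquot[OF subquotient_coherent[OF cof that]]
    by (simp add: coherent_mod_trivial_def families_eq)
  show "coherent_mod_trivial_change (Suc m) B h c \<in> carrier (coherent_mod_trivial (Suc m) B)"
    if AB: "comm_group A" "comm_group B" "h \<in> hom A B"
      and c: "c \<in> carrier (coherent_mod_trivial (Suc m) A :: ('d list \<Rightarrow> 'd \<Rightarrow> 'a) set monoid)"
    for A B :: "'a monoid" and h c
  proof -
    interpret subquotient_map "?M A m" "?coh A" "?triv A" "?M B m" "?coh B" "?triv B" "?ch m h"
      using AB by (rule step)
    obtain \<Phi> where \<Phi>: "\<Phi> \<in> ?coh A" "c = ?triv A #>\<^bsub>?M A m\<^esub> \<Phi>" using c carrier[OF AB(1)] by auto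
    then show ?thesis
      unfolding change carrier[OF AB(2)] using induced_coset closed by simp
  qed
  show ?natural
  proof (rule naturally_isomorphicI[of ?\<theta>])
    fix A :: "'a monoid" assume A: "comm_group A"
    show "?\<theta> A \<in> iso (coherent_mod_trivial (Suc m) A)
        (cover_cohomology (Suc m) A (finite_support_presheaf A) ordinal_rel lessThan)"
      by (rule coboundary_iso[OF cof A])
    fix B :: "'a monoid" and h c
    assume B: "comm_group B" "h \<in> hom A B"
      and c: "c \<in> carrier (coherent_mod_trivial (Suc m) A :: ('d list \<Rightarrow> 'd \<Rightarrow> 'a) set monoid)"
    interpret s: subquotient_map "?M A m" "?coh A" "?triv A" "?M B m" "?coh B" "?triv B" "?ch m h"
      using A B by (rule step)
    interpret dA: subquotient_map "?M A m" "?coh A" "?triv A" "?M A (Suc m)"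
      "cocycles A (finite_support_presheaf A) ordinal_rel (lessThan :: 'd \<Rightarrow> 'd set) (Suc m)" "?B A" "?d A m"
      by (rule subquotient_map_coboundary[OF cof A])
    interpret dB: subquotient_map "?M B m" "?coh B" "?triv B" "?M B (Suc m)"
      "cocycles B (finite_support_presheaf B) ordinal_rel (lessThan :: 'd \<Rightarrow> 'd set) (Suc m)" "?B B" "?d B m"
      by (rule subquotient_map_coboundary[OF cof B(1)])
    interpret change: coefficient_change A "finite_support_presheaf A :: 'd set \<Rightarrow> _" B "finite_support_presheaf B" h
      using coefficient_functor_finite_support A B by (rule coefficient_functorD)
    obtain \<Phi> where \<Phi>: "\<Phi> \<in> ?coh A" "c = ?triv A #>\<^bsub>?M A m\<^esub> \<Phi>" using c carrier[OF A] by auto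
    show "?\<theta> B (coherent_mod_trivial_change (Suc m) B h c) =
        cover_cohomology_change (Suc m) finite_support_presheaf ordinal_rel lessThan B h (?\<theta> A c)"
      unfolding change cover_cohomology_change_eq \<Phi>(2) s.induced_coset[OF \<Phi>(1)]
        dB.induced_coset[OF s.closed[OF \<Phi>(1)]] dA.induced_coset[OF \<Phi>(1)]
        change.change_class[OF U zero_less_Suc dA.closed[OF \<Phi>(1)]] commute[OF A B \<Phi>(1)]
      by simp
  qed
qed

lemma cohomology_coherent_natural:
  assumes cof: "uncountable_cofinality TYPE('d::{wellorder, linorder_topology})"
  shows "naturally_isomorphic
    (\<lambda>A. cover_cohomology (Suc m) A (finite_support_presheaf A) ordinal_rel (lessThan :: 'd \<Rightarrow> 'd set))
    (cover_cohomology_change (Suc m) finite_support_presheaf ordinal_rel lessThan)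
    (coherent_mod_trivial (Suc m) :: 'a monoid \<Rightarrow> ('d list \<Rightarrow> 'd \<Rightarrow> 'a) set monoid)
    (coherent_mod_trivial_change (Suc m))"
proof (rule naturally_isomorphic_sym[OF coherent_natural(1)[OF cof]])
  show "Group.group (coherent_mod_trivial (Suc m) A :: ('d list \<Rightarrow> 'd \<Rightarrow> 'a) set monoid)"
    if "comm_group A" for A :: "'a monoid"
    using subquotient.comm_group_subquot[OF subquotient_coherent[OF cof that], of m]
    by (simp add: coherent_mod_trivial_def families_eq comm_group.axioms(2))
qed (rule coherent_closed[OF cof])

section \<open>From locally constant to finitely supported functions\<close>

text \<open>
  On a compact interval \<open>{..a}\<close> a locally constant function is determined by its value at the least
  element and its finitely many jumps, the nontrivial quotients of its values at successive points.
  Since constants contribute no cohomology, this identifies the cohomology of the two sheaves for the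
  covers \<open>atMost\<close> and \<open>lessThan\<close>.
\<close>
definition next_elem :: "'d::wellorder \<Rightarrow> 'd" where
  "next_elem x = (LEAST y. x < y)"

text \<open>Leads from the cover by \<open>{..a}\<close> to the cover by \<open>{..<a}\<close>: if
  \<open>x\<close> is below \<open>a\<close>, its successor is still in \<open>{..a}\<close>, so
  both values are defined.\<close>

definition jumps :: "'a monoid \<Rightarrow> nat \<Rightarrow> ('d::wellorder list \<Rightarrow> 'd \<Rightarrow> 'a) \<Rightarrow> ('d list \<Rightarrow> 'd \<Rightarrow> 'a)" where
  "jumps A m f = (\<lambda>xs\<in>increasing_tuples ordinal_rel (m + 1). \<lambda>x\<in>overlap lessThan xs.
     f xs (next_elem x) \<otimes>\<^bsub>A\<^esub> inv\<^bsub>A\<^esub> f xs x)"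

text \<open>A discrete integral, right inverse to \<open>jumps\<close> and normalised to be trivial
  at the least element. Only nontrivial factors are multiplied, so that the index set is finite for
  finitely supported \<open>g\<close>.\<close>

definition partial_products :: "'a monoid \<Rightarrow> nat \<Rightarrow> ('d::wellorder list \<Rightarrow> 'd \<Rightarrow> 'a) \<Rightarrow> ('d list \<Rightarrow> 'd \<Rightarrow> 'a)" where
  "partial_products A m g = (\<lambda>xs\<in>increasing_tuples ordinal_rel (m + 1). \<lambda>x\<in>overlap atMost xs.
     (\<Otimes>\<^bsub>A\<^esub>y\<in>{y. y < x \<and> g xs y \<noteq> \<one>\<^bsub>A\<^esub>}. g xs y))"

lemma jumps_apply:
  "xs \<in> increasing_tuples ordinal_rel (m + 1) \<Longrightarrow> x \<in> overlap lessThan xs \<Longrightarrow>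
     jumps A m f xs x = f xs (next_elem x) \<otimes>\<^bsub>A\<^esub> inv\<^bsub>A\<^esub> f xs x"
  by (simp add: jumps_def)

context
  assumes cof: "uncountable_cofinality TYPE('d::{wellorder, linorder_topology})"
begin

lemma next_elem: "(x :: 'd) < next_elem x" "y \<le> x \<longleftrightarrow> y < next_elem x" "next_elem x \<le> y \<longleftrightarrow> x < y"
proof -
  show less: "x < next_elem x"
    unfolding next_elem_def using no_maximum[OF cof, of x] by (rule LeastI_ex)
  have le: "next_elem x \<le> y" if "x < y" for y
    unfolding next_elem_def using that by (rule Least_le)
  show "y \<le> x \<longleftrightarrow> y < next_elem x" "next_elem x \<le> y \<longleftrightarrow> x < y"
    using less le by (meson le_less_trans less_le_trans not_le)+
qed

lemma overlap_next_elem: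
  fixes xs :: "'d list"
  assumes "x \<in> overlap lessThan xs"
  shows "next_elem x \<in> overlap atMost xs" "x \<in> overlap atMost xs"
  using assms by (auto simp: overlap_def next_elem(3))

lemma locally_constant_neighbourhood:
  fixes a :: 'd
  assumes "f \<in> locally_constant_sheaf A {..a}" "x \<le> a"
  shows "(\<forall>y. x \<le> y) \<or> (\<exists>b<x. \<forall>y. b < y \<and> y \<le> x \<longrightarrow> f y = f x)"
proof -
  have "x \<in> {..a}" using assms(2) by simp
  with assms(1) obtain W where W: "open W" "x \<in> W" "W \<subseteq> {..a}" "\<forall>y\<in>W. f y = f x"
    by (rule locally_constant_sheafE)
  consider "\<forall>y. x \<le> y" | b where "b < x" "{b<..x} \<subseteq> W" using open_Ioc_left[OF W(1,2)] by blast
  then show ?thesis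
  proof cases
    case 2
    have "f y = f x" if "b < y \<and> y \<le> x" for y
    proof -
      have "y \<in> {b<..x}" using that by simp
      then show ?thesis using 2(2) W(4) by blast
    qed
    then show ?thesis using 2(1) by blast
  qed blast
qed

text \<open>\<open>f\<close> is constant on some \<open>{c<..b}\<close>, so a jump below
  \<open>b\<close> occurs at \<open>c\<close> or below \<open>c\<close>; the induction then descends
  to \<open>c\<close>.\<close>

lemma finite_jumps:
  fixes a :: 'd
  assumes f: "f \<in> locally_constant_sheaf A {..a}" and "b \<le> a"
  shows "finite {x \<in> {..<b}. f (next_elem x) \<noteq> f x}"
  using \<open>b \<le> a\<close>
proof (induction b rule: less_induct)
  case (less b)
  consider "\<forall>y. b \<le> y" | c where "c < b" "\<forall>y. c < y \<and> y \<le> b \<longrightarrow> f y = f b"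
    using locally_constant_neighbourhood[OF f less.prems] by blast
  then show ?case
  proof cases
    case 1
    then have "{x \<in> {..<b}. f (next_elem x) \<noteq> f x} = {}" by (auto simp: not_less)
    then show ?thesis by (simp only: finite.emptyI)
  next
    case 2
    have "{x \<in> {..<b}. f (next_elem x) \<noteq> f x} \<subseteq> insert c {x \<in> {..<c}. f (next_elem x) \<noteq> f x}"
    proof
      fix x assume x: "x \<in> {x \<in> {..<b}. f (next_elem x) \<noteq> f x}"
      have "\<not> c < x"
      proof
        assume "c < x"
        moreover have "x < b" using x by simp
        moreover have "x < next_elem x" "next_elem x \<le> b" using next_elem(1) next_elem(3) \<open>x < b\<close> by blast+
        ultimately have "f (next_elem x) = f b" "f x = f b" using 2(2) by (meson less_trans less_imp_le)+
        then show False using x by simp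
      qed
      then show "x \<in> insert c {x \<in> {..<c}. f (next_elem x) \<noteq> f x}" using x by auto
    qed
    moreover have "finite {x \<in> {..<c}. f (next_elem x) \<noteq> f x}"
      using less.IH[OF 2(1)] 2(1) less.prems by simp
    ultimately show ?thesis by (meson finite_insert finite_subset)
  qed
qed

text \<open>\<open>f\<close> is constant on some \<open>{c<..x}\<close>, which contains the
  successor of \<open>c\<close>. With no jump at \<open>c\<close>, the value at \<open>x\<close> is
  the value at \<open>c\<close>.\<close>

lemma locally_constant_without_jumps:
  fixes a :: 'd
  assumes f: "f \<in> locally_constant_sheaf A {..a}"
    and no_jump: "\<And>x. x < a \<Longrightarrow> f (next_elem x) = f x" and z: "\<forall>y. z \<le> y" and "x \<le> a"
  shows "f x = f z"
  using \<open>x \<le> a\<close>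
proof (induction x rule: less_induct)
  case (less x)
  consider "\<forall>y. x \<le> y" | c where "c < x" "\<forall>y. c < y \<and> y \<le> x \<longrightarrow> f y = f x"
    using locally_constant_neighbourhood[OF f less.prems] by blast
  then show ?case
  proof cases
    case 1
    then show ?thesis using z by (metis antisym)
  next
    case 2
    have "c < next_elem c" "next_elem c \<le> x" using next_elem(1) next_elem(3) 2(1) by blast+
    then have "f (next_elem c) = f x" using 2(2) by blast
    moreover have "f (next_elem c) = f c" using 2(1) less.prems by (intro no_jump) simp
    moreover have "f c = f z" using less.IH[OF 2(1)] 2(1) less.prems by simp
    ultimately show ?thesis by simp
  qed
qed

text \<open>Left of \<open>x\<close>, beyond the last nontrivial factor before \<open>x\<close>, the
  product does not change; to the right the neighbourhood is cut off by the open set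
  \<open>{..x}\<close>.\<close>

lemma partial_product_locally_constant:
  fixes a :: 'd
  assumes A: "comm_group A" and g: "\<And>x. x < a \<Longrightarrow> g x \<in> carrier A" "finite {x \<in> {..<a}. g x \<noteq> \<one>\<^bsub>A\<^esub>}"
  shows "(\<lambda>x\<in>{..a}. \<Otimes>\<^bsub>A\<^esub>y\<in>{y. y < x \<and> g y \<noteq> \<one>\<^bsub>A\<^esub>}. g y) \<in> locally_constant_sheaf A {..a}"
proof (rule locally_constant_sheafI)
  interpret comm_group A by fact
  show "(\<lambda>x\<in>{..a}. \<Otimes>\<^bsub>A\<^esub>y\<in>{y. y < x \<and> g y \<noteq> \<one>\<^bsub>A\<^esub>}. g y) \<in> {..a} \<rightarrow>\<^sub>E carrier A"
    using g(1) by (auto intro!: finprod_closed)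
  fix x assume x: "x \<in> {..a}"
  let ?T = "{y. y < x \<and> g y \<noteq> \<one>\<^bsub>A\<^esub>}"
  have fin: "finite ?T" by (rule finite_subset[OF _ g(2)]) (use x in auto)
  have "\<exists>W. open W \<and> x \<in> W \<and> W \<subseteq> {..x} \<and> (\<forall>w\<in>W. \<forall>y\<in>?T. y < w)"
  proof (cases "?T = {}")
    case True
    then show ?thesis using open_atMost[OF cof, of x] by (intro exI[of _ "{..x}"]) auto
  next
    case False
    define b where "b = Max ?T"
    have b: "b < x" using Max_in[OF fin False] unfolding b_def by blast
    have "y \<le> b" if "y \<in> ?T" for y using Max_ge[OF fin that] unfolding b_def .
    then have "\<forall>w\<in>{b<..} \<inter> {..x}. \<forall>y\<in>?T. y < w" by (meson IntD1 greaterThan_iff le_less_trans)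
    moreover have "open ({b<..} \<inter> {..x})" using open_atMost[OF cof, of x] open_greaterThan by blast
    ultimately show ?thesis using b by (intro exI[of _ "{b<..} \<inter> {..x}"] conjI) simp_all
  qed
  then obtain W where W: "open W" "x \<in> W" "W \<subseteq> {..x}" "\<And>w y. w \<in> W \<Longrightarrow> y \<in> ?T \<Longrightarrow> y < w" by blast
  have "{y. y < w \<and> g y \<noteq> \<one>\<^bsub>A\<^esub>} = ?T" if "w \<in> W" for w
    using W(3,4) that by fastforce
  moreover have Wa: "W \<subseteq> {..a}" using W(3) x by auto
  ultimately have "(\<lambda>x\<in>{..a}. \<Otimes>\<^bsub>A\<^esub>y\<in>{y. y < x \<and> g y \<noteq> \<one>\<^bsub>A\<^esub>}. g y) w =
      (\<lambda>x\<in>{..a}. \<Otimes>\<^bsub>A\<^esub>y\<in>{y. y < x \<and> g y \<noteq> \<one>\<^bsub>A\<^esub>}. g y) x" if "w \<in> W" for w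
    using subsetD[OF Wa that] x that by (simp only: restrict_apply' simp_thms)
  then show "\<exists>W. open W \<and> x \<in> W \<and> W \<subseteq> {..a} \<and>
      (\<forall>w\<in>W. (\<lambda>x\<in>{..a}. \<Otimes>\<^bsub>A\<^esub>y\<in>{y. y < x \<and> g y \<noteq> \<one>\<^bsub>A\<^esub>}. g y) w =
        (\<lambda>x\<in>{..a}. \<Otimes>\<^bsub>A\<^esub>y\<in>{y. y < x \<and> g y \<noteq> \<one>\<^bsub>A\<^esub>}. g y) x)"
    using W(1,2) Wa by blast
qed

lemma partial_product_next:
  fixes a :: 'd
  assumes A: "comm_group A" and g: "\<And>x. x < a \<Longrightarrow> g x \<in> carrier A" "finite {x \<in> {..<a}. g x \<noteq> \<one>\<^bsub>A\<^esub>}"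
    and x: "x < a"
  shows "(\<Otimes>\<^bsub>A\<^esub>y\<in>{y. y < next_elem x \<and> g y \<noteq> \<one>\<^bsub>A\<^esub>}. g y) \<otimes>\<^bsub>A\<^esub>
    inv\<^bsub>A\<^esub> (\<Otimes>\<^bsub>A\<^esub>y\<in>{y. y < x \<and> g y \<noteq> \<one>\<^bsub>A\<^esub>}. g y) = g x"
proof -
  interpret comm_group A by fact
  let ?T = "{y. y < x \<and> g y \<noteq> \<one>\<^bsub>A\<^esub>}"
  have fin: "finite ?T" by (rule finite_subset[OF _ g(2)]) (use x in auto)
  have c: "finprod A g ?T \<in> carrier A" using g(1) x by (intro finprod_closed) auto
  have gx: "g x \<in> carrier A" using g(1) x by simp
  have "finprod A g {y. y < next_elem x \<and> g y \<noteq> \<one>\<^bsub>A\<^esub>} = g x \<otimes>\<^bsub>A\<^esub> finprod A g ?T"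
  proof (cases "g x = \<one>\<^bsub>A\<^esub>")
    case True
    then have "{y. y < next_elem x \<and> g y \<noteq> \<one>\<^bsub>A\<^esub>} = ?T" by (auto simp: next_elem(2)[symmetric] order_le_less)
    then show ?thesis using c True by simp
  next
    case False
    then have "{y. y < next_elem x \<and> g y \<noteq> \<one>\<^bsub>A\<^esub>} = insert x ?T"
      by (auto simp: next_elem(2)[symmetric] order_le_less)
    moreover have "g \<in> ?T \<rightarrow> carrier A" using g(1) x by (auto intro: less_trans)
    ultimately show ?thesis using fin gx by (simp only:) (subst finprod_insert, auto)
  qed
  then show ?thesis using c gx by (simp add: m_assoc)
qed

section \<open>The jump map on cochains and cohomology\<close>

context
  fixes A :: "'a monoid"
  assumes A: "comm_group A"
begin

interpretation comm_group A by (rule A)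

interpretation D: function_presheaf A "finite_support_presheaf A :: 'd set \<Rightarrow> _"
  by (rule function_presheaf_finite_support[OF A])

interpretation L: function_presheaf A "locally_constant_sheaf A :: 'd set \<Rightarrow> _"
  by (rule function_presheaf_locally_constant[OF A])

private abbreviation M where "M m \<equiv> all_cochains A ordinal_rel (lessThan :: 'd \<Rightarrow> 'd set) m"
private abbreviation N where "N m \<equiv> all_cochains A ordinal_rel (atMost :: 'd \<Rightarrow> 'd set) m"
private abbreviation dM where "dM m \<equiv> coboundary_map A ordinal_rel (lessThan :: 'd \<Rightarrow> 'd set) m"
private abbreviation dN where "dN m \<equiv> coboundary_map A ordinal_rel (atMost :: 'd \<Rightarrow> 'd set) m"
private abbreviation CD where "CD m \<equiv> D.C ordinal_rel (lessThan :: 'd \<Rightarrow> 'd set) m"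
private abbreviation CL where "CL m \<equiv> L.C ordinal_rel (atMost :: 'd \<Rightarrow> 'd set) m"
private abbreviation ZL where "ZL \<equiv> cocycles A (locally_constant_sheaf A) ordinal_rel (atMost :: 'd \<Rightarrow> 'd set)"
private abbreviation BL where "BL \<equiv> coboundaries A (locally_constant_sheaf A) ordinal_rel (atMost :: 'd \<Rightarrow> 'd set)"
private abbreviation ZD where "ZD \<equiv> cocycles A (finite_support_presheaf A) ordinal_rel (lessThan :: 'd \<Rightarrow> 'd set)"
private abbreviation BD where "BD \<equiv> coboundaries A (finite_support_presheaf A) ordinal_rel (lessThan :: 'd \<Rightarrow> 'd set)"

lemma jumps_closed:
  assumes "f \<in> carrier (N m)" shows "jumps A m f \<in> carrier (M m)"
proof (rule all_cochains_carrierI)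
  fix xs :: "'d list" and x assume xs: "xs \<in> increasing_tuples ordinal_rel (m + 1)" "x \<in> overlap lessThan xs"
  then show "jumps A m f xs x \<in> carrier A"
    using all_cochains_value[OF assms xs(1)] overlap_next_elem[OF xs(2)] by (simp add: jumps_apply)
qed (auto simp: jumps_def)

lemma jumps_mult:
  assumes f: "f \<in> carrier (N m)" and g: "g \<in> carrier (N m)"
  shows "jumps A m (f \<otimes>\<^bsub>N m\<^esub> g) = jumps A m f \<otimes>\<^bsub>M m\<^esub> jumps A m g"
proof (rule all_cochains_eqI)
  interpret M: comm_group "M m" by (rule comm_group_all_cochains[OF A])
  interpret N: comm_group "N m" by (rule comm_group_all_cochains[OF A])
  show "jumps A m (f \<otimes>\<^bsub>N m\<^esub> g) \<in> carrier (M m)" using f g by (intro jumps_closed N.m_closed)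
  show "jumps A m f \<otimes>\<^bsub>M m\<^esub> jumps A m g \<in> carrier (M m)" using f g by (intro jumps_closed M.m_closed)
  fix xs :: "'d list" and x assume xs: "xs \<in> increasing_tuples ordinal_rel (m + 1)" "x \<in> overlap lessThan xs"
  note o = overlap_next_elem[OF xs(2)]
  show "jumps A m (f \<otimes>\<^bsub>N m\<^esub> g) xs x = (jumps A m f \<otimes>\<^bsub>M m\<^esub> jumps A m g) xs x"
    unfolding all_cochains_mult[OF xs] jumps_apply[OF xs]
      all_cochains_mult[OF xs(1) o(1)] all_cochains_mult[OF xs(1) o(2)]
    using all_cochains_value[OF f xs(1) o(1)] all_cochains_value[OF f xs(1) o(2)]
      all_cochains_value[OF g xs(1) o(1)] all_cochains_value[OF g xs(1) o(2)]
    by (simp add: inv_mult m_ac)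
qed

text \<open>The coboundary acts at each point separately, so it commutes with comparing the values
  at \<open>next_elem x\<close> and at \<open>x\<close>.\<close>

lemma jumps_coboundary:
  assumes f: "f \<in> carrier (N m)"
  shows "jumps A (m + 1) (dN m f) = dM m (jumps A m f)"
proof (rule all_cochains_eqI)
  note wo = Well_order_ordinal_rel
  show "jumps A (m + 1) (dN m f) \<in> carrier (M (m + 1))"
    using coboundary_closed[OF A wo f] by (rule jumps_closed)
  show "dM m (jumps A m f) \<in> carrier (M (m + 1))"
    using A wo jumps_closed[OF f] by (rule coboundary_closed)
  fix xs :: "'d list" and x
  assume xs: "xs \<in> increasing_tuples ordinal_rel (m + 1 + 1)" "x \<in> overlap lessThan xs"
  note o = overlap_next_elem[OF xs(2)]
  let ?F = "\<lambda>x. alt_ext A ordinal_rel atMost m f x"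
  have F: "range (?F x) \<subseteq> carrier A" "?F x zs \<in> carrier A" for x zs
    using alt_ext_range[OF A wo f] alt_ext_closed[OF A wo f] by auto
  have "dM m (jumps A m f) xs x = asum A xs (\<lambda>zs. ?F (next_elem x) zs \<otimes>\<^bsub>A\<^esub> inv\<^bsub>A\<^esub> ?F x zs)"
  proof (rule coboundary_eq_asum[OF A])
    fix zs :: "'d list" assume zs: "zs \<in> increasing_tuples ordinal_rel (m + 1)" "x \<in> overlap lessThan zs"
    note o = overlap_next_elem[OF zs(2)]
    show "jumps A m f zs x = ?F (next_elem x) zs \<otimes>\<^bsub>A\<^esub> inv\<^bsub>A\<^esub> ?F x zs"
      unfolding jumps_apply[OF zs] alt_ext_increasing[OF A wo f zs(1) o(1)]
        alt_ext_increasing[OF A wo f zs(1) o(2)] ..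
  qed (use F xs in auto)
  also have "\<dots> = asum A xs (?F (next_elem x)) \<otimes>\<^bsub>A\<^esub> inv\<^bsub>A\<^esub> asum A xs (?F x)"
    using F by (simp add: asum_mult asum_inv image_subset_iff)
  also have "\<dots> = jumps A (m + 1) (dN m f) xs x"
    using xs o coboundary_alt_ext[OF A wo f, of xs] by (simp add: jumps_apply)
  finally show "jumps A (m + 1) (dN m f) xs x = dM m (jumps A m f) xs x" by simp
qed

lemma jumps_in_CD:
  assumes f: "f \<in> CL m" shows "jumps A m f \<in> CD m"
proof -
  have fN: "f \<in> carrier (N m)" using L.C_all_cochains[OF atMost_cover(1)[OF cof] f] .
  have "finite {x \<in> {..<hd xs}. jumps A m f xs x \<noteq> \<one>\<^bsub>A\<^esub>}"
    if xs: "xs \<in> increasing_tuples ordinal_rel (m + 1)" for xs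
  proof (rule finite_subset)
    have "f xs \<in> locally_constant_sheaf A {..hd xs}"
      using L.C_sections[OF f xs] overlap_lessThan(2)[of xs m] xs by simp
    then show "finite {x \<in> {..<hd xs}. f xs (next_elem x) \<noteq> f xs x}" by (rule finite_jumps) simp
    show "{x \<in> {..<hd xs}. jumps A m f xs x \<noteq> \<one>\<^bsub>A\<^esub>} \<subseteq> {x \<in> {..<hd xs}. f xs (next_elem x) \<noteq> f xs x}"
    proof
      fix x assume x: "x \<in> {x \<in> {..<hd xs}. jumps A m f xs x \<noteq> \<one>\<^bsub>A\<^esub>}"
      then have o: "x \<in> overlap lessThan xs" using overlap_lessThan(1)[of xs m] xs by simp
      have "f xs x \<in> carrier A" using all_cochains_value[OF fN xs overlap_next_elem(2)[OF o]] .
      then show "x \<in> {x \<in> {..<hd xs}. f xs (next_elem x) \<noteq> f xs x}"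
        using x jumps_apply[OF xs o, of A f] by auto
    qed
  qed
  then show ?thesis using finite_support_cochains_iff[OF cof A jumps_closed[OF fN]] by blast
qed

text \<open>Hence the jump map is onto already at the level of cochains.\<close>

lemma partial_products_in_CL:
  assumes g: "g \<in> CD m" shows "partial_products A m g \<in> CL m" "jumps A m (partial_products A m g) = g"
proof -
  have gM: "g \<in> carrier (M m)" using D.C_all_cochains[OF lessThan_cover(1)[OF cof] g] .
  have val: "g xs x \<in> carrier A" if "xs \<in> increasing_tuples ordinal_rel (m + 1)" "x < hd xs" for xs x
    using all_cochains_value[OF gM that(1)] overlap_lessThan(1)[of xs m] that by simp
  have fin: "finite {x \<in> {..<hd xs}. g xs x \<noteq> \<one>\<^bsub>A\<^esub>}" if "xs \<in> increasing_tuples ordinal_rel (m + 1)" for xs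
    using g finite_support_cochains_iff[OF cof A gM] that by blast
  show PL: "partial_products A m g \<in> CL m"
  proof (rule L.C_I)
    fix xs :: "'d list" assume xs: "xs \<in> increasing_tuples ordinal_rel (m + 1)"
    then have "overlap atMost xs = {..hd xs}" using overlap_lessThan(2)[of xs m] by simp
    then show "partial_products A m g xs \<in> locally_constant_sheaf A (overlap atMost xs)"
      using partial_product_locally_constant[OF A val[OF xs] fin[OF xs]] xs
      by (simp add: partial_products_def)
  qed (simp add: partial_products_def)
  show "jumps A m (partial_products A m g) = g"
  proof (rule all_cochains_eqI)
    show "jumps A m (partial_products A m g) \<in> carrier (M m)"
      using L.C_all_cochains[OF atMost_cover(1)[OF cof] PL] by (rule jumps_closed)
    fix xs :: "'d list" and x assume xs: "xs \<in> increasing_tuples ordinal_rel (m + 1)" "x \<in> overlap lessThan xs"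
    have "x < hd xs" using xs overlap_lessThan(1)[of xs m] by simp
    then show "jumps A m (partial_products A m g) xs x = g xs x"
      using partial_product_next[OF A val[OF xs(1)] fin[OF xs(1)]] xs(1) overlap_next_elem[OF xs(2)]
      by (simp add: jumps_apply[OF xs] partial_products_def)
  qed fact
qed

lemma no_jumps_constant:
  assumes f: "f \<in> CL m" and "jumps A m f = \<one>\<^bsub>M m\<^esub>" and z: "\<forall>y. z \<le> y"
    and xs: "xs \<in> increasing_tuples ordinal_rel (m + 1)" and x: "x \<in> overlap atMost xs"
  shows "f xs x = f xs z"
proof (rule locally_constant_without_jumps)
  have ov: "overlap atMost xs = {..hd xs}" "overlap lessThan xs = {..<hd xs}"
    using xs overlap_lessThan[of xs m] by simp_all
  show "f xs \<in> locally_constant_sheaf A {..hd xs}" using L.C_sections[OF f xs] ov by simp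
  show "x \<le> hd xs" using x ov by simp
  fix y assume "y < hd xs"
  then have y: "y \<in> overlap lessThan xs" using ov by simp
  have fN: "f \<in> carrier (N m)" using L.C_all_cochains[OF atMost_cover(1)[OF cof] f] .
  have "f xs y \<in> carrier A" "f xs (next_elem y) \<in> carrier A"
    using all_cochains_value[OF fN xs] overlap_next_elem[OF y] by auto
  moreover have "f xs (next_elem y) \<otimes>\<^bsub>A\<^esub> inv\<^bsub>A\<^esub> f xs y = \<one>\<^bsub>A\<^esub>"
    using jumps_apply[OF xs y, of A f] assms(2) all_cochains_one[OF xs y, of A] by simp
  ultimately show "f xs (next_elem y) = f xs y" by (metis inv_equality inv_inv inv_closed)
qed fact

text \<open>Constants are locally constant on every overlap, and every member contains the least
  element \<open>z\<close>. So the cone formed at the single point \<open>z\<close> stays in the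
  sheaf; \<open>z\<close> can also be the cone index, since it lies in \<open>{..z}\<close>.\<close>

lemma constant_cocycle_coboundary:
  assumes f: "f \<in> CL (m + 1)" and df: "dN (m + 1) f = \<one>\<^bsub>N (m + 2)\<^esub>"
    and z: "\<forall>y :: 'd. z \<le> y"
    and const: "\<And>xs x. xs \<in> increasing_tuples ordinal_rel (m + 1 + 1) \<Longrightarrow> x \<in> overlap atMost xs \<Longrightarrow> f xs x = f xs z"
  shows "f \<in> dN m ` CL m"
proof -
  note wo = Well_order_ordinal_rel and S = atMost_cover(1)[OF cof]
  have fN: "f \<in> carrier (N (m + 1))" using L.C_all_cochains[OF S f] .
  define k where "k = (\<lambda>xs\<in>increasing_tuples ordinal_rel (m + 1). \<lambda>x\<in>overlap atMost xs.
    alt_ext A ordinal_rel atMost (m + 1) f z (z # xs))"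
  have k: "k \<in> CL m"
  proof (rule L.C_I)
    fix xs :: "'d list" assume xs: "xs \<in> increasing_tuples ordinal_rel (m + 1)"
    have op: "open (overlap atMost xs)" using open_overlap[OF S, of xs] by simp
    have "(\<lambda>x\<in>overlap atMost xs. alt_ext A ordinal_rel atMost (m + 1) f z (z # xs))
        \<in> locally_constant_sheaf A (overlap atMost xs)"
      by (rule locally_constant_sheafI) (use op alt_ext_closed[OF A wo fN] in auto)
    then show "k xs \<in> locally_constant_sheaf A (overlap atMost xs)" using xs by (simp add: k_def)
  qed (simp add: k_def)
  have "dN m k = f"
  proof (rule all_cochains_eqI)
    show "dN m k \<in> carrier (N (m + 1))"
      using A wo L.C_all_cochains[OF S k] by (rule coboundary_closed)
    show "f \<in> carrier (N (m + 1))" by fact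
    fix xs :: "'d list" and x assume xs: "xs \<in> increasing_tuples ordinal_rel (m + 1 + 1)" "x \<in> overlap atMost xs"
    have z': "z \<in> overlap atMost xs" using z by (auto simp: overlap_def)
    have "dN m k xs x = asum A xs (\<lambda>zs. alt_ext A ordinal_rel atMost (m + 1) f z (z # zs))"
      using xs alt_ext_closed[OF A wo fN] by (intro coboundary_eq_asum A) (auto simp: k_def)
    also have "\<dots> = alt_ext A ordinal_rel atMost (m + 1) f z xs"
      using z df by (intro asum_cone A wo fN) (auto simp: overlap_def)
    also have "\<dots> = f xs z" using xs z' by (intro alt_ext_increasing A wo fN)
    also have "\<dots> = f xs x" using const[OF xs] by simp
    finally show "dN m k xs x = f xs x" .
  qed
  then show ?thesis using k by blast
qed

lemma subquotient_map_jumps: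
  "subquotient_map (N (Suc m)) (ZL (Suc m))
     (BL (Suc m))
     (M (Suc m)) (ZD (Suc m))
     (BD (Suc m)) (jumps A (Suc m))"
proof -
  note S = atMost_cover(1)[OF cof] and U = lessThan_cover(1)[OF cof]
  interpret G: subquotient "N (Suc m)"
    "ZL (Suc m)"
    "BL (Suc m)"
    by (rule L.subquotient_cohomology[OF S]) simp
  interpret H: subquotient "M (Suc m)"
    "ZD (Suc m)"
    "BD (Suc m)"
    by (rule D.subquotient_cohomology[OF U]) simp
  have one: "jumps A n \<one>\<^bsub>N n\<^esub> = \<one>\<^bsub>M n\<^esub>" for n
  proof -
    interpret j: group_hom "N n" "M n" "jumps A n"
      by (simp add: group_hom_def group_hom_axioms_def group_all_cochains A homI jumps_closed jumps_mult)
    show ?thesis by (rule j.hom_one)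
  qed
  show ?thesis
  proof
    fix f assume "f \<in> ZL (Suc m)"
    then have f: "f \<in> CL (Suc m)" "dN (Suc m) f = \<one>\<^bsub>N (Suc m + 1)\<^esub>" by (auto simp: L.cocycles_eq)
    then show "jumps A (Suc m) f \<in> ZD (Suc m)"
      using jumps_in_CD[OF f(1)] jumps_coboundary[OF L.C_all_cochains[OF S f(1)]] one[of "Suc m + 1"]
      by (simp add: D.cocycles_eq)
  next
    fix f g assume "f \<in> ZL (Suc m)"
      "g \<in> ZL (Suc m)"
    then show "jumps A (Suc m) (f \<otimes>\<^bsub>N (Suc m)\<^esub> g) = jumps A (Suc m) f \<otimes>\<^bsub>M (Suc m)\<^esub> jumps A (Suc m) g"
      by (intro jumps_mult G.Z_carrier)
  next
    fix f assume "f \<in> BL (Suc m)"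
    then obtain g where g: "g \<in> CL m" "f = dN m g" by (auto simp: L.coboundaries_Suc)
    then have "jumps A (Suc m) f = dM m (jumps A m g)"
      using jumps_coboundary[OF L.C_all_cochains[OF S g(1)]] by simp
    then show "jumps A (Suc m) f \<in> BD (Suc m)"
      using jumps_in_CD[OF g(1)] by (simp add: D.coboundaries_Suc)
  qed
qed

text \<open>The jump map is onto on cochains, and its kernel consists of cochains that are constant
  on each overlap, which have no cohomology in positive degrees. The argument of the long exact
  sequence is carried out on representatives.\<close>

lemma jumps_iso:
  "induced_map (M (Suc m)) (BD (Suc m)) (jumps A (Suc m))
     \<in> iso (cover_cohomology (Suc m) A (locally_constant_sheaf A) ordinal_rel (atMost :: 'd \<Rightarrow> 'd set))
         (cover_cohomology (Suc m) A (finite_support_presheaf A) ordinal_rel (lessThan :: 'd \<Rightarrow> 'd set))"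
proof -
  note S = atMost_cover(1)[OF cof] and U = lessThan_cover(1)[OF cof] and wo = Well_order_ordinal_rel
  interpret j: subquotient_map "N (Suc m)"
    "ZL (Suc m)"
    "BL (Suc m)" "M (Suc m)"
    "ZD (Suc m)"
    "BD (Suc m)" "jumps A (Suc m)"
    by (rule subquotient_map_jumps)
  define z :: 'd where "z = (LEAST y. True)"
  have z: "\<forall>y. z \<le> y" by (simp add: z_def Least_le)
  have "induced_map (M (Suc m)) (BD (Suc m)) (jumps A (Suc m))
      \<in> iso j.G.subquot j.H.subquot"
  proof (rule j.induced_iso)
    fix f assume f: "f \<in> ZL (Suc m)"
      and "jumps A (Suc m) f \<in> BD (Suc m)"
    then obtain g where g: "g \<in> CD m" "jumps A (Suc m) f = dM m g" by (auto simp: D.coboundaries_Suc)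
    \<comment> \<open>\<open>s\<close> is a coboundary with the same jumps as \<open>f\<close>, so
      the quotient \<open>f'\<close> has no jumps and is a coboundary as a constant cocycle.\<close>
    define s where "s = dN m (partial_products A m g)"
    note P = partial_products_in_CL[OF g(1)]
    have s: "s \<in> BL (Suc m)"
      using P(1) by (auto simp: s_def L.coboundaries_Suc)
    have js: "jumps A (Suc m) s = jumps A (Suc m) f"
      using jumps_coboundary[OF L.C_all_cochains[OF S P(1)]] P(2) g(2) by (simp add: s_def)
    have sZ: "s \<in> ZL (Suc m)"
      using s j.G.BZ by blast
    define f' where "f' = f \<otimes>\<^bsub>N (Suc m)\<^esub> inv\<^bsub>N (Suc m)\<^esub> s"
    have f': "f' \<in> ZL (Suc m)"
      using f sZ subgroup.m_closed[OF j.G.Z] subgroup.m_inv_closed[OF j.G.Z] by (simp add: f'_def)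
    have "jumps A (Suc m) f' = \<one>\<^bsub>M (Suc m)\<^esub>"
      using f sZ subgroup.m_inv_closed[OF j.G.Z sZ] j.closed[OF f] j.H.Z_carrier
      by (simp add: f'_def j.mult j.map_inv js)
    then have "f' \<in> dN m ` CL m"
      using f' no_jumps_constant[of f' "Suc m" z] z
      by (intro constant_cocycle_coboundary[of f' m z]) (auto simp: L.cocycles_eq)
    then have "f' \<in> BL (Suc m)"
      by (simp add: L.coboundaries_Suc)
    then have "f' \<otimes>\<^bsub>N (Suc m)\<^esub> s \<in> BL (Suc m)"
      using s by (rule subgroup.m_closed[OF j.G.B])
    then show "f \<in> BL (Suc m)"
      using j.G.Z_carrier[OF f] j.G.Z_carrier[OF sZ] by (simp add: f'_def j.G.m_assoc)
  next
    fix y assume y: "y \<in> ZD (Suc m)"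
    then have yD: "y \<in> CD (Suc m)" "dM (Suc m) y = \<one>\<^bsub>M (Suc m + 1)\<^esub>" by (auto simp: D.cocycles_eq)
    define x where "x = partial_products A (Suc m) y"
    have x: "x \<in> CL (Suc m)" "jumps A (Suc m) x = y"
      using partial_products_in_CL[OF yD(1)] by (simp_all add: x_def)
    have xN: "x \<in> carrier (N (Suc m))" using L.C_all_cochains[OF S x(1)] .
    have jdx: "jumps A (Suc m + 1) (dN (Suc m) x) = \<one>\<^bsub>M (Suc m + 1)\<^esub>"
      using jumps_coboundary[OF xN] x(2) yD(2) by simp
    have dx: "dN (Suc m) x \<in> CL (Suc m + 1)" using L.coboundary_in_C[OF S x(1)] .
    \<comment> \<open>The coboundary of \<open>x\<close> has no jumps, so it equals its value at the
      least element \<open>z\<close>, where all partial products are empty.\<close>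
    have "dN (Suc m) x = \<one>\<^bsub>N (Suc m + 1)\<^esub>"
    proof (rule all_cochains_eqI)
      show "dN (Suc m) x \<in> carrier (N (Suc m + 1))" using L.C_all_cochains[OF S dx] .
      show "\<one>\<^bsub>N (Suc m + 1)\<^esub> \<in> carrier (N (Suc m + 1))"
        using group_all_cochains[OF A] by (rule monoid.one_closed[OF group.is_monoid])
      fix xs :: "'d list" and u assume xs: "xs \<in> increasing_tuples ordinal_rel (Suc m + 1 + 1)" "u \<in> overlap atMost xs"
      have z': "z \<in> overlap atMost zs" for zs :: "'d list" using z by (auto simp: overlap_def)
      have "dN (Suc m) x xs u = dN (Suc m) x xs z"
        using dx jdx z xs by (rule no_jumps_constant)
      also have "\<dots> = asum A xs (\<lambda>_. \<one>\<^bsub>A\<^esub>)"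
      proof (rule coboundary_eq_asum[OF A])
        fix zs :: "'d list" assume "zs \<in> increasing_tuples ordinal_rel (Suc m + 1)"
        moreover have e: "{y'. y' < z \<and> y zs y' \<noteq> \<one>\<^bsub>A\<^esub>} = {}" using z by (auto simp: not_less)
        ultimately show "x zs z = \<one>\<^bsub>A\<^esub>"
          unfolding x_def partial_products_def using z' by (simp add: e del: Collect_empty_eq)
      qed (use xs z' in auto)
      finally show "dN (Suc m) x xs u = \<one>\<^bsub>N (Suc m + 1)\<^esub> xs u"
        using all_cochains_one[OF xs, of A] by simp
    qed
    then have "x \<in> ZL (Suc m)"
      using x(1) by (simp add: L.cocycles_eq)
    moreover have "y \<otimes>\<^bsub>M (Suc m)\<^esub> inv\<^bsub>M (Suc m)\<^esub> jumps A (Suc m) x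
        \<in> BD (Suc m)"
      using x(2) j.H.Z_carrier[OF y] subgroup.one_closed[OF j.H.B] by simp
    ultimately show "\<exists>x\<in>ZL (Suc m).
        y \<otimes>\<^bsub>M (Suc m)\<^esub> inv\<^bsub>M (Suc m)\<^esub> jumps A (Suc m) x
        \<in> BD (Suc m)" by blast
  qed
  then show ?thesis by (simp add: cover_cohomology_subquot)
qed

end

end

text \<open>A homomorphism of coefficients preserves the quotient of two values, so it commutes with
  \<open>jumps\<close> already on cochains.\<close>

lemma jumps_natural:
  assumes cof: "uncountable_cofinality TYPE('d::{wellorder, linorder_topology})"
  shows "naturally_isomorphic
    (\<lambda>A :: 'a monoid. cover_cohomology (Suc m) A (locally_constant_sheaf A) ordinal_rel (atMost :: 'd \<Rightarrow> 'd set))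
    (cover_cohomology_change (Suc m) locally_constant_sheaf ordinal_rel atMost)
    (\<lambda>A. cover_cohomology (Suc m) A (finite_support_presheaf A) ordinal_rel (lessThan :: 'd \<Rightarrow> 'd set))
    (cover_cohomology_change (Suc m) finite_support_presheaf ordinal_rel lessThan)"
proof (rule naturally_isomorphicI)
  note S = atMost_cover(1)[OF cof] and U = lessThan_cover(1)[OF cof]
  fix A :: "'a monoid" assume A: "comm_group A"
  let ?\<theta> = "\<lambda>A. induced_map (all_cochains A ordinal_rel (lessThan :: 'd \<Rightarrow> 'd set) (Suc m))
    (coboundaries A (finite_support_presheaf A) ordinal_rel lessThan (Suc m)) (jumps A (Suc m))"
  show "?\<theta> A \<in> iso (cover_cohomology (Suc m) A (locally_constant_sheaf A) ordinal_rel atMost)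
      (cover_cohomology (Suc m) A (finite_support_presheaf A) ordinal_rel lessThan)"
    by (rule jumps_iso[OF cof A])
  fix B :: "'a monoid" and h c
  assume B: "comm_group B" "h \<in> hom A B"
    and c: "c \<in> carrier (cover_cohomology (Suc m) A (locally_constant_sheaf A) ordinal_rel (atMost :: 'd \<Rightarrow> 'd set))"
  interpret L: coefficient_change A "locally_constant_sheaf A :: 'd set \<Rightarrow> _" B "locally_constant_sheaf B" h
    using coefficient_functor_locally_constant A B by (rule coefficient_functorD)
  interpret D: coefficient_change A "finite_support_presheaf A :: 'd set \<Rightarrow> _" B "finite_support_presheaf B" h
    using coefficient_functor_finite_support A B by (rule coefficient_functorD)
  interpret jA: subquotient_map "all_cochains A ordinal_rel (atMost :: 'd \<Rightarrow> 'd set) (Suc m)"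
    "cocycles A (locally_constant_sheaf A) ordinal_rel (atMost :: 'd \<Rightarrow> 'd set) (Suc m)"
    "coboundaries A (locally_constant_sheaf A) ordinal_rel atMost (Suc m)"
    "all_cochains A ordinal_rel (lessThan :: 'd \<Rightarrow> 'd set) (Suc m)"
    "cocycles A (finite_support_presheaf A) ordinal_rel (lessThan :: 'd \<Rightarrow> 'd set) (Suc m)"
    "coboundaries A (finite_support_presheaf A) ordinal_rel lessThan (Suc m)" "jumps A (Suc m)"
    by (rule subquotient_map_jumps[OF cof A])
  interpret jB: subquotient_map "all_cochains B ordinal_rel (atMost :: 'd \<Rightarrow> 'd set) (Suc m)"
    "cocycles B (locally_constant_sheaf B) ordinal_rel (atMost :: 'd \<Rightarrow> 'd set) (Suc m)"
    "coboundaries B (locally_constant_sheaf B) ordinal_rel atMost (Suc m)"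
    "all_cochains B ordinal_rel (lessThan :: 'd \<Rightarrow> 'd set) (Suc m)"
    "cocycles B (finite_support_presheaf B) ordinal_rel (lessThan :: 'd \<Rightarrow> 'd set) (Suc m)"
    "coboundaries B (finite_support_presheaf B) ordinal_rel lessThan (Suc m)" "jumps B (Suc m)"
    by (rule subquotient_map_jumps[OF cof B(1)])
  obtain f where f: "f \<in> cocycles A (locally_constant_sheaf A) ordinal_rel (atMost :: 'd \<Rightarrow> 'd set) (Suc m)"
    "c = cohomology_class A (locally_constant_sheaf A) (Suc m) ordinal_rel atMost f"
    using c L.dom.carrier_cohomology[OF S zero_less_Suc] by auto
  have fN: "f \<in> carrier (all_cochains A ordinal_rel atMost (Suc m))" using f(1) by (rule jA.G.Z_carrier)
  have "jumps B (Suc m) (cochain_change ordinal_rel atMost (Suc m) h f) =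
      cochain_change ordinal_rel lessThan (Suc m) h (jumps A (Suc m) f)"
  proof (rule all_cochains_eqI)
    show "jumps B (Suc m) (cochain_change ordinal_rel atMost (Suc m) h f)
        \<in> carrier (all_cochains B ordinal_rel lessThan (Suc m))"
      using L.cochain_change_closed[OF fN] by (rule jumps_closed[OF cof B(1)])
    show "cochain_change ordinal_rel lessThan (Suc m) h (jumps A (Suc m) f)
        \<in> carrier (all_cochains B ordinal_rel lessThan (Suc m))"
      using jumps_closed[OF cof A fN] by (rule D.cochain_change_closed)
    fix xs :: "'d list" and x
    assume xs: "xs \<in> increasing_tuples ordinal_rel (Suc m + 1)" "x \<in> overlap lessThan xs"
    note o = overlap_next_elem[OF cof xs(2)]
    show "jumps B (Suc m) (cochain_change ordinal_rel atMost (Suc m) h f) xs x =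
        cochain_change ordinal_rel lessThan (Suc m) h (jumps A (Suc m) f) xs x"
      unfolding jumps_apply[OF xs] D.cochain_change_apply[OF xs]
        L.cochain_change_apply[OF xs(1) o(1)] L.cochain_change_apply[OF xs(1) o(2)]
      using all_cochains_value[OF fN xs(1) o(1)] all_cochains_value[OF fN xs(1) o(2)] by simp
  qed
  then show "?\<theta> B (cover_cohomology_change (Suc m) locally_constant_sheaf ordinal_rel atMost B h c) =
      cover_cohomology_change (Suc m) finite_support_presheaf ordinal_rel lessThan B h (?\<theta> A c)"
    unfolding cover_cohomology_change_eq f(2) L.change_class[OF S zero_less_Suc f(1)]
      jB.induced_coset[OF L.change_cocycle[OF S zero_less_Suc f(1)]] jA.induced_coset[OF f(1)]
      D.change_class[OF U zero_less_Suc jA.closed[OF f(1)]]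
    by simp
qed

theorem theorem2p29:
  fixes A :: "'a monoid"
  assumes A: "comm_group A"
    and cof: "uncountable_cofinality TYPE('d::{wellorder, linorder_topology})"
  shows
    "(\<forall>(P :: 'd set \<Rightarrow> ('d \<Rightarrow> 'a) set) (n::nat) (r :: 'i rel) (V :: 'i \<Rightarrow> 'd set).
        presheaf_of_functions A P \<and> disjointly_additive P \<and> 0 < n \<and>
        enumerated_open_cover r V \<and> refines (V ` Field r) (range lessThan)
        \<longrightarrow> cech_cohomology n A P \<cong> cover_cohomology n A P r V)
     \<and>
     (\<forall>n>0.
        cech_cohomology n A (locally_constant_sheaf A :: 'd set \<Rightarrow> _)
          \<cong> cech_cohomology n A (finite_support_presheaf A :: 'd set \<Rightarrow> _)
      \<and> cech_cohomology n A (finite_support_presheaf A :: 'd set \<Rightarrow> _)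
          \<cong> cover_cohomology n A (finite_support_presheaf A) ordinal_rel (lessThan :: 'd \<Rightarrow> 'd set)
      \<and> naturally_isomorphic
          (\<lambda>A :: 'a monoid. cech_cohomology n A (locally_constant_sheaf A :: 'd set \<Rightarrow> _))
          (cech_cohomology_change n locally_constant_sheaf)
          (coherent_mod_trivial n :: 'a monoid \<Rightarrow> ('d list \<Rightarrow> 'd \<Rightarrow> 'a) set monoid)
          (coherent_mod_trivial_change n)
      \<and> naturally_isomorphic
          (\<lambda>A :: 'a monoid. cech_cohomology n A (finite_support_presheaf A :: 'd set \<Rightarrow> _))
          (cech_cohomology_change n finite_support_presheaf)
          (coherent_mod_trivial n :: 'a monoid \<Rightarrow> ('d list \<Rightarrow> 'd \<Rightarrow> 'a) set monoid)
          (coherent_mod_trivial_change n)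
      \<and> naturally_isomorphic
          (\<lambda>A :: 'a monoid. cover_cohomology n A (finite_support_presheaf A) ordinal_rel
                              (lessThan :: 'd \<Rightarrow> 'd set))
          (cover_cohomology_change n finite_support_presheaf ordinal_rel lessThan)
          (coherent_mod_trivial n :: 'a monoid \<Rightarrow> ('d list \<Rightarrow> 'd \<Rightarrow> 'a) set monoid)
          (coherent_mod_trivial_change n))"
proof (intro conjI allI impI, goal_cases)
  case (1 P n r V)
  then show ?case
    using A by (intro cech_cohomology_iso[OF cof] function_presheaf.intro) auto
next
  \<comment> \<open>For the locally constant functions the limit is taken at the cover by the sets
    \<open>{..a}\<close>, where the jump map starts.\<close>
  have cech_L: "naturally_isomorphic
      (\<lambda>A :: 'a monoid. cech_cohomology (Suc m) A (locally_constant_sheaf A :: 'd set \<Rightarrow> _))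
      (cech_cohomology_change (Suc m) locally_constant_sheaf)
      (\<lambda>A. cover_cohomology (Suc m) A (finite_support_presheaf A) ordinal_rel (lessThan :: 'd \<Rightarrow> 'd set))
      (cover_cohomology_change (Suc m) finite_support_presheaf ordinal_rel lessThan)" for m
    by (rule naturally_isomorphic_trans[OF cech_natural jumps_natural[OF cof]])
      (intro coefficient_functor_locally_constant atMost_cover[OF cof] zero_less_Suc)+
  have cech_D: "naturally_isomorphic
      (\<lambda>A :: 'a monoid. cech_cohomology (Suc m) A (finite_support_presheaf A :: 'd set \<Rightarrow> _))
      (cech_cohomology_change (Suc m) finite_support_presheaf)
      (\<lambda>A. cover_cohomology (Suc m) A (finite_support_presheaf A) ordinal_rel (lessThan :: 'd \<Rightarrow> 'd set))
      (cover_cohomology_change (Suc m) finite_support_presheaf ordinal_rel lessThan)" for m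
    by (intro cech_natural coefficient_functor_finite_support lessThan_cover[OF cof] zero_less_Suc)
  note coherent = cohomology_coherent_natural[OF cof]
  {
    case (2 n)
    then obtain m where n: "n = Suc m" using gr0_implies_Suc by blast
    have "cover_cohomology n A (finite_support_presheaf A) ordinal_rel (lessThan :: 'd \<Rightarrow> 'd set)
        \<cong> cech_cohomology n A (finite_support_presheaf A :: 'd set \<Rightarrow> _)"
      using function_presheaf.to_cech_iso[OF function_presheaf_finite_support[OF A] lessThan_cover[OF cof] 2]
      by (rule is_isoI)
    with naturally_isomorphic_iso[OF cech_L A] show ?case unfolding n by (rule iso_trans)
  next
    case (3 n)
    then show ?case using naturally_isomorphic_iso[OF cech_D A] gr0_implies_Suc by blast
  next
    case (4 n)
    then show ?case using naturally_isomorphic_trans[OF cech_L coherent] gr0_implies_Suc by blast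
  next
    case (5 n)
    then show ?case using naturally_isomorphic_trans[OF cech_D coherent] gr0_implies_Suc by blast
  next
    case (6 n)
    then show ?case using coherent gr0_implies_Suc by blast
  }
qed

end
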